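(* Let $0<\alpha\le1$, $t\ge0$, and let $A^\alpha_n(t)=n^{-\alpha/2}((\mathcal S^\alpha_{L^d(i,j),n}(t)))_{1\le i,j\le n}$, with input variables satisfying Assumption I and independent of the fractional Poisson process $N^\alpha$. (i) For $L^2(i,j)=(\max\{i,j\},\min\{i,j\})$, the matrix $n^{-1/2}A_n^\alpha(t)$ in $(\mathcal M_n(\mathcal A_{\mathbb P}),\tau_n=n^{-1}\mathbb E\,\mathrm{Trace})$ converges to the time-changed free Brownian motion variable $B^\alpha(t)$ in the polynomial algebra $\mathbb C\langle B^\alpha(t)\rangle$, with state given by $\tau((B^\alpha(t))^l)=\lim_{n\to\infty}\tau_n((n^{-1/2}A^\alpha_n(t))^l)$ for all $l\ge1$. (ii) If $L^1(i,j)=n/2-|n/2-|i-j||$, $1\le i,j\le n$, then $n^{-1/2}A^\alpha_n(t)$ converges algebraically to a variable whose moments determine a probability law, which is the law of $W(L^\alpha(t))$, where $\{W(t)\}_{t\ge0}$ is a standard Brownian motion independent of an inverse $\alpha$-stable subordinator $\{L^\alpha(t)\}_{t\ge0}$.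
   Context: $\{H^\alpha(t)\}_{t\ge0}$ is an $\alpha$-stable subordinator ($0<\alpha<1$): non-decreasing Lévy process with $\mathbb Ee^{-uH^\alpha(t)}=e^{-tu^\alpha}$, $u>0$. Its inverse is $L^\alpha(t)=\inf\{s\ge0:H^\alpha(s)\ge t\}$, and $L^1(t)=t$ for $\alpha=1$. The fractional Poisson process is $N^\alpha(t)=N(L^\alpha(t))$, with $N$ a homogeneous Poisson process of rate one independent of $L^\alpha$. (The process $L^\alpha$ is not to be confused with the link functions $L^1,L^2$.) Assumption I: $\{X_{i,j,k},X_{i,k}: i,j\ge0,\ k\ge1\}$ are independent real random variables with mean zero and variance one, and for each $l\ge3$, $\sup_{i,j,k}\mathbb E[|X_{i,j,k}|^l+|X_{i,k}|^l]<\infty$. Stopped walks (the same $N^\alpha$ for all entries): $\mathcal S^\alpha_{i,j,n}(t)=\sum_{k=1}^{N^\alpha(nt)}X_{i,j,k}$ (used for $L^2$, $d=2$) and $\mathcal S^\alpha_{i,n}(t)=\sum_{k=1}^{N^\alpha(nt)}X_{i,k}$ (used for $L^1$, $d=1$). $\mathcal A_{\mathbb P}=\cap_{1\le p<\infty}L^p(\mathbb P)$; $\mathcal M_n(\mathcal A_{\mathbb P})$ is the algebra of $n\times n$ matrices over it. Algebraic convergence of a single self-adjoint element means convergence of all its moments under $\tau_n$ to the moments of the limit. Free Brownian motion $\{B(t)\}_{t\ge0}$ in $(\mathcal A,\tau)$: self-adjoint elements with $B(0)=0$, freely independent increments, and $B(s+t)-B(s)$ semicircular with mean $0$ and variance $t$.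 The time-changed free Brownian motion is $B^\alpha(t)=B(L^\alpha(t))$, with $L^\alpha$ independent of $B$, and joint moments $$\hat\tau(B^\alpha(t_1)\cdots B^\alpha(t_l))=\int_{\mathbb R_+^l}\tau(B(x_1)\cdots B(x_l))\,\mathbb P\{L^\alpha(t_1)\in\mathrm dx_1,\dots,L^\alpha(t_l)\in\mathrm dx_l\}.$$ In particular its odd moments vanish and $\hat\tau((B^\alpha(t))^{2m})=\frac{(2m)!}{(m+1)!\,m!}\cdot\frac{t^{m\alpha}\Gamma(m+1)}{\Gamma(m\alpha+1)}$. The state in (i) is the restriction of $\hat\tau$. *)

theory Defs
  imports
    "HOL-Probability.Probability"
    "HOL-Computational_Algebra.Polynomial"
    "Jordan_Normal_Form.Matrix"
begin

section \<open>Stochastic processes in continuous time\<close>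

text \<open>
  Time is a real variable, and only times \<open>t \<ge> 0\<close> matter: every definition below leaves the values
  of a process at negative times unconstrained. Path regularity is required on every sample path
  (one may always discard a null event), so that compositions such as \<open>N (L t \<omega>) \<omega>\<close> are random
  variables even if the probability space is not complete.
\<close>

context prob_space
begin

definition independent_increments :: "(real \<Rightarrow> 'a \<Rightarrow> real) \<Rightarrow> bool" where
  "independent_increments X \<longleftrightarrow>
     (\<forall>t :: nat \<Rightarrow> real. \<forall>m. 0 \<le> t 0 \<longrightarrow> mono t \<longrightarrow>
        indep_vars (\<lambda>_. borel) (\<lambda>k \<omega>. X (t (Suc k)) \<omega> - X (t k) \<omega>) {..<m})"

definition levy_process :: "(real \<Rightarrow> 'a \<Rightarrow> real) \<Rightarrow> bool" where
  "levy_process X \<longleftrightarrow>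
     (\<forall>t\<ge>0. X t \<in> borel_measurable M) \<and>
     (AE \<omega> in M. X 0 \<omega> = 0) \<and>
     independent_increments X \<and>
     (\<forall>s\<ge>0. \<forall>t\<ge>0. distr M borel (\<lambda>\<omega>. X (s + t) \<omega> - X s \<omega>) = distr M borel (X t)) \<and>
     (\<forall>\<omega>\<in>space M.
        (\<forall>t\<ge>0. continuous (at_right t) (\<lambda>s. X s \<omega>)) \<and>
        (\<forall>t>0. \<exists>x. ((\<lambda>s. X s \<omega>) \<longlongrightarrow> x) (at_left t)))"

definition stable_subordinator :: "real \<Rightarrow> (real \<Rightarrow> 'a \<Rightarrow> real) \<Rightarrow> bool" where
  "stable_subordinator \<alpha> H \<longleftrightarrow>
     levy_process H \<and>
     (\<forall>\<omega>\<in>space M. mono_on {0..} (\<lambda>t. H t \<omega>)) \<and>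
     (\<forall>t\<ge>0. \<forall>u>0. expectation (\<lambda>\<omega>. exp (- u * H t \<omega>)) = exp (- t * u powr \<alpha>))"

end

text \<open>
  The value \<open>0\<close> on paths that never reach level \<open>t\<close> is a convention; for a stable subordinator
  these paths form a null event.
\<close>

definition first_passage :: "(real \<Rightarrow> 'a \<Rightarrow> real) \<Rightarrow> real \<Rightarrow> 'a \<Rightarrow> real" where
  "first_passage H t \<omega> =
     (if \<exists>s\<ge>0. H s \<omega> \<ge> t then Inf {s. 0 \<le> s \<and> H s \<omega> \<ge> t} else 0)"

definition time_change :: "(real \<Rightarrow> 'a \<Rightarrow> 'b) \<Rightarrow> (real \<Rightarrow> 'a \<Rightarrow> real) \<Rightarrow> real \<Rightarrow> 'a \<Rightarrow> 'b" where
  "time_change X L t \<omega> = X (L t \<omega>) \<omega>"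

context prob_space
begin

definition inverse_stable_subordinator :: "real \<Rightarrow> (real \<Rightarrow> 'a \<Rightarrow> real) \<Rightarrow> bool" where
  "inverse_stable_subordinator \<alpha> L \<longleftrightarrow>
     (if \<alpha> = 1 then \<forall>t\<ge>0. \<forall>\<omega>\<in>space M. L t \<omega> = t
      else \<exists>H. stable_subordinator \<alpha> H \<and>
               (\<forall>t\<ge>0. \<forall>\<omega>\<in>space M. L t \<omega> = first_passage H t \<omega>))"

definition poisson_process :: "(real \<Rightarrow> 'a \<Rightarrow> nat) \<Rightarrow> bool" where
  "poisson_process N \<longleftrightarrow>
     levy_process (\<lambda>t \<omega>. real (N t \<omega>)) \<and>
     (\<forall>t\<ge>0. N t \<in> measurable M (count_space UNIV)) \<and>
     (\<forall>t>0. distr M (count_space UNIV) (N t) = measure_pmf (poisson_pmf t))"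

definition brownian_motion :: "(real \<Rightarrow> 'a \<Rightarrow> real) \<Rightarrow> bool" where
  "brownian_motion W \<longleftrightarrow>
     (\<forall>t\<ge>0. W t \<in> borel_measurable M) \<and>
     (AE \<omega> in M. W 0 \<omega> = 0) \<and>
     independent_increments W \<and>
     (\<forall>s\<ge>0. \<forall>t>0. distributed M lborel (\<lambda>\<omega>. W (s + t) \<omega> - W s \<omega>) (normal_density 0 (sqrt t))) \<and>
     (\<forall>\<omega>\<in>space M. continuous_on {0..} (\<lambda>t. W t \<omega>))"

text \<open>
  Independence of two families: each is viewed as one random element of a product space, and the
  generated \<open>\<sigma>\<close>-algebras are independent.
\<close>

definition indep_families ::
  "'i set \<Rightarrow> 'b measure \<Rightarrow> ('i \<Rightarrow> 'a \<Rightarrow> 'b) \<Rightarrow> 'j set \<Rightarrow> 'c measure \<Rightarrow> ('j \<Rightarrow> 'a \<Rightarrow> 'c) \<Rightarrow> bool" where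
  "indep_families I S X J T Y \<longleftrightarrow>
     indep_set
       (sets (vimage_algebra (space M) (\<lambda>\<omega>. \<lambda>i\<in>I. X i \<omega>) (PiM I (\<lambda>_. S))))
       (sets (vimage_algebra (space M) (\<lambda>\<omega>. \<lambda>j\<in>J. Y j \<omega>) (PiM J (\<lambda>_. T))))"

end

section \<open>Input variables, link functions and random matrices\<close>

text \<open>
  All input variables as one family: \<open>Inl ((i, j), k)\<close> indexes \<open>X2 (i, j) k\<close> and \<open>Inr (i, k)\<close>
  indexes \<open>X1 i k\<close>.
\<close>

definition input_index :: "((nat \<times> nat) \<times> nat + nat \<times> nat) set" where
  "input_index = (UNIV \<times> {1..}) <+> (UNIV \<times> {1..})"

definition input_family ::
  "(nat \<times> nat \<Rightarrow> nat \<Rightarrow> 'a \<Rightarrow> real) \<Rightarrow> (nat \<Rightarrow> nat \<Rightarrow> 'a \<Rightarrow> real) \<Rightarrow>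
   (nat \<times> nat) \<times> nat + nat \<times> nat \<Rightarrow> 'a \<Rightarrow> real" where
  "input_family X2 X1 = case_sum (\<lambda>(ij, k). X2 ij k) (\<lambda>(i, k). X1 i k)"

definition (in prob_space) assumption_I ::
  "(nat \<times> nat \<Rightarrow> nat \<Rightarrow> 'a \<Rightarrow> real) \<Rightarrow> (nat \<Rightarrow> nat \<Rightarrow> 'a \<Rightarrow> real) \<Rightarrow> bool" where
  "assumption_I X2 X1 \<longleftrightarrow>
     indep_vars (\<lambda>_. borel) (input_family X2 X1) input_index \<and>
     (\<forall>a\<in>input_index.
        expectation (input_family X2 X1 a) = 0 \<and> variance (input_family X2 X1 a) = 1) \<and>
     (\<forall>l\<ge>3. (SUP i :: nat. SUP j :: nat. SUP k \<in> {1 :: nat..}.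
        \<integral>\<^sup>+\<omega>. ennreal (\<bar>X2 (i, j) k \<omega>\<bar> ^ l + \<bar>X1 i k \<omega>\<bar> ^ l) \<partial>M) < \<infinity>)"

definition link2 :: "nat \<Rightarrow> nat \<Rightarrow> nat \<Rightarrow> nat \<times> nat" where
  "link2 n i j = (max i j, min i j)"

text \<open>For \<open>1 \<le> i, j \<le> n\<close> the argument of the floor is a nonnegative integer.\<close>

definition link1 :: "nat \<Rightarrow> nat \<Rightarrow> nat \<Rightarrow> nat" where
  "link1 n i j = nat \<lfloor>real n / 2 - \<bar>real n / 2 - \<bar>real i - real j\<bar>\<bar>\<rfloor>"

definition stopped_walk :: "(nat \<Rightarrow> 'a \<Rightarrow> real) \<Rightarrow> ('a \<Rightarrow> nat) \<Rightarrow> 'a \<Rightarrow> real" where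
  "stopped_walk Y K \<omega> = (\<Sum>k=1..K \<omega>. Y k \<omega>)"

text \<open>
  A matrix of random variables is represented as a matrix-valued function on the sample space, so
  that the algebra operations are pointwise. Library matrices are indexed from \<open>0\<close>, hence the
  shifts by one.
\<close>

definition link_matrix ::
  "real \<Rightarrow> (nat \<Rightarrow> nat \<Rightarrow> nat \<Rightarrow> 'i) \<Rightarrow> ('i \<Rightarrow> nat \<Rightarrow> 'a \<Rightarrow> real) \<Rightarrow> (real \<Rightarrow> 'a \<Rightarrow> nat) \<Rightarrow>
   nat \<Rightarrow> real \<Rightarrow> 'a \<Rightarrow> complex mat" where
  "link_matrix \<alpha> link X N\<alpha> n t \<omega> =
     complex_of_real (real n powr (- \<alpha> / 2)) \<cdot>\<^sub>m
       mat n n (\<lambda>(i, j). complex_of_real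
         (stopped_walk (X (link n (Suc i) (Suc j))) (N\<alpha> (real n * t)) \<omega>))"

definition normalized_link_matrix ::
  "real \<Rightarrow> (nat \<Rightarrow> nat \<Rightarrow> nat \<Rightarrow> 'i) \<Rightarrow> ('i \<Rightarrow> nat \<Rightarrow> 'a \<Rightarrow> real) \<Rightarrow> (real \<Rightarrow> 'a \<Rightarrow> nat) \<Rightarrow>
   nat \<Rightarrow> real \<Rightarrow> 'a \<Rightarrow> complex mat" where
  "normalized_link_matrix \<alpha> link X N\<alpha> n t \<omega> =
     complex_of_real (real n powr (- 1 / 2)) \<cdot>\<^sub>m link_matrix \<alpha> link X N\<alpha> n t \<omega>"

definition Lp_intersection :: "'a measure \<Rightarrow> ('a \<Rightarrow> complex) set" where
  "Lp_intersection M =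
     {Y \<in> borel_measurable M. \<forall>p :: real. p \<ge> 1 \<longrightarrow> integrable M (\<lambda>\<omega>. norm (Y \<omega>) powr p)}"

definition random_matrix_algebra :: "'a measure \<Rightarrow> nat \<Rightarrow> ('a \<Rightarrow> complex mat) set" where
  "random_matrix_algebra M n =
     {A. (\<forall>\<omega>. A \<omega> \<in> carrier_mat n n) \<and>
         (\<forall>i<n. \<forall>j<n. (\<lambda>\<omega>. A \<omega> $$ (i, j)) \<in> Lp_intersection M)}"

definition mat_trace :: "complex mat \<Rightarrow> complex" where
  "mat_trace A = (\<Sum>i<dim_row A. A $$ (i, i))"

definition tau_n :: "'a measure \<Rightarrow> nat \<Rightarrow> ('a \<Rightarrow> complex mat) \<Rightarrow> complex" where
  "tau_n M n A = (\<integral>\<omega>. mat_trace (A \<omega>) \<partial>M) / of_nat n"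

section \<open>Noncommutative probability\<close>

locale nc_prob_space = vector_space scaleC
  for scaleC :: "complex \<Rightarrow> 'b :: ring_1 \<Rightarrow> 'b" +
  fixes star :: "'b \<Rightarrow> 'b"
    and \<tau> :: "'b \<Rightarrow> complex"
  assumes scale_mult_left: "scaleC c (a * b) = scaleC c a * b"
    and scale_mult_right: "scaleC c (a * b) = a * scaleC c b"
    and star_star: "star (star a) = a"
    and star_add: "star (a + b) = star a + star b"
    and star_scale: "star (scaleC c a) = scaleC (cnj c) (star a)"
    and star_mult: "star (a * b) = star b * star a"
    and state_add: "\<tau> (a + b) = \<tau> a + \<tau> b"
    and state_scale: "\<tau> (scaleC c a) = c * \<tau> a"
    and state_one: "\<tau> 1 = 1"
    and state_positive: "\<tau> (star a * a) \<in> \<real>\<^sub>\<ge>\<^sub>0"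

definition semicircle_density :: "real \<Rightarrow> real \<Rightarrow> real" where
  "semicircle_density v x = (if x\<^sup>2 \<le> 4 * v then sqrt (4 * v - x\<^sup>2) / (2 * pi * v) else 0)"

context nc_prob_space
begin

inductive_set star_subalgebra_generated :: "'b set \<Rightarrow> 'b set" for G :: "'b set" where
  one: "1 \<in> star_subalgebra_generated G"
| gen: "a \<in> G \<Longrightarrow> a \<in> star_subalgebra_generated G"
| add: "\<lbrakk>a \<in> star_subalgebra_generated G; b \<in> star_subalgebra_generated G\<rbrakk>
          \<Longrightarrow> a + b \<in> star_subalgebra_generated G"
| mult: "\<lbrakk>a \<in> star_subalgebra_generated G; b \<in> star_subalgebra_generated G\<rbrakk>
          \<Longrightarrow> a * b \<in> star_subalgebra_generated G"
| scale: "a \<in> star_subalgebra_generated G \<Longrightarrow> scaleC c a \<in> star_subalgebra_generated G"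
| star: "a \<in> star_subalgebra_generated G \<Longrightarrow> star a \<in> star_subalgebra_generated G"

definition freely_independent :: "'i set \<Rightarrow> ('i \<Rightarrow> 'b) \<Rightarrow> bool" where
  "freely_independent I a \<longleftrightarrow>
     (\<forall>js xs. length js = length xs \<longrightarrow> xs \<noteq> [] \<longrightarrow> set js \<subseteq> I \<longrightarrow>
        (\<forall>k<length xs. xs ! k \<in> star_subalgebra_generated {a (js ! k)} \<and> \<tau> (xs ! k) = 0) \<longrightarrow>
        (\<forall>k. Suc k < length js \<longrightarrow> js ! k \<noteq> js ! Suc k) \<longrightarrow>
        \<tau> (prod_list xs) = 0)"

text \<open>Centred semicircular element of variance \<open>v > 0\<close>.\<close>

definition semicircular :: "real \<Rightarrow> 'b \<Rightarrow> bool" where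
  "semicircular v a \<longleftrightarrow>
     star a = a \<and>
     (\<forall>l. \<tau> (a ^ l) = complex_of_real (\<integral>x. x ^ l * semicircle_density v x \<partial>lborel))"

definition free_brownian_motion :: "(real \<Rightarrow> 'b) \<Rightarrow> bool" where
  "free_brownian_motion B \<longleftrightarrow>
     (\<forall>t\<ge>0. star (B t) = B t) \<and>
     B 0 = 0 \<and>
     (\<forall>t :: nat \<Rightarrow> real. \<forall>m. 0 \<le> t 0 \<longrightarrow> mono t \<longrightarrow>
        freely_independent {..<m} (\<lambda>k. B (t (Suc k)) - B (t k))) \<and>
     (\<forall>s\<ge>0. \<forall>t>0. semicircular t (B (s + t) - B s))"

end

text \<open>
  The joint moment of the time-changed process \<open>B (L t\<^sub>1), \<dots>, B (L t\<^sub>l)\<close> for the list of times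
  \<open>ts = [t\<^sub>1, \<dots>, t\<^sub>l]\<close>: an integral over the positive orthant against the joint law of
  \<open>L t\<^sub>1, \<dots>, L t\<^sub>l\<close>.
\<close>

definition joint_law :: "'a measure \<Rightarrow> (real \<Rightarrow> 'a \<Rightarrow> real) \<Rightarrow> real list \<Rightarrow> (nat \<Rightarrow> real) measure" where
  "joint_law M L ts =
     distr M (PiM {..<length ts} (\<lambda>_. borel)) (\<lambda>\<omega>. \<lambda>i\<in>{..<length ts}. L (ts ! i) \<omega>)"

definition time_changed_moment ::
  "'a measure \<Rightarrow> (real \<Rightarrow> 'a \<Rightarrow> real) \<Rightarrow> ('b :: ring_1 \<Rightarrow> complex) \<Rightarrow> (real \<Rightarrow> 'b) \<Rightarrow> real list \<Rightarrow> complex"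
where
  "time_changed_moment M L \<tau> B ts =
     (LINT x:{x. \<forall>i<length ts. 0 \<le> x i}|joint_law M L ts.
        \<tau> (prod_list (map (\<lambda>i. B (x i)) [0..<length ts])))"

text \<open>
  Restriction to the polynomial algebra in the single variable \<open>B (L t)\<close>, realised as
  \<open>complex poly\<close> with the variable as its self-adjoint generator; the power \<open>l\<close> of the variable
  is \<open>monom 1 l\<close>.
\<close>

definition time_changed_state ::
  "'a measure \<Rightarrow> (real \<Rightarrow> 'a \<Rightarrow> real) \<Rightarrow> ('b :: ring_1 \<Rightarrow> complex) \<Rightarrow> (real \<Rightarrow> 'b) \<Rightarrow> real \<Rightarrow>
   complex poly \<Rightarrow> complex" where
  "time_changed_state M L \<tau> B t p =
     (\<Sum>l\<le>degree p. coeff p l * time_changed_moment M L \<tau> B (replicate l t))"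

text \<open>
  A law on the real line with finite moments that is the only law with these moments.
\<close>

definition moment_determinate :: "real measure \<Rightarrow> bool" where
  "moment_determinate \<mu> \<longleftrightarrow>
     prob_space \<mu> \<and> sets \<mu> = sets borel \<and> (\<forall>l :: nat. integrable \<mu> (\<lambda>x. x ^ l)) \<and>
     (\<forall>\<nu>. prob_space \<nu> \<longrightarrow> sets \<nu> = sets borel \<longrightarrow>
        (\<forall>l :: nat. integrable \<nu> (\<lambda>x. x ^ l) \<and> (\<integral>x. x ^ l \<partial>\<nu>) = (\<integral>x. x ^ l \<partial>\<mu>)) \<longrightarrow> \<nu> = \<mu>)"

end

theory Submission imports Defs begin

text \<open>
  Conditionally on the common number \<open>k\<close> of steps, the entries are independent walks \<open>S\<close> with
  \<open>E S\<^sup>2 = k\<close> and \<open>E S\<^sup>q = O(k ^ (q div 2))\<close>. In the expansion of the trace, closed walks in which every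
  input index occurs exactly twice therefore contribute \<open>k ^ (l div 2)\<close> each, those with an index occurring once
  contribute nothing, and the remaining ones are too few to matter. The random matrix enters only
  through the number of closed walks of the first kind: for \<open>link2\<close> they are, up to lower order, the depth-first
  traversals of plane trees, counted by Dyck paths, and for \<open>link1\<close> they are counted by perfect matchings.
  The subordinator enters only through \<open>E (N (L (n t)))\<^sup>m / n ^ (\<alpha> m) \<longlonglongrightarrow> E (L t)\<^sup>m\<close>, a consequence of
  self-similarity and of the factorial moments of the Poisson law.

  Laws are identified through Laplace transforms and Gaussian mixtures by a moment criterion: a law whose even moments are \<open>o((2 m)! / u ^ (2 m))\<close> for every \<open>u\<close> is determined by its moments, since its
  characteristic function is the sum of its moment series.
\<close>

section \<open>Moments, independence and random times\<close>

text \<open>All entries share one fractional Poisson clock, so they are dependent, and the limit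
  averages over the law of \<open>L t\<close> what a deterministic clock would give. Conditioning is
  harmless because the moment bound for walks has one constant for all indices and all
  \<open>k\<close>: main words and error words then carry the same moment of the clock and are
  compared by cardinality alone. In (ii) the law is claimed on every space that carries
  \<open>W\<close> and \<open>L'\<close>. It is therefore fixed once on \<open>M\<close> as a
  Gaussian mixture, and carried over because the law of an inverse subordinator depends only on
  \<alpha> and the time. Chernoff's bound for \<open>L t\<close> has a free parameter and so yields
  exponential moments of every rate, which is what the moment criterion asks of a Gaussian mixture.
  In (i) two points are not combinatorial: positivity of the limiting functional, which is an
  average of states, and measurability in the times of the joint moments of free Brownian motion, on
  which the passage from the joint law back to the sample space rests.\<close>

lemma real_distribution_eq_of_moments:
  assumes "real_distribution \<mu>" and "real_distribution \<nu>"
    and i\<mu>: "\<And>l. integrable \<mu> (\<lambda>x. x ^ l)" and i\<nu>: "\<And>l. integrable \<nu> (\<lambda>x. x ^ l)"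
    and eq: "\<And>l. (\<integral>x. x ^ l \<partial>\<nu>) = (\<integral>x. x ^ l \<partial>\<mu>)"
    and small: "\<And>t :: real. (\<lambda>m. t ^ (2 * m) / fact (2 * m) * (\<integral>x. x ^ (2 * m) \<partial>\<mu>)) \<longlonglongrightarrow> 0"
  shows "\<nu> = \<mu>"
proof (rule Levy_uniqueness)
  interpret mu: real_distribution \<mu> by fact
  interpret nu: real_distribution \<nu> by fact
  show "char \<nu> = char \<mu>"
  proof
    fix t :: real
    define S where "S m = (\<Sum>k\<le>2 * m. ((\<i> * t) ^ k / fact k) * (\<integral>x. x ^ k \<partial>\<mu>))" for m :: nat
    define e where "e m = 2 * (t ^ (2 * m) / fact (2 * m) * (\<integral>x. x ^ (2 * m) \<partial>\<mu>))" for m :: nat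
    \<comment> \<open>The Taylor remainder of the characteristic function involves an absolute
      moment; stopping at even order makes it an ordinary one.\<close>
    have ev: "\<bar>x\<bar> ^ (2 * m) = x ^ (2 * m)" for x :: real and m :: nat
      by (simp add: power_even_abs)
    have a: "cmod (char \<mu> t - S m) \<le> e m" for m
      using mu.char_approx1[of "2 * m" t] i\<mu> unfolding S_def e_def by (simp add: ev)
    have b: "cmod (char \<nu> t - S m) \<le> e m" for m
      using nu.char_approx1[of "2 * m" t] i\<nu> unfolding S_def e_def by (simp add: ev eq)
    have e: "e \<longlonglongrightarrow> 0"
      unfolding e_def by (rule tendsto_mult_right_zero[OF small])
    have lim: "S \<longlonglongrightarrow> c" if "\<And>m. cmod (c - S m) \<le> e m" for c
    proof (rule LIM_zero_cancel)
      have "(\<lambda>m. c - S m) \<longlonglongrightarrow> 0"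
        by (rule Lim_null_comparison[OF always_eventually e]) (use that in auto)
      then show "(\<lambda>m. S m - c) \<longlonglongrightarrow> 0"
        using tendsto_minus by fastforce
    qed
    then show "char \<nu> t = char \<mu> t"
      using LIMSEQ_unique[OF lim[OF b] lim[OF a]] by simp
  qed
qed fact+

section \<open>Independence, random indices and random times\<close>

context prob_space
begin

text \<open>A measurable functional of a family is measurable for the \<sigma>-algebra which the
  family generates, so independence passes down to it. Full state spaces place the restricted family
  in the product space, and measurability with respect to \<open>M\<close> comes out of independence
  itself.\<close>

lemma indep_families_imp_indep_var:
  fixes N1 N2 :: "'d measure"
  assumes ind: "indep_families I S X J T Y" and UNIV: "space S = UNIV" "space T = UNIV"
    and u: "u \<in> measurable (PiM I (\<lambda>_. S)) N1" and v: "v \<in> measurable (PiM J (\<lambda>_. T)) N2"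
  shows "indep_var N1 (\<lambda>\<omega>. u (\<lambda>i\<in>I. X i \<omega>)) N2 (\<lambda>\<omega>. v (\<lambda>j\<in>J. Y j \<omega>))"
proof -
  let ?f = "\<lambda>\<omega>. \<lambda>i\<in>I. X i \<omega>" and ?g = "\<lambda>\<omega>. \<lambda>j\<in>J. Y j \<omega>"
  let ?A = "vimage_algebra (space M) ?f (PiM I (\<lambda>_. S))"
  let ?B = "vimage_algebra (space M) ?g (PiM J (\<lambda>_. T))"
  have ind: "indep_set (sets ?A) (sets ?B)"
    using ind by (simp add: indep_families_def)
  then have ev: "sets ?A \<subseteq> events" "sets ?B \<subseteq> events"
    by (auto simp: indep_set_def indep_sets_def split: bool.splits)
  have uf: "(\<lambda>\<omega>. u (?f \<omega>)) \<in> measurable ?A N1"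
    by (rule measurable_compose[OF measurable_vimage_algebra1 u]) (simp add: space_PiM UNIV)
  have vg: "(\<lambda>\<omega>. v (?g \<omega>)) \<in> measurable ?B N2"
    by (rule measurable_compose[OF measurable_vimage_algebra1 v]) (simp add: space_PiM UNIV)
  have sub: "sigma_sets (space M) {h -` A \<inter> space M |A. A \<in> sets N} \<subseteq> sets C"
    if "h \<in> measurable C N" "space C = space M" for h :: "'a \<Rightarrow> 'd" and N C
  proof -
    have "{h -` A \<inter> space C |A. A \<in> sets N} \<subseteq> sets C"
      using that(1) by (auto intro: measurable_sets)
    from sets.sigma_sets_subset[OF this] show ?thesis
      by (simp add: that(2))
  qed
  have rv: "random_variable N1 (\<lambda>\<omega>. u (?f \<omega>))" "random_variable N2 (\<lambda>\<omega>. v (?g \<omega>))"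
    using uf vg ev by (auto simp: measurable_def)
  moreover have "indep_set
      (sigma_sets (space M) {(\<lambda>\<omega>. u (?f \<omega>)) -` A \<inter> space M |A. A \<in> sets N1})
      (sigma_sets (space M) {(\<lambda>\<omega>. v (?g \<omega>)) -` A \<inter> space M |A. A \<in> sets N2})"
    using ind sub[OF uf] sub[OF vg] unfolding indep_set_def
    by (rule_tac indep_sets_mono_sets) (auto split: bool.splits)
  ultimately show ?thesis
    by (simp add: indep_var_eq)
qed

lemma nn_integral_nat_fibres:
  assumes [measurable]: "K \<in> measurable M (count_space UNIV)" "g \<in> borel_measurable M"
  shows "(\<integral>\<^sup>+\<omega>. g \<omega> \<partial>M) = (\<Sum>k :: nat. \<integral>\<^sup>+\<omega>. g \<omega> * indicator (K -` {k} \<inter> space M) \<omega> \<partial>M)"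
proof -
  have "(\<integral>\<^sup>+\<omega>. g \<omega> \<partial>M) = (\<integral>\<^sup>+\<omega>\<in>(\<Union>k. K -` {k} \<inter> space M). g \<omega> \<partial>M)"
    by (rule nn_integral_cong) (auto simp: indicator_def)
  also have "\<dots> = (\<Sum>k. \<integral>\<^sup>+\<omega>\<in>K -` {k} \<inter> space M. g \<omega> \<partial>M)"
    by (rule nn_integral_disjoint_family) (auto simp: disjoint_family_on_def)
  finally show ?thesis .
qed

text \<open>The sample space splits into the countably many fibres of \<open>K\<close>, and on each
  fibre independence factorises. The norms are treated first: their identity holds without
  integrability, so \<open>dom\<close> turns into integrability of
  \<open>F (K \<omega>) \<omega>\<close>, and only then is the signed sum legitimate.\<close>

lemma expectation_random_index:
  fixes F :: "nat \<Rightarrow> 'a \<Rightarrow> 'b :: {real_normed_field, banach, second_countable_topology}"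
  assumes K [measurable]: "K \<in> measurable M (count_space UNIV)"
    and indep: "\<And>k. indep_var borel (F k) borel (\<lambda>\<omega>. of_nat (K \<omega>))"
    and int: "\<And>k. integrable M (F k)"
    and dom: "integrable M (\<lambda>\<omega>. expectation (\<lambda>\<omega>'. norm (F (K \<omega>) \<omega>')))"
  shows "integrable M (\<lambda>\<omega>. F (K \<omega>) \<omega>)"
    and "expectation (\<lambda>\<omega>. F (K \<omega>) \<omega>) = expectation (\<lambda>\<omega>. expectation (F (K \<omega>)))"
proof -
  have F [measurable]: "F k \<in> borel_measurable M" for k
    using indep_var_rv1[OF indep] .
  have FK [measurable]: "(\<lambda>\<omega>. F (K \<omega>) \<omega>) \<in> borel_measurable M"
    by (rule measurable_compose_countable[OF F K])
  define A where "A k = K -` {k} \<inter> space M" for k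
  have A [measurable]: "A k \<in> events" for k
    unfolding A_def by measurable
  have Un: "(\<Union>k. A k) = space M" and disj: "disjoint_family A"
    by (auto simp: A_def disjoint_family_on_def)
  have indn: "indep_var borel (\<lambda>\<omega>. norm (F k \<omega>)) borel (\<lambda>\<omega>. indicator {k} (K \<omega>) :: real)" for k
  proof -
    \<comment> \<open>\<open>of_nat\<close> is injective, so the event that \<open>K\<close> equals
      \<open>k\<close> is a measurable function of the variable in \<open>indep\<close>.\<close>
    have "indicator {of_nat k :: 'b} (of_nat j) = (indicator {k} j :: real)" for j
      by (simp split: split_indicator)
    then show ?thesis
      using indep_var_compose[OF indep, of norm borel "indicator {of_nat k :: 'b}" borel k]
      by (simp add: comp_def)
  qed
  have ind: "indep_var borel (F k) borel (\<lambda>\<omega>. of_real (indicator {k} (K \<omega>)) :: 'b)" for k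
    using indep_var_compose[OF indep, of "\<lambda>x. x" borel "\<lambda>j. of_real (indicator {of_nat k} j)" borel k]
    by (simp add: comp_def indicator_def)
  have intI: "integrable M (\<lambda>\<omega>. of_real (indicator {k} (K \<omega>)) :: 'b)"
     "integrable M (\<lambda>\<omega>. indicator {k} (K \<omega>) :: real)" for k
    by (auto intro!: integrable_const_bound[of _ 1] simp: indicator_def)
  have indA: "indicator (A k) \<omega> = (indicator {k} (K \<omega>) :: real)" if "\<omega> \<in> space M" for k \<omega>
    using that by (auto simp: A_def indicator_def)
  have setint: "(LINT \<omega>:A k|M. expectation (G (K \<omega>))) = of_real (prob (A k)) * expectation (G k)"
    for k and G :: "nat \<Rightarrow> 'a \<Rightarrow> 'c :: {real_normed_field, banach, second_countable_topology}"
  proof -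
    have "(LINT \<omega>:A k|M. expectation (G (K \<omega>))) = (LINT \<omega>:A k|M. expectation (G k))"
      by (rule set_lebesgue_integral_cong) (auto simp: A_def)
    also have "\<dots> = prob (A k) *\<^sub>R expectation (G k)"
      unfolding set_lebesgue_integral_def by (subst integral_scaleR_left) (auto simp: emeasure_eq_measure)
    also have "\<dots> = of_real (prob (A k)) * expectation (G k)"
      by (rule scaleR_conv_of_real)
    finally show ?thesis .
  qed
  have nn: "(\<integral>\<^sup>+\<omega>. ennreal (norm (F (K \<omega>) \<omega>)) * indicator (A k) \<omega> \<partial>M)
      = (\<integral>\<^sup>+\<omega>. ennreal (expectation (\<lambda>\<omega>'. norm (F (K \<omega>) \<omega>'))) * indicator (A k) \<omega> \<partial>M)" for k
  proof -
    have "(\<integral>\<^sup>+\<omega>. ennreal (norm (F (K \<omega>) \<omega>)) * indicator (A k) \<omega> \<partial>M)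
        = (\<integral>\<^sup>+\<omega>. ennreal (norm (F k \<omega>) * indicator {k} (K \<omega>)) \<partial>M)"
      by (rule nn_integral_cong) (auto simp: A_def indicator_def)
    also have "\<dots> = ennreal (expectation (\<lambda>\<omega>. norm (F k \<omega>) * indicator {k} (K \<omega>)))"
      by (rule nn_integral_eq_integral)
         (auto intro!: indep_var_integrable[OF indn] intI int)
    also have "\<dots> = ennreal (expectation (\<lambda>\<omega>. norm (F k \<omega>)) * prob (A k))"
    proof -
      have "expectation (\<lambda>\<omega>. indicator {k} (K \<omega>) :: real) = prob (A k)"
        by (subst Bochner_Integration.integral_cong[OF refl indA[symmetric]]) auto
      then show ?thesis
        by (subst indep_var_lebesgue_integral[OF indn]) (auto intro!: intI int)
    qed
    also have "\<dots> = (\<integral>\<^sup>+\<omega>. ennreal (expectation (\<lambda>\<omega>'. norm (F k \<omega>'))) * indicator (A k) \<omega> \<partial>M)"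
      by (simp add: nn_integral_cmult ennreal_mult' ennreal_mult'' ennreal_indicator emeasure_eq_measure)
    also have "\<dots> = (\<integral>\<^sup>+\<omega>. ennreal (expectation (\<lambda>\<omega>'. norm (F (K \<omega>) \<omega>'))) * indicator (A k) \<omega> \<partial>M)"
      by (rule nn_integral_cong) (auto simp: A_def indicator_def)
    finally show ?thesis .
  qed
  note nnsum = nn_integral_nat_fibres[OF K, folded A_def]
  have "(\<integral>\<^sup>+\<omega>. norm (F (K \<omega>) \<omega>) \<partial>M) = (\<integral>\<^sup>+\<omega>. expectation (\<lambda>\<omega>'. norm (F (K \<omega>) \<omega>')) \<partial>M)"
    by (subst (1 2) nnsum) (auto simp: nn)
  also have "\<dots> < \<infinity>"
    using integrableD(2)[OF dom] by (simp add: top.not_eq_extremum)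
  finally show int1: "integrable M (\<lambda>\<omega>. F (K \<omega>) \<omega>)"
    by (intro integrableI_bounded) auto
  have int2: "integrable M (\<lambda>\<omega>. expectation (F (K \<omega>)))"
  proof (rule Bochner_Integration.integrable_bound[OF dom])
    show "(\<lambda>\<omega>. expectation (F (K \<omega>))) \<in> borel_measurable M"
      by (rule measurable_compose[OF K]) simp
    show "AE \<omega> in M. norm (expectation (F (K \<omega>)))
        \<le> norm (expectation (\<lambda>\<omega>'. norm (F (K \<omega>) \<omega>')))"
      by (auto intro!: AE_I2 order_trans[OF integral_norm_bound])
  qed
  have sum: "expectation g = (\<Sum>k. LINT \<omega>:A k|M. g \<omega>)" if "integrable M g" for g :: "'a \<Rightarrow> 'b"
  proof -
    have "expectation g = (LINT \<omega>:(\<Union>k. A k)|M. g \<omega>)"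
      unfolding Un by (simp add: set_integral_space that)
    also have "\<dots> = (\<Sum>k. LINT \<omega>:A k|M. g \<omega>)"
      by (rule lebesgue_integral_countable_add)
         (use disj that in \<open>auto simp: disjoint_family_on_def Un set_integrable_def 
             intro!: integrable_mult_indicator\<close>)
    finally show ?thesis .
  qed
  have "(LINT \<omega>:A k|M. F (K \<omega>) \<omega>) = of_real (prob (A k)) * expectation (F k)" for k
  proof -
    have "(LINT \<omega>:A k|M. F (K \<omega>) \<omega>) = expectation (\<lambda>\<omega>. F k \<omega> * of_real (indicator {k} (K \<omega>)))"
      unfolding set_lebesgue_integral_def
      by (rule Bochner_Integration.integral_cong) (auto simp: A_def indicator_def)
    also have "\<dots> = expectation (F k) * expectation (\<lambda>\<omega>. of_real (indicator {k} (K \<omega>)))"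
      by (rule indep_var_lebesgue_integral[OF ind int intI(1)])
    also have "expectation (\<lambda>\<omega>. of_real (indicator {k} (K \<omega>)) :: 'b) = of_real (prob (A k))"
    proof -
      have "expectation (\<lambda>\<omega>. of_real (indicator {k} (K \<omega>)) :: 'b)
          = expectation (\<lambda>\<omega>. indicator (A k) \<omega> *\<^sub>R 1)"
        by (rule Bochner_Integration.integral_cong[OF refl]) (simp add: indA scaleR_conv_of_real)
      also have "\<dots> = prob (A k) *\<^sub>R 1"
        by (subst integral_scaleR_left) (auto simp: emeasure_eq_measure)
      finally show ?thesis
        by (simp add: scaleR_conv_of_real)
    qed
    finally show ?thesis
      by simp
  qed
  then show "expectation (\<lambda>\<omega>. F (K \<omega>) \<omega>) = expectation (\<lambda>\<omega>. expectation (F (K \<omega>)))"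
    by (simp add: sum[OF int1] sum[OF int2] setint)
qed

text \<open>
  The time is approximated strictly from above by dyadic numbers: strictness matches
  \<open>at_right\<close>, and countably many values make only the one-dimensional independence of \<open>X s\<close>
  and \<open>L\<close> necessary.
\<close>

lemma expectation_independent_time:
  fixes X :: "real \<Rightarrow> 'a \<Rightarrow> real"
    and f :: "real \<Rightarrow> 'b :: {real_normed_field, banach, second_countable_topology}"
  assumes indep: "\<And>s. 0 \<le> s \<Longrightarrow> indep_var borel (X s) borel L"
    and rcont: "\<And>\<omega> s. \<omega> \<in> space M \<Longrightarrow> 0 \<le> s \<Longrightarrow> continuous (at_right s) (\<lambda>s. X s \<omega>)"
    and nonneg: "\<And>\<omega>. \<omega> \<in> space M \<Longrightarrow> 0 \<le> L \<omega>"
    and f: "continuous_on UNIV f" "\<And>x. norm (f x) \<le> C"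
  shows "(\<lambda>\<omega>. X (L \<omega>) \<omega>) \<in> borel_measurable M"
    and "expectation (\<lambda>\<omega>. f (X (L \<omega>) \<omega>)) = expectation (\<lambda>\<omega>. expectation (\<lambda>\<omega>'. f (X (L \<omega>) \<omega>')))"
proof -
  have L [measurable]: "L \<in> borel_measurable M"
    using indep_var_rv2[OF indep[OF order_refl]] .
  have X: "X s \<in> borel_measurable M" if "0 \<le> s" for s
    using indep_var_rv1[OF indep[OF that]] .
  have f_meas [measurable]: "f \<in> borel_measurable borel"
    by (rule borel_measurable_continuous_onI[OF f(1)])
  define J where "J n \<omega> = nat (\<lfloor>2 ^ n * L \<omega>\<rfloor> + 1)" for n \<omega>
  define D where "D n \<omega> = real (J n \<omega>) / 2 ^ n" for n \<omega>
  have J [measurable]: "J n \<in> measurable M (count_space UNIV)" for n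
    unfolding J_def by measurable
  have D0: "0 \<le> D n \<omega>" for n \<omega>
    by (simp add: D_def)
  have DL: "L \<omega> < D n \<omega> \<and> D n \<omega> \<le> L \<omega> + (1 / 2) ^ n" if "\<omega> \<in> space M" for n \<omega>
  proof -
    have "0 \<le> 2 ^ n * L \<omega>"
      using nonneg[OF that] by simp
    then have "real (J n \<omega>) = of_int \<lfloor>2 ^ n * L \<omega>\<rfloor> + 1"
      by (simp add: J_def)
    then have "2 ^ n * L \<omega> < real (J n \<omega>)" "real (J n \<omega>) \<le> 2 ^ n * L \<omega> + 1"
      by linarith+
    then show ?thesis
      by (simp add: D_def field_simps power_divide)
  qed
  have Dlim: "(\<lambda>n. D n \<omega>) \<longlonglongrightarrow> L \<omega>" if "\<omega> \<in> space M" for \<omega>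
  proof (rule tendsto_sandwich[OF _ _ tendsto_const])
    have "(\<lambda>n. L \<omega> + (1 / 2) ^ n) \<longlonglongrightarrow> L \<omega> + 0"
      by (intro tendsto_intros LIMSEQ_power_zero) simp
    then show "(\<lambda>n. L \<omega> + (1 / 2) ^ n) \<longlonglongrightarrow> L \<omega>" by simp
  qed (use DL[OF that] in \<open>auto intro!: always_eventually less_imp_le\<close>)
  \<comment> \<open>Time and path are taken at separate sample points: equal points give the limit
    of the left-hand side, a fixed time gives the limit of \<open>g\<close>.\<close>
  have XD: "(\<lambda>n. X (D n \<omega>) \<omega>') \<longlonglongrightarrow> X (L \<omega>) \<omega>'" if "\<omega> \<in> space M" "\<omega>' \<in> space M" for \<omega> \<omega>'
    using rcont[OF that(2) nonneg[OF that(1)]] DL[OF that(1)] Dlim[OF that(1)]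
    unfolding continuous_within_sequentially by (auto simp: comp_def)
  have [measurable]: "(\<lambda>\<omega>. X (D n \<omega>) \<omega>) \<in> borel_measurable M" for n
    unfolding D_def by (rule measurable_compose_countable[OF _ J, of "\<lambda>j. X (real j / 2 ^ n)"]) (auto intro: X)
  show XL [measurable]: "(\<lambda>\<omega>. X (L \<omega>) \<omega>) \<in> borel_measurable M"
    by (rule borel_measurable_LIMSEQ_metric[of "\<lambda>n \<omega>. X (D n \<omega>) \<omega>"]) (auto intro: XD)
  define g where "g s = expectation (\<lambda>\<omega>. f (X s \<omega>))" for s
  have fX: "(\<lambda>\<omega>. f (X s \<omega>)) \<in> borel_measurable M" if "0 \<le> s" for s
    using X[OF that] by simp
  have ibd: "integrable M (\<lambda>\<omega>. f (X s \<omega>))" if "0 \<le> s" for s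
    by (rule integrable_const_bound[of _ C]) (use f fX[OF that] in auto)
  have C: "0 \<le> C"
    using norm_ge_zero[of "f 0"] f(2)[of 0] by linarith
  have gC: "norm (g s) \<le> C" if "0 \<le> s" for s
  proof -
    have "norm (g s) \<le> expectation (\<lambda>\<omega>. norm (f (X s \<omega>)))"
      unfolding g_def by (rule integral_norm_bound)
    also have "\<dots> \<le> expectation (\<lambda>\<omega>. C)"
      by (rule integral_mono) (use ibd[OF that] f in auto)
    finally show ?thesis by (simp add: prob_space)
  qed
  have flim: "(\<lambda>n. f (X (D n \<omega>) \<omega>')) \<longlonglongrightarrow> f (X (L \<omega>) \<omega>')"
    if "\<omega> \<in> space M" "\<omega>' \<in> space M" for \<omega> \<omega>'
    by (rule continuous_on_tendsto_compose[OF f(1) XD[OF that]]) auto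
  have glim: "(\<lambda>n. g (D n \<omega>)) \<longlonglongrightarrow> g (L \<omega>)" if "\<omega> \<in> space M" for \<omega>
    unfolding g_def
    by (rule integral_dominated_convergence[of _ _ _ "\<lambda>_. C"])
       (use fX D0 nonneg that flim f(2) in auto)
  have [measurable]: "(\<lambda>\<omega>. g (D n \<omega>)) \<in> borel_measurable M" for n
    unfolding D_def by (rule measurable_compose[OF J]) simp
  have [measurable]: "(\<lambda>\<omega>. g (L \<omega>)) \<in> borel_measurable M"
    by (rule borel_measurable_LIMSEQ_metric[of "\<lambda>n \<omega>. g (D n \<omega>)"]) (auto intro: glim)
  have step: "expectation (\<lambda>\<omega>. f (X (D n \<omega>) \<omega>)) = expectation (\<lambda>\<omega>. g (D n \<omega>))" for n
    unfolding D_def g_def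
  proof (rule expectation_random_index(2)[of _ "\<lambda>j \<omega>. f (X (real j / 2 ^ n) \<omega>)", OF J])
    fix j
    show "indep_var borel (\<lambda>\<omega>. f (X (real j / 2 ^ n) \<omega>)) borel (\<lambda>\<omega>. of_nat (J n \<omega>))"
      using indep_var_compose[OF indep, of "real j / 2 ^ n" f borel "\<lambda>x. of_nat (nat (\<lfloor>2 ^ n * x\<rfloor> + 1))" borel]
      by (simp add: comp_def J_def[abs_def])
    show "integrable M (\<lambda>\<omega>. f (X (real j / 2 ^ n) \<omega>))"
      by (rule ibd) simp
    show "integrable M (\<lambda>\<omega>. expectation (\<lambda>\<omega>'. norm (f (X (real (J n \<omega>) / 2 ^ n) \<omega>'))))"
    proof (rule integrable_const_bound[of _ C])
      show "(\<lambda>\<omega>. expectation (\<lambda>\<omega>'. norm (f (X (real (J n \<omega>) / 2 ^ n) \<omega>')))) \<in> borel_measurable M"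
        by (rule measurable_compose[OF J]) simp
      have "expectation (\<lambda>\<omega>'. norm (f (X s \<omega>'))) \<le> C" if "0 \<le> s" for s
        using integral_mono[OF integrable_norm[OF ibd[OF that]], of "\<lambda>_. C"] f by (simp add: prob_space)
      then show "AE \<omega> in M. norm (expectation (\<lambda>\<omega>'. norm (f (X (real (J n \<omega>) / 2 ^ n) \<omega>')))) \<le> C"
        by (auto simp: integral_nonneg_AE)
    qed
  qed
  have "(\<lambda>n. expectation (\<lambda>\<omega>. f (X (D n \<omega>) \<omega>))) \<longlonglongrightarrow> expectation (\<lambda>\<omega>. f (X (L \<omega>) \<omega>))"
    by (rule integral_dominated_convergence[of _ _ _ "\<lambda>_. C"]) (use flim f(2) in auto)
  moreover have "(\<lambda>n. expectation (\<lambda>\<omega>. g (D n \<omega>))) \<longlonglongrightarrow> expectation (\<lambda>\<omega>. g (L \<omega>))"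
    by (rule integral_dominated_convergence[of _ _ _ "\<lambda>_. C"]) (use glim gC D0 in auto)
  ultimately show "expectation (\<lambda>\<omega>. f (X (L \<omega>) \<omega>)) = expectation (\<lambda>\<omega>. expectation (\<lambda>\<omega>'. f (X (L \<omega>) \<omega>')))"
    unfolding step by (simp add: LIMSEQ_unique g_def)
qed

end

section \<open>Inverse stable subordinators\<close>

lemma power_over_fact_le_exp:
  fixes x :: real
  assumes "0 \<le> x"
  shows "x ^ m / fact m \<le> exp x"
proof -
  have "(\<Sum>n\<in>{m}. x ^ n / fact n) \<le> (\<Sum>n. x ^ n / fact n)"
    by (rule sum_le_suminf) (use assms summable_exp_generic[of x] in \<open>auto simp: divide_inverse mult.commute\<close>)
  then show ?thesis
    by (simp add: exp_def divide_inverse mult.commute)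
qed

lemma LIMSEQ_even_power_over_fact: "(\<lambda>m. (t :: real) ^ (2 * m) / fact (2 * m)) \<longlonglongrightarrow> 0"
proof -
  have "(\<lambda>n. t ^ n / fact n) \<longlonglongrightarrow> 0"
    using summable_LIMSEQ_zero[OF summable_exp_generic[of t]] by (simp add: divide_inverse mult.commute)
  then show ?thesis
    using LIMSEQ_subseq_LIMSEQ[of "\<lambda>n. t ^ n / fact n" 0 "\<lambda>m. 2 * m"] by (simp add: strict_mono_def comp_def)
qed

text \<open>The Laplace transform at integer points is the moment sequence of the bounded variable \<open>exp (- Y)\<close>.\<close>

lemma distr_eq_of_Laplace:
  fixes Y :: "'a \<Rightarrow> real" and Y' :: "'c \<Rightarrow> real"
  assumes "prob_space M" "prob_space M'"
    and [measurable]: "Y \<in> borel_measurable M" "Y' \<in> borel_measurable M'"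
    and nonneg: "AE x in M. 0 \<le> Y x" "AE x in M'. 0 \<le> Y' x"
    and eq: "\<And>k :: nat. 0 < k \<Longrightarrow> (\<integral>x. exp (- real k * Y x) \<partial>M) = (\<integral>x. exp (- real k * Y' x) \<partial>M')"
  shows "distr M borel Y = distr M' borel Y'"
proof -
  interpret M: prob_space M by fact
  interpret M': prob_space M' by fact
  define \<mu> where "\<mu> = distr M borel (\<lambda>x. exp (- Y x))"
  define \<nu> where "\<nu> = distr M' borel (\<lambda>x. exp (- Y' x))"
  have pow: "exp (- y) ^ k = exp (- real k * y)" for y :: real and k
    by (simp flip: exp_of_nat_mult)
  have int: "integrable M (\<lambda>x. exp (- Y x) ^ k)" "integrable M' (\<lambda>x. exp (- Y' x) ^ k)" for k
    using nonneg by (auto intro!: M.integrable_const_bound[of _ 1] M'.integrable_const_bound[of _ 1]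
        elim!: eventually_mono simp: power_le_one)
  have mom: "(\<integral>x. x ^ k \<partial>\<mu>) = (\<integral>x. exp (- Y x) ^ k \<partial>M)" "(\<integral>x. x ^ k \<partial>\<nu>) = (\<integral>x. exp (- Y' x) ^ k \<partial>M')" for k
    by (simp_all add: \<mu>_def \<nu>_def integral_distr)
  have "\<nu> = \<mu>"
  proof (rule real_distribution_eq_of_moments)
    show "real_distribution \<mu>" "real_distribution \<nu>"
      unfolding \<mu>_def \<nu>_def by (simp_all add: M.real_distribution_distr M'.real_distribution_distr)
    show "integrable \<mu> (\<lambda>x. x ^ k)" "integrable \<nu> (\<lambda>x. x ^ k)" for k
      using int by (simp_all add: \<mu>_def \<nu>_def integrable_distr_eq)
    show "(\<integral>x. x ^ k \<partial>\<nu>) = (\<integral>x. x ^ k \<partial>\<mu>)" for k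
      unfolding mom pow using eq[of k] by (cases "k = 0") (simp_all add: M.prob_space M'.prob_space)
    show "(\<lambda>m. t ^ (2 * m) / fact (2 * m) * (\<integral>x. x ^ (2 * m) \<partial>\<mu>)) \<longlonglongrightarrow> 0" for t :: real
    proof (rule Lim_null_comparison[OF always_eventually LIMSEQ_even_power_over_fact[of t]], rule allI)
      fix m
      have "(\<integral>x. exp (- Y x) ^ (2 * m) \<partial>M) \<le> (\<integral>x. 1 \<partial>M)"
        by (rule integral_mono_AE) (use nonneg int in \<open>auto elim!: eventually_mono simp: power_le_one\<close>)
      then have "(\<integral>x. x ^ (2 * m) \<partial>\<mu>) \<le> 1"
        by (simp add: mom M.prob_space)
      moreover have "0 \<le> (\<integral>x. x ^ (2 * m) \<partial>\<mu>)"
        by (simp add: mom integral_nonneg_AE)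
      ultimately have "\<bar>\<integral>x. x ^ (2 * m) \<partial>\<mu>\<bar> \<le> 1" by simp
      then show "norm (t ^ (2 * m) / fact (2 * m) * (\<integral>x. x ^ (2 * m) \<partial>\<mu>)) \<le> t ^ (2 * m) / fact (2 * m)"
        by (simp add: abs_mult power_even_abs divide_right_mono mult_left_le)
    qed
  qed
  \<comment> \<open>The map \<open>- ln\<close> undoes \<open>exp (- Y)\<close>, so equality of the
    laws passes back to \<open>Y\<close> and \<open>Y'\<close>.\<close>
  then have "distr \<mu> borel (\<lambda>y. - ln y) = distr \<nu> borel (\<lambda>y. - ln y)"
    by simp
  then show ?thesis
    by (simp add: \<mu>_def \<nu>_def distr_distr comp_def)
qed

text \<open>Right continuity makes the infimum attained: by monotonicity everything to its right
  lies in the level set, and the value at the infimum is the limit of the values there.\<close>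

lemma Inf_level_le_iff:
  fixes h :: "real \<Rightarrow> real"
  assumes mono: "mono_on {0..} h" and rcont: "\<And>s. 0 \<le> s \<Longrightarrow> continuous (at_right s) h"
    and reach: "\<exists>s\<ge>0. h s \<ge> t" and "0 \<le> s"
  shows "Inf {s. 0 \<le> s \<and> h s \<ge> t} \<le> s \<longleftrightarrow> h s \<ge> t"
proof -
  let ?S = "{s. 0 \<le> s \<and> h s \<ge> t}"
  define i where "i = Inf ?S"
  have ne: "?S \<noteq> {}" and bdd: "bdd_below ?S"
    using reach by auto
  have i0: "0 \<le> i"
    unfolding i_def by (rule cInf_greatest[OF ne]) auto
  have above: "h r \<ge> t" if "i < r" for r
  proof -
    obtain r' where "r' \<in> ?S" "r' < r"
      using cInf_lessD[OF ne, of r] \<open>i < r\<close> by (auto simp: i_def)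
    then show ?thesis
      using monotone_onD[OF mono, of r' r] by auto
  qed
  have "h i \<ge> t"
  proof (rule tendsto_lowerbound)
    show "(h \<longlongrightarrow> h i) (at_right i)"
      using rcont[OF i0] by (simp add: continuous_within)
    show "\<forall>\<^sub>F r in at_right i. t \<le> h r"
      using above by (auto simp: eventually_at_filter)
  qed simp
  then have "h s \<ge> t" if "i \<le> s"
    using monotone_onD[OF mono, of i s] that i0 by auto
  moreover have "i \<le> s" if "h s \<ge> t"
    unfolding i_def by (rule cInf_lower[OF _ bdd]) (use that \<open>0 \<le> s\<close> in auto)
  ultimately show ?thesis
    unfolding i_def by blast
qed

section \<open>Stable subordinators and their first passage times\<close>

context prob_space
begin

context
  fixes \<alpha> :: real and H :: "real \<Rightarrow> 'a \<Rightarrow> real"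
  assumes H: "stable_subordinator \<alpha> H"
begin

lemma stable_subordinator_measurable: "0 \<le> s \<Longrightarrow> H s \<in> borel_measurable M"
  using H by (simp add: stable_subordinator_def levy_process_def)

lemma stable_subordinator_nonneg:
  assumes "0 \<le> s"
  shows "AE \<omega> in M. 0 \<le> H s \<omega>"
proof -
  have "AE \<omega> in M. H 0 \<omega> = 0"
    using H by (simp add: stable_subordinator_def levy_process_def)
  then show ?thesis
  proof (rule AE_mp, intro AE_I2 impI)
    fix \<omega> assume "\<omega> \<in> space M" "H 0 \<omega> = 0"
    then show "0 \<le> H s \<omega>"
      using H assms monotone_onD[of "{0..}" "(\<le>)" "(\<le>)" "\<lambda>t. H t \<omega>" 0 s]
      by (auto simp: stable_subordinator_def)
  qed
qed

lemma stable_subordinator_Laplace: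
  "0 \<le> s \<Longrightarrow> 0 < u \<Longrightarrow> expectation (\<lambda>\<omega>. exp (- u * H s \<omega>)) = exp (- s * u powr \<alpha>)"
  using H by (simp add: stable_subordinator_def)

text \<open>Markov's inequality for \<open>exp (- u * H s \<omega>)\<close>. The parameter
  \<open>u\<close> is left free, so that the exponential rate in \<open>s\<close> can be made as
  large as desired.\<close>

lemma stable_subordinator_Chernoff:
  assumes s: "0 \<le> s" and u: "0 < u"
  shows "prob {\<omega> \<in> space M. H s \<omega> < t} \<le> exp (t * u - s * u powr \<alpha>)"
proof -
  note [measurable] = stable_subordinator_measurable[OF s]
  have E: "expectation (\<lambda>\<omega>. exp (- u * H s \<omega>)) = exp (- s * u powr \<alpha>)"
    by (rule stable_subordinator_Laplace[OF s u])
  \<comment> \<open>A function that is not integrable has integral 0 by convention, whereas this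
    integral is an exponential.\<close>
  have int: "integrable M (\<lambda>\<omega>. exp (- u * H s \<omega>))"
    using E not_integrable_integral_eq by fastforce
  have "prob {\<omega> \<in> space M. H s \<omega> < t} \<le> prob {\<omega> \<in> space M. exp (- u * t) \<le> exp (- u * H s \<omega>)}"
    using u by (intro finite_measure_mono) auto
  also have "\<dots> \<le> expectation (\<lambda>\<omega>. exp (- u * H s \<omega>)) / exp (- u * t)"
    by (rule integral_Markov_inequality_measure[where A = "{}", OF int]) auto
  also have "\<dots> = exp (t * u - s * u powr \<alpha>)"
    unfolding E by (simp add: algebra_simps flip: exp_diff)
  finally show ?thesis .
qed

lemma first_passage_le_iff:
  assumes "\<omega> \<in> space M" "0 \<le> s" "\<exists>s\<ge>0. H s \<omega> \<ge> t"
  shows "first_passage H t \<omega> \<le> s \<longleftrightarrow> t \<le> H s \<omega>"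
  using Inf_level_le_iff[of "\<lambda>s. H s \<omega>" t s] H assms
  by (auto simp: first_passage_def stable_subordinator_def levy_process_def)

lemma first_passage_nonneg: "0 \<le> first_passage H t \<omega>"
  unfolding first_passage_def by (auto intro!: cInf_greatest)

text \<open>Chernoff's bound with \<open>u = 1\<close> decays geometrically along the integers, so
  staying below \<open>t\<close> at all integer times is a null event. Hence the default value of
  \<open>first_passage\<close> is almost surely not taken.\<close>

lemma stable_subordinator_unbounded: "AE \<omega> in M. \<exists>s\<ge>0. t \<le> H s \<omega>"
proof -
  note [measurable] = stable_subordinator_measurable
  let ?E = "\<lambda>n :: nat. {\<omega> \<in> space M. H (real n) \<omega> < t}"
  have [measurable]: "?E n \<in> events" for n
    by measurable
  have "prob (\<Inter>n. ?E n) \<le> exp t * exp (- 1) ^ n" for n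
  proof -
    have "prob (\<Inter>n. ?E n) \<le> prob (?E n)"
      by (rule finite_measure_mono) auto
    also have "\<dots> \<le> exp (t * 1 - real n * 1 powr \<alpha>)"
      by (rule stable_subordinator_Chernoff) auto
    finally show ?thesis
      by (simp add: exp_diff exp_minus divide_inverse power_inverse flip: exp_of_nat_mult)
  qed
  moreover have lim: "(\<lambda>n. exp t * exp (- 1) ^ n) \<longlonglongrightarrow> exp t * (0 :: real)"
    by (intro tendsto_intros LIMSEQ_power_zero) simp
  ultimately have "prob (\<Inter>n. ?E n) \<le> exp t * 0"
    by (intro LIMSEQ_le_const[OF lim]) blast
  then have "(\<Inter>n. ?E n) \<in> null_sets M"
    by (auto simp: null_sets_def emeasure_eq_measure measure_le_0_iff)
  then show ?thesis
    by (rule AE_I') (auto simp: not_le, metis of_nat_less_0_iff)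
qed

lemma prob_first_passage_le:
  assumes [measurable]: "first_passage H t \<in> borel_measurable M" and "0 \<le> s"
  shows "prob {\<omega> \<in> space M. first_passage H t \<omega> \<le> s} = prob {\<omega> \<in> space M. t \<le> H s \<omega>}"
proof -
  note [measurable] = stable_subordinator_measurable[OF \<open>0 \<le> s\<close>]
  have "AE \<omega> in M. first_passage H t \<omega> \<le> s \<longleftrightarrow> t \<le> H s \<omega>"
    using stable_subordinator_unbounded[of t]
    by (rule AE_mp, intro AE_I2 impI first_passage_le_iff) (use \<open>0 \<le> s\<close> in auto)
  then show ?thesis
    by (intro finite_measure_eq_AE) auto
qed

end

section \<open>Exponential moments of inverse stable subordinators\<close>

context
  fixes \<alpha> t :: real and L :: "real \<Rightarrow> 'a \<Rightarrow> real"
  assumes \<alpha>: "0 < \<alpha>"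
    and L: "inverse_stable_subordinator \<alpha> L" and t: "0 \<le> t"
begin

lemma inverse_stable_subordinator_nonneg: "\<omega> \<in> space M \<Longrightarrow> 0 \<le> L t \<omega>"
  using L t by (auto simp: inverse_stable_subordinator_def first_passage_nonneg split: if_splits)

text \<open>On paths where \<open>first_passage\<close> takes its default value 0, the event fails
  because \<open>0 \<le> s\<close>; on the others \<open>s < L t \<omega>\<close> forces
  \<open>H s \<omega> < t\<close>. For \<open>\<alpha> = 1\<close> the event is certain or
  impossible, and when it is certain the bound exceeds 1.\<close>

lemma inverse_stable_subordinator_tail:
  assumes "0 \<le> s" "0 < u"
  shows "prob {\<omega> \<in> space M. s < L t \<omega>} \<le> exp (t * u - s * u powr \<alpha>)"
proof (cases "\<alpha> = 1")
  case True
  then have "{\<omega> \<in> space M. s < L t \<omega>} = (if s < t then space M else {})"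
    using L t by (auto simp: inverse_stable_subordinator_def)
  then show ?thesis
    using True assms by (auto simp: prob_space algebra_simps)
next
  case False
  then obtain H where H: "stable_subordinator \<alpha> H"
    and LH: "\<And>\<omega>. \<omega> \<in> space M \<Longrightarrow> L t \<omega> = first_passage H t \<omega>"
    using L t by (auto simp: inverse_stable_subordinator_def)
  note [measurable] = stable_subordinator_measurable[OF H \<open>0 \<le> s\<close>]
  have "H s \<omega> < t" if "\<omega> \<in> space M" "s < L t \<omega>" for \<omega>
  proof (rule ccontr)
    assume "\<not> H s \<omega> < t"
    then have "\<exists>s\<ge>0. t \<le> H s \<omega>"
      using \<open>0 \<le> s\<close> by (auto simp: not_less)
    then have "first_passage H t \<omega> \<le> s"
      using first_passage_le_iff[OF H that(1) \<open>0 \<le> s\<close>] \<open>\<not> H s \<omega> < t\<close> by auto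
    then show False
      using LH that by auto
  qed
  then have "prob {\<omega> \<in> space M. s < L t \<omega>} \<le> prob {\<omega> \<in> space M. H s \<omega> < t}"
    by (intro finite_measure_mono) auto
  also have "\<dots> \<le> exp (t * u - s * u powr \<alpha>)"
    by (rule stable_subordinator_Chernoff[OF H assms])
  finally show ?thesis .
qed

context
  assumes meas [measurable]: "L t \<in> borel_measurable M"
begin

lemma inverse_stable_subordinator_exp_integrable:
  assumes "0 < c"
  shows "integrable M (\<lambda>\<omega>. exp (c * L t \<omega>))"
proof -
  \<comment> \<open>This choice makes the tail at \<open>s\<close> of order
    \<open>exp (- (c + 1) * s)\<close>, faster by one unit of rate than the growth
    \<open>exp (c * s)\<close>.\<close>
  define u where "u = (c + 1) powr (1 / \<alpha>)"
  have u: "0 < u" "u powr \<alpha> = c + 1"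
    using assms \<alpha> by (auto simp: u_def powr_powr)
  let ?A = "\<lambda>j :: nat. {\<omega> \<in> space M. real j < L t \<omega>}"
  have bound: "ennreal (exp (c * L t \<omega>)) \<le> 1 + (\<Sum>j. ennreal (exp (c * (real j + 1))) * indicator (?A j) \<omega>)"
    if \<omega>: "\<omega> \<in> space M" for \<omega>
  proof (cases "L t \<omega> = 0")
    case False
    then have pos: "0 < L t \<omega>"
      using inverse_stable_subordinator_nonneg[OF \<omega>] by simp
    \<comment> \<open>The ceiling minus one, and not the floor: the tail events are strict, so
      \<open>j < L t \<omega>\<close> must be strict as well.\<close>
    define j where "j = nat (\<lceil>L t \<omega>\<rceil> - 1)"
    have j: "real j < L t \<omega>" "L t \<omega> \<le> real j + 1"
      using pos unfolding j_def by linarith+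
    have "ennreal (exp (c * L t \<omega>)) \<le> ennreal (exp (c * (real j + 1))) * indicator (?A j) \<omega>"
      using j \<omega> assms by (auto intro!: ennreal_leI)
    also have "\<dots> \<le> (\<Sum>j. ennreal (exp (c * (real j + 1))) * indicator (?A j) \<omega>)"
    proof -
      have "f j \<le> suminf f" for f :: "nat \<Rightarrow> ennreal"
        using sum_le_suminf[of f "{j}"] by simp
      then show ?thesis .
    qed
    also have "\<dots> \<le> 1 + \<dots>"
      by simp
    finally show ?thesis .
  qed simp
  have term_le: "ennreal (exp (c * (real j + 1))) * emeasure M (?A j)
      \<le> ennreal (exp (c + t * u) * exp (- 1) ^ j)" for j
  proof -
    have "exp (c * (real j + 1)) * prob (?A j) \<le> exp (c * (real j + 1)) * exp (t * u - real j * (c + 1))"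
      using inverse_stable_subordinator_tail[of "real j" u] u by (intro mult_left_mono) auto
    also have "\<dots> = exp (c + t * u) * exp (- 1) ^ j"
      by (simp add: algebra_simps flip: exp_add exp_of_nat_mult)
    finally show ?thesis
      by (simp add: emeasure_eq_measure flip: ennreal_mult)
  qed
  have "(\<integral>\<^sup>+\<omega>. exp (c * L t \<omega>) \<partial>M)
      \<le> (\<integral>\<^sup>+\<omega>. 1 + (\<Sum>j. ennreal (exp (c * (real j + 1))) * indicator (?A j) \<omega>) \<partial>M)"
    by (rule nn_integral_mono) (rule bound)
  also have "\<dots> = 1 + (\<Sum>j. ennreal (exp (c * (real j + 1))) * emeasure M (?A j))"
    by (subst nn_integral_add) (auto simp: nn_integral_suminf nn_integral_cmult emeasure_space_1)
  also have "\<dots> \<le> 1 + (\<Sum>j. ennreal (exp (c + t * u) * exp (- 1) ^ j))"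
    by (intro add_left_mono suminf_le term_le) auto
  also have "\<dots> < \<infinity>"
    by (subst suminf_ennreal2) (auto intro!: summable_mult summable_geometric)
  finally show ?thesis
    by (intro integrableI_bounded) auto
qed

text \<open>One term of the exponential series at \<open>c * L t \<omega>\<close> is bounded by its
  sum. That the second bound holds for every rate \<open>c\<close> is what makes Gaussian mixtures
  over \<open>L t\<close> moment determinate.\<close>

lemma inverse_stable_subordinator_power:
  shows "integrable M (\<lambda>\<omega>. L t \<omega> ^ m)"
    and "0 < c \<Longrightarrow> expectation (\<lambda>\<omega>. L t \<omega> ^ m) \<le> fact m / c ^ m * expectation (\<lambda>\<omega>. exp (c * L t \<omega>))"
proof -
  have bound: "L t \<omega> ^ m \<le> fact m / c ^ m * exp (c * L t \<omega>)" if "0 < c" "\<omega> \<in> space M" for c \<omega>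
    using power_over_fact_le_exp[of "c * L t \<omega>" m] inverse_stable_subordinator_nonneg[OF that(2)] that(1)
    by (simp add: field_simps power_mult_distrib)
  show int: "integrable M (\<lambda>\<omega>. L t \<omega> ^ m)"
    by (rule Bochner_Integration.integrable_bound[OF
          integrable_mult_right[OF inverse_stable_subordinator_exp_integrable[of 1], of "fact m"]])
       (use bound[of 1] inverse_stable_subordinator_nonneg in auto)
  show "expectation (\<lambda>\<omega>. L t \<omega> ^ m) \<le> fact m / c ^ m * expectation (\<lambda>\<omega>. exp (c * L t \<omega>))" if "0 < c"
  proof -
    have "expectation (\<lambda>\<omega>. L t \<omega> ^ m) \<le> expectation (\<lambda>\<omega>. fact m / c ^ m * exp (c * L t \<omega>))"
      by (rule integral_mono[OF int integrable_mult_right[OF inverse_stable_subordinator_exp_integrable[OF that]] bound[OF that]])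
    then show ?thesis by simp
  qed
qed

end

end

end

text \<open>Up to null events \<open>L t \<le> s\<close> says \<open>t \<le> H s\<close>, so the
  claim is the self-similarity of \<open>H\<close>: both \<open>c * H s\<close> and
  \<open>H' (c powr \<alpha> * s)\<close> have Laplace exponent
  \<open>s * (c * k) powr \<alpha>\<close>. Two spaces are allowed because the lemma has two uses:
  with one space it is self-similarity of \<open>L\<close>, and with \<open>c = 1\<close> it says
  that the law of \<open>L t\<close> is the same on every space.\<close>

lemma inverse_stable_subordinator_scaling:
  fixes M :: "'a measure" and M' :: "'c measure"
  assumes "prob_space M" "prob_space M'" and \<alpha>: "0 < \<alpha>"
    and L: "prob_space.inverse_stable_subordinator M \<alpha> L"
    and L': "prob_space.inverse_stable_subordinator M' \<alpha> L'"
    and c: "0 < c" and t: "0 \<le> t"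
    and [measurable]: "L t \<in> borel_measurable M" "L' (c * t) \<in> borel_measurable M'"
  shows "distr M' borel (L' (c * t)) = distr M borel (\<lambda>\<omega>. c powr \<alpha> * L t \<omega>)"
proof -
  interpret M: prob_space M by fact
  interpret M': prob_space M' by fact
  have ct: "0 \<le> c * t" using c t by simp
  have ca: "0 < c powr \<alpha>" using c by simp
  have main: "M'.prob {\<omega> \<in> space M'. L' (c * t) \<omega> \<le> c powr \<alpha> * s} = M.prob {\<omega> \<in> space M. L t \<omega> \<le> s}"
    if s: "0 \<le> s" for s
  proof (cases "\<alpha> = 1")
    case True
    then have eq: "\<And>\<omega>. \<omega> \<in> space M' \<Longrightarrow> L' (c * t) \<omega> = c * t" "\<And>\<omega>. \<omega> \<in> space M \<Longrightarrow> L t \<omega> = t"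
      using L L' t ct by (auto simp: M.inverse_stable_subordinator_def M'.inverse_stable_subordinator_def)
    have "{\<omega> \<in> space M'. L' (c * t) \<omega> \<le> c powr \<alpha> * s} = (if t \<le> s then space M' else {})"
      "{\<omega> \<in> space M. L t \<omega> \<le> s} = (if t \<le> s then space M else {})"
      using eq c True by auto
    then show ?thesis
      by (simp add: M.prob_space M'.prob_space)
  next
    case False
    then obtain H H' where H: "M.stable_subordinator \<alpha> H" and H': "M'.stable_subordinator \<alpha> H'"
      and LH: "\<And>\<omega>. \<omega> \<in> space M \<Longrightarrow> L t \<omega> = first_passage H t \<omega>"
      and LH': "\<And>\<omega>. \<omega> \<in> space M' \<Longrightarrow> L' (c * t) \<omega> = first_passage H' (c * t) \<omega>"
      using L L' t ct by (auto simp: M.inverse_stable_subordinator_def M'.inverse_stable_subordinator_def)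
    have cs: "0 \<le> c powr \<alpha> * s" using s by simp
    note [measurable] = M.stable_subordinator_measurable[OF H s] M'.stable_subordinator_measurable[OF H' cs]
    have [measurable]: "first_passage H t \<in> borel_measurable M" "first_passage H' (c * t) \<in> borel_measurable M'"
      using measurable_cong[of M "L t" "first_passage H t" borel] LH
        measurable_cong[of M' "L' (c * t)" "first_passage H' (c * t)" borel] LH' by auto
    have laws: "distr M borel (\<lambda>\<omega>. c * H s \<omega>) = distr M' borel (H' (c powr \<alpha> * s))"
    proof (rule distr_eq_of_Laplace)
      show "AE \<omega> in M. 0 \<le> c * H s \<omega>"
        using M.stable_subordinator_nonneg[OF H s] c by auto
      show "AE \<omega> in M'. 0 \<le> H' (c powr \<alpha> * s) \<omega>"
        by (rule M'.stable_subordinator_nonneg[OF H' cs])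
      fix k :: nat assume k: "0 < k"
      have "M.expectation (\<lambda>\<omega>. exp (- real k * (c * H s \<omega>))) = M.expectation (\<lambda>\<omega>. exp (- (real k * c) * H s \<omega>))"
        by (simp add: mult.assoc)
      also have "\<dots> = exp (- s * (real k * c) powr \<alpha>)"
        by (rule M.stable_subordinator_Laplace[OF H s]) (use k c in simp)
      also have "\<dots> = exp (- (c powr \<alpha> * s) * real k powr \<alpha>)"
        using k c by (simp add: powr_mult algebra_simps)
      also have "\<dots> = M'.expectation (\<lambda>\<omega>. exp (- real k * H' (c powr \<alpha> * s) \<omega>))"
        by (rule M'.stable_subordinator_Laplace[OF H' cs, symmetric]) (use k in simp)
      finally show "M.expectation (\<lambda>\<omega>. exp (- real k * (c * H s \<omega>)))
          = M'.expectation (\<lambda>\<omega>. exp (- real k * H' (c powr \<alpha> * s) \<omega>))" .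
    qed (use assms(1,2) in simp_all)
    have "M'.prob {\<omega> \<in> space M'. L' (c * t) \<omega> \<le> c powr \<alpha> * s}
        = M'.prob {\<omega> \<in> space M'. first_passage H' (c * t) \<omega> \<le> c powr \<alpha> * s}"
      using LH' by (intro arg_cong[where f = M'.prob]) auto
    also have "\<dots> = M'.prob {\<omega> \<in> space M'. c * t \<le> H' (c powr \<alpha> * s) \<omega>}"
      by (rule M'.prob_first_passage_le[OF H' _ cs]) measurable
    also have "\<dots> = measure (distr M' borel (H' (c powr \<alpha> * s))) {c * t..}"
      by (subst measure_distr) (auto intro!: arg_cong[where f = M'.prob])
    also have "\<dots> = M.prob {\<omega> \<in> space M. t \<le> H s \<omega>}"
      unfolding laws[symmetric] using c by (subst measure_distr) (auto intro!: arg_cong[where f = M.prob])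
    also have "\<dots> = M.prob {\<omega> \<in> space M. first_passage H t \<omega> \<le> s}"
      by (rule M.prob_first_passage_le[OF H _ s, symmetric]) measurable
    also have "\<dots> = M.prob {\<omega> \<in> space M. L t \<omega> \<le> s}"
      using LH by (intro arg_cong[where f = M.prob]) auto
    finally show ?thesis .
  qed
  note nonneg = M.inverse_stable_subordinator_nonneg[OF \<alpha> L t] M'.inverse_stable_subordinator_nonneg[OF \<alpha> L' ct]
  show ?thesis
  proof (rule cdf_unique)
    show "cdf (distr M' borel (L' (c * t))) = cdf (distr M borel (\<lambda>\<omega>. c powr \<alpha> * L t \<omega>))"
    proof
      fix x
      have m: "cdf (distr M' borel (L' (c * t))) x = M'.prob {\<omega> \<in> space M'. L' (c * t) \<omega> \<le> x}"
        "cdf (distr M borel (\<lambda>\<omega>. c powr \<alpha> * L t \<omega>)) x = M.prob {\<omega> \<in> space M. c powr \<alpha> * L t \<omega> \<le> x}"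
        unfolding cdf_def by (simp_all add: measure_distr vimage_def Int_def conj_commute)
      show "cdf (distr M' borel (L' (c * t))) x = cdf (distr M borel (\<lambda>\<omega>. c powr \<alpha> * L t \<omega>)) x"
      proof (cases "0 \<le> x")
        case True
        then have "{\<omega> \<in> space M. c powr \<alpha> * L t \<omega> \<le> x} = {\<omega> \<in> space M. L t \<omega> \<le> x / c powr \<alpha>}"
          using ca by (auto simp: field_simps)
        then show ?thesis
          using main[of "x / c powr \<alpha>"] True ca by (simp add: m)
      next
        case False
        have "{\<omega> \<in> space M'. L' (c * t) \<omega> \<le> x} = {}"
          using nonneg False by force
        moreover have "0 \<le> c powr \<alpha> * L t \<omega>" if "\<omega> \<in> space M" for \<omega>
          using nonneg(1)[OF that] by simp
        then have "{\<omega> \<in> space M. c powr \<alpha> * L t \<omega> \<le> x} = {}"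
          using False by force
        ultimately show ?thesis
          unfolding m by (simp only: measure_empty)
      qed
    qed
  qed (simp_all add: M.real_distribution_distr M'.real_distribution_distr)
qed

section \<open>Poisson processes at an independent random time\<close>

text \<open>The factorial moments of the Poisson law: with the factor \<open>x ^ m / fact m\<close>
  taken out, the terms from index \<open>m\<close> onwards form the exponential series.\<close>

lemma sums_choose_exp:
  fixes x :: real
  shows "(\<lambda>j. real (j choose m) * (x ^ j / fact j * exp (- x))) sums (x ^ m / fact m)"
proof -
  have e: "(\<lambda>i. x ^ i / fact i) sums exp x"
    using exp_converges[of x] by (simp add: divide_inverse mult.commute)
  have "(\<lambda>i. x ^ m / fact m * exp (- x) * (x ^ i / fact i)) sums (x ^ m / fact m * exp (- x) * exp x)"
    by (rule sums_mult[OF e])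
  also have "(\<lambda>i. x ^ m / fact m * exp (- x) * (x ^ i / fact i)) =
      (\<lambda>i. real ((i + m) choose m) * (x ^ (i + m) / fact (i + m) * exp (- x)))"
    by (simp add: binomial_fact power_add field_simps)
  also have "x ^ m / fact m * exp (- x) * exp x = x ^ m / fact m"
    by (simp add: exp_minus)
  finally have "(\<lambda>j. real (j choose m) * (x ^ j / fact j * exp (- x))) sums
      (x ^ m / fact m + (\<Sum>j<m. real (j choose m) * (x ^ j / fact j * exp (- x))))"
    by (subst (asm) sums_iff_shift) simp
  also have "(\<Sum>j<m. real (j choose m) * (x ^ j / fact j * exp (- x))) = 0"
    by (rule sum.neutral) (auto simp: binomial_eq_0)
  finally show ?thesis
    by simp
qed

text \<open>The expansion of a monomial in binomial coefficients; \<open>c j\<close> is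
  \<open>fact j\<close> times a Stirling number of the second kind. Only the top coefficient is
  recorded, since the others are lost in the limit.\<close>

lemma power_eq_sum_choose:
  "\<exists>c :: nat \<Rightarrow> real. c m = fact m \<and> (\<forall>k :: nat. real k ^ m = (\<Sum>j\<le>m. c j * real (k choose j)))"
proof (induction m)
  case 0
  then show ?case by (intro exI[of _ "\<lambda>_. 1"]) simp
next
  case (Suc m)
  then obtain c where c: "c m = fact m" "\<And>k. real k ^ m = (\<Sum>j\<le>m. c j * real (k choose j))"
    by blast
  define d where "d j = (if 0 < j then real j * c (j - 1) else 0) + (if j \<le> m then real j * c j else 0)" for j
  have rec: "real k * real (k choose j) = real (Suc j) * real (k choose Suc j) + real j * real (k choose j)" for k j
  proof -
    have "real k * real (k choose j) = (real k - real j) * real (k choose j) + real j * real (k choose j)"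
      by (simp add: algebra_simps)
    also have "(real k - real j) * real (k choose j) = real (Suc j) * real (k choose Suc j)"
    proof (cases "j \<le> k")
      case True
      have "(k - j) * (k choose j) = Suc j * (k choose Suc j)"
        using binomial_absorb_comp[of k j] binomial_absorption[of j k] by simp
      then have "real ((k - j) * (k choose j)) = real (Suc j * (k choose Suc j))"
        by (rule arg_cong)
      then show ?thesis
        using True by (simp add: of_nat_diff distrib_right)
    qed (simp add: binomial_eq_0)
    finally show ?thesis .
  qed
  have "real k ^ Suc m = (\<Sum>j\<le>Suc m. d j * real (k choose j))" for k
  proof -
    have "real k ^ Suc m = (\<Sum>j\<le>m. c j * (real k * real (k choose j)))"
      by (simp add: c sum_distrib_left mult_ac)
    also have "\<dots> = (\<Sum>j\<le>m. real (Suc j) * c j * real (k choose Suc j)) + (\<Sum>j\<le>m. real j * c j * real (k choose j))"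
      unfolding rec by (simp add: algebra_simps sum.distrib)
    also have "(\<Sum>j\<le>m. real (Suc j) * c j * real (k choose Suc j))
        = (\<Sum>j\<le>Suc m. (if 0 < j then real j * c (j - 1) else 0) * real (k choose j))"
      by (subst sum.atMost_Suc_shift) simp
    also have "(\<Sum>j\<le>m. real j * c j * real (k choose j)) = (\<Sum>j\<le>Suc m. (if j \<le> m then real j * c j else 0) * real (k choose j))"
      by simp
    finally show ?thesis
      by (simp add: d_def algebra_simps sum.distrib)
  qed
  moreover have "d (Suc m) = fact (Suc m)"
    by (simp add: d_def c)
  ultimately show ?case
    by blast
qed

context prob_space
begin

context
  fixes N :: "real \<Rightarrow> 'a \<Rightarrow> nat" and T :: "'a \<Rightarrow> real"
  assumes N: "poisson_process N"
    and indep: "\<And>s. 0 \<le> s \<Longrightarrow> indep_var borel (\<lambda>\<omega>. real (N s \<omega>)) borel T"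
    and nonneg: "\<And>\<omega>. \<omega> \<in> space M \<Longrightarrow> 0 \<le> T \<omega>"
begin

lemma poisson_process_prob:
  assumes "0 \<le> s"
  shows "prob {\<omega> \<in> space M. N s \<omega> = j} = s ^ j / fact j * exp (- s)"
proof (cases "s = 0")
  case True
  have [measurable]: "N 0 \<in> measurable M (count_space UNIV)"
    using N by (simp add: poisson_process_def)
  have "AE \<omega> in M. N 0 \<omega> = 0"
    using N by (simp add: poisson_process_def levy_process_def)
  then have "prob {\<omega> \<in> space M. N 0 \<omega> = j} = prob {\<omega> \<in> space M. j = 0}"
    by (intro finite_measure_eq_AE) auto
  then show ?thesis
    using True by (cases "j = 0") (auto simp: prob_space)
next
  case False
  then have s: "0 < s" using assms by simp
  have [measurable]: "N s \<in> measurable M (count_space UNIV)"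
    using N s by (simp add: poisson_process_def)
  have "prob {\<omega> \<in> space M. N s \<omega> = j} = measure (distr M (count_space UNIV) (N s)) {j}"
    by (subst measure_distr) (auto intro!: arg_cong[where f = prob])
  also have "\<dots> = pmf (poisson_pmf s) j"
    using N s by (simp add: poisson_process_def pmf.rep_eq)
  finally show ?thesis
    using s by simp
qed

lemma measurable_poisson_time_change: "(\<lambda>\<omega>. N (T \<omega>) \<omega>) \<in> measurable M (count_space UNIV)"
proof -
  have rc: "continuous (at_right s) (\<lambda>s. real (N s \<omega>))" if "\<omega> \<in> space M" "0 \<le> s" for s \<omega>
    using N that by (simp add: poisson_process_def levy_process_def)
  \<comment> \<open>Only the measurability half of the random time lemma is wanted here, hence the
    trivial test function.\<close>
  have "(\<lambda>\<omega>. real (N (T \<omega>) \<omega>)) \<in> borel_measurable M"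
    by (rule expectation_independent_time(1)[OF indep rc nonneg, where f = "\<lambda>_. 0 :: real" and C = 0]) auto
  then have "(\<lambda>\<omega>. nat \<lfloor>real (N (T \<omega>) \<omega>)\<rfloor>) \<in> measurable M (count_space UNIV)"
    by measurable
  then show ?thesis by simp
qed

text \<open>A mixed Poisson law: given \<open>T\<close>, the count is Poisson with mean
  \<open>T\<close>.\<close>

lemma prob_poisson_time_change:
  "prob {\<omega> \<in> space M. N (T \<omega>) \<omega> = j} = expectation (\<lambda>\<omega>. T \<omega> ^ j / fact j * exp (- T \<omega>))"
proof -
  have rc: "continuous (at_right s) (\<lambda>s. real (N s \<omega>))" if "\<omega> \<in> space M" "0 \<le> s" for s \<omega>
    using N that by (simp add: poisson_process_def levy_process_def)
  note [measurable] = measurable_poisson_time_change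
  \<comment> \<open>A tent function: continuous and bounded, as the random time lemma demands, and
    equal to the indicator of \<open>j\<close> on the natural numbers.\<close>
  define f where "f x = max 0 (1 - \<bar>x - real j\<bar>)" for x :: real
  have f: "f (real i) = indicator {j} i" for i
    by (auto simp: f_def indicator_def)
  have f_prob: "expectation (\<lambda>\<omega>. f (real (K \<omega>))) = prob {\<omega> \<in> space M. K \<omega> = j}" 
    if [measurable]: "K \<in> measurable M (count_space UNIV)" for K
  proof -
    have "expectation (\<lambda>\<omega>. f (real (K \<omega>))) = expectation (indicator {\<omega> \<in> space M. K \<omega> = j})"
      unfolding f by (rule Bochner_Integration.integral_cong) (auto simp: indicator_def)
    then show ?thesis by simp
  qed
  have "prob {\<omega> \<in> space M. N (T \<omega>) \<omega> = j} = expectation (\<lambda>\<omega>. f (real (N (T \<omega>) \<omega>)))"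
    by (rule f_prob[symmetric]) measurable
  also have "\<dots> = expectation (\<lambda>\<omega>. expectation (\<lambda>\<omega>'. f (real (N (T \<omega>) \<omega>'))))"
    by (rule expectation_independent_time(2)[OF indep rc nonneg, where f = f and C = 1])
       (auto simp: f_def intro!: continuous_intros)
  also have "\<dots> = expectation (\<lambda>\<omega>. T \<omega> ^ j / fact j * exp (- T \<omega>))"
  proof (rule Bochner_Integration.integral_cong[OF refl])
    fix \<omega> assume "\<omega> \<in> space M"
    then have "0 \<le> T \<omega>" by (rule nonneg)
    moreover from this have "N (T \<omega>) \<in> measurable M (count_space UNIV)"
      using N by (simp add: poisson_process_def)
    ultimately show "expectation (\<lambda>\<omega>'. f (real (N (T \<omega>) \<omega>'))) = T \<omega> ^ j / fact j * exp (- T \<omega>)"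
      by (simp add: f_prob poisson_process_prob)
  qed
  finally show ?thesis .
qed

text \<open>Tonelli over the value of the count reduces the claim to the factorial moments of a
  Poisson law with fixed mean. All terms are nonnegative, so the computation delivers integrability
  together with the value.\<close>

lemma expectation_choose_poisson_time_change:
  assumes int: "integrable M (\<lambda>\<omega>. T \<omega> ^ m)"
  shows "integrable M (\<lambda>\<omega>. real (N (T \<omega>) \<omega> choose m))"
    and "expectation (\<lambda>\<omega>. real (N (T \<omega>) \<omega> choose m)) = expectation (\<lambda>\<omega>. T \<omega> ^ m) / fact m"
proof -
  let ?K = "\<lambda>\<omega>. N (T \<omega>) \<omega>"
  note [measurable] = measurable_poisson_time_change
  have [measurable]: "T \<in> borel_measurable M"
    using indep_var_rv2[OF indep[OF order_refl]] .
  let ?p = "\<lambda>j \<omega>. T \<omega> ^ j / fact j * exp (- T \<omega>)"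
  have p0: "0 \<le> ?p j \<omega>" if "\<omega> \<in> space M" for j \<omega>
    using nonneg[OF that] by simp
  have pint: "integrable M (?p j)" for j
  proof (rule integrable_const_bound[of _ 1])
    show "AE \<omega> in M. norm (?p j \<omega>) \<le> 1"
    proof (rule AE_I2)
      fix \<omega> assume "\<omega> \<in> space M"
      then have "0 \<le> T \<omega>" by (rule nonneg)
      then have "T \<omega> ^ j / fact j * exp (- T \<omega>) \<le> exp (T \<omega>) * exp (- T \<omega>)"
        by (intro mult_right_mono power_over_fact_le_exp) auto
      then show "norm (?p j \<omega>) \<le> 1"
        using \<open>0 \<le> T \<omega>\<close> by (simp add: exp_minus)
    qed
  qed measurable
  have "(\<integral>\<^sup>+\<omega>. real (?K \<omega> choose m) \<partial>M)
      = (\<Sum>j. \<integral>\<^sup>+\<omega>. ennreal (real (?K \<omega> choose m)) * indicator (?K -` {j} \<inter> space M) \<omega> \<partial>M)"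
    by (rule nn_integral_nat_fibres) measurable
  also have "\<dots> = (\<Sum>j. \<integral>\<^sup>+\<omega>. ennreal (real (j choose m) * ?p j \<omega>) \<partial>M)"
  proof (rule suminf_cong)
    fix j
    have "(\<integral>\<^sup>+\<omega>. ennreal (real (?K \<omega> choose m)) * indicator (?K -` {j} \<inter> space M) \<omega> \<partial>M)
        = (\<integral>\<^sup>+\<omega>. ennreal (real (j choose m)) * indicator {\<omega> \<in> space M. ?K \<omega> = j} \<omega> \<partial>M)"
      by (rule nn_integral_cong) (auto simp: indicator_def)
    also have "\<dots> = ennreal (real (j choose m)) * ennreal (expectation (?p j))"
      by (subst nn_integral_cmult) (auto simp: emeasure_eq_measure prob_poisson_time_change)
    also have "ennreal (expectation (?p j)) = (\<integral>\<^sup>+\<omega>. ?p j \<omega> \<partial>M)"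
      by (rule nn_integral_eq_integral[symmetric]) (use pint p0 in auto)
    also have "ennreal (real (j choose m)) * (\<integral>\<^sup>+\<omega>. ?p j \<omega> \<partial>M) = (\<integral>\<^sup>+\<omega>. ennreal (real (j choose m) * ?p j \<omega>) \<partial>M)"
      by (subst nn_integral_cmult[symmetric]) (auto intro!: nn_integral_cong ennreal_mult'[symmetric] simp del: times_divide_eq_right times_divide_eq_left)
    finally show "(\<integral>\<^sup>+\<omega>. ennreal (real (?K \<omega> choose m)) * indicator (?K -` {j} \<inter> space M) \<omega> \<partial>M)
        = (\<integral>\<^sup>+\<omega>. ennreal (real (j choose m) * ?p j \<omega>) \<partial>M)" .
  qed
  also have "\<dots> = (\<integral>\<^sup>+\<omega>. (\<Sum>j. ennreal (real (j choose m) * ?p j \<omega>)) \<partial>M)"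
    by (rule nn_integral_suminf[symmetric]) measurable
  also have "\<dots> = (\<integral>\<^sup>+\<omega>. ennreal (T \<omega> ^ m / fact m) \<partial>M)"
  proof (rule nn_integral_cong)
    fix \<omega> assume \<omega>: "\<omega> \<in> space M"
    show "(\<Sum>j. ennreal (real (j choose m) * ?p j \<omega>)) = ennreal (T \<omega> ^ m / fact m)"
      using sums_choose_exp[of m "T \<omega>"] p0[OF \<omega>]
      by (subst suminf_ennreal2) (auto simp: sums_iff intro!: divide_nonneg_nonneg mult_nonneg_nonneg zero_le_power nonneg[OF \<omega>])
  qed
  also have "\<dots> = ennreal (expectation (\<lambda>\<omega>. T \<omega> ^ m / fact m))"
    by (rule nn_integral_eq_integral) (use int nonneg in auto)
  finally have nn: "(\<integral>\<^sup>+\<omega>. real (?K \<omega> choose m) \<partial>M) = ennreal (expectation (\<lambda>\<omega>. T \<omega> ^ m / fact m))" .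
  then show "integrable M (\<lambda>\<omega>. real (?K \<omega> choose m))"
    by (intro integrableI_bounded) auto
  have "expectation (\<lambda>\<omega>. real (?K \<omega> choose m)) = enn2real (\<integral>\<^sup>+\<omega>. real (?K \<omega> choose m) \<partial>M)"
    by (rule integral_eq_nn_integral) auto
  also have "\<dots> = expectation (\<lambda>\<omega>. T \<omega> ^ m / fact m)"
    unfolding nn using nonneg by (intro enn2real_ennreal integral_nonneg_AE) auto
  finally show "expectation (\<lambda>\<omega>. real (?K \<omega> choose m)) = expectation (\<lambda>\<omega>. T \<omega> ^ m) / fact m"
    by simp
qed

end

lemma fractional_poisson_moments:
  fixes N :: "real \<Rightarrow> 'a \<Rightarrow> nat"
  assumes "0 < \<alpha>" and L: "inverse_stable_subordinator \<alpha> L" and N: "poisson_process N"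
    and NL: "indep_families {0..} (count_space UNIV) N {0..} borel L" and t: "0 \<le> t"
  shows "time_change N L (real n * t) \<in> measurable M (count_space UNIV)"
    and "integrable M (\<lambda>\<omega>. real (time_change N L (real n * t) \<omega>) ^ m)"
    and "(\<lambda>n. expectation (\<lambda>\<omega>. real (time_change N L (real n * t) \<omega>) ^ m) / (real n powr \<alpha>) ^ m)
      \<longlonglongrightarrow> expectation (\<lambda>\<omega>. L t \<omega> ^ m)"
proof -
  have ind: "indep_var borel (\<lambda>\<omega>. real (N s \<omega>)) borel (L r)" if "0 \<le> s" "0 \<le> r" for s r
    using indep_families_imp_indep_var[OF NL, of "\<lambda>x. real (x s)" borel "\<lambda>x. x r" borel] that by simp
  have Lm [measurable]: "L r \<in> borel_measurable M" if "0 \<le> r" for r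
    using indep_var_rv2[OF ind[OF order_refl that]] .
  have r0: "0 \<le> real n * t" for n
    using t by simp
  show "time_change N L (real n * t) \<in> measurable M (count_space UNIV)"
    using measurable_poisson_time_change[OF N ind[OF _ r0]
        inverse_stable_subordinator_nonneg[OF \<open>0 < \<alpha>\<close> L r0], of n]
    by (simp add: time_change_def[abs_def])
  have int: "integrable M (\<lambda>\<omega>. real (time_change N L (real n * t) \<omega> choose j))"
    and E: "expectation (\<lambda>\<omega>. real (time_change N L (real n * t) \<omega> choose j))
        = expectation (\<lambda>\<omega>. L (real n * t) \<omega> ^ j) / fact j" for n j
    using expectation_choose_poisson_time_change[OF N ind[OF _ r0]
        inverse_stable_subordinator_nonneg[OF \<open>0 < \<alpha>\<close> L r0]
        inverse_stable_subordinator_power(1)[OF \<open>0 < \<alpha>\<close> L r0 Lm[OF r0]], of n j]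
    by (auto simp: time_change_def)
  obtain c where c: "c m = fact m" "\<And>k. real k ^ m = (\<Sum>j\<le>m. c j * real (k choose j))"
    using power_eq_sum_choose[of m] by blast
  show "integrable M (\<lambda>\<omega>. real (time_change N L (real n * t) \<omega>) ^ m)"
    unfolding c(2) by (intro Bochner_Integration.integrable_sum integrable_mult_right int)
  have scal: "expectation (\<lambda>\<omega>. L (real n * t) \<omega> ^ j) = (real n powr \<alpha>) ^ j * expectation (\<lambda>\<omega>. L t \<omega> ^ j)"
    if "0 < n" for n j
  proof -
    have "expectation (\<lambda>\<omega>. L (real n * t) \<omega> ^ j) = (\<integral>x. x ^ j \<partial>distr M borel (L (real n * t)))"
      by (rule integral_distr[symmetric]) (use r0 in auto)
    also have "\<dots> = (\<integral>x. x ^ j \<partial>distr M borel (\<lambda>\<omega>. real n powr \<alpha> * L t \<omega>))"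
      by (subst inverse_stable_subordinator_scaling[OF prob_space_axioms prob_space_axioms \<open>0 < \<alpha>\<close> L L])
         (use that t r0 in auto)
    also have "\<dots> = (real n powr \<alpha>) ^ j * expectation (\<lambda>\<omega>. L t \<omega> ^ j)"
      using t by (subst integral_distr) (auto simp: power_mult_distrib)
    finally show ?thesis .
  qed
  \<comment> \<open>After division by \<open>(real n powr \<alpha>) ^ m\<close> the term
    \<open>j\<close> carries \<open>n\<close> to the power \<open>- \<alpha> * (m - j)\<close>. Only
    \<open>j = m\<close> survives, and there \<open>c m / fact m = 1\<close>.\<close>
  define e where "e j = c j / fact j * expectation (\<lambda>\<omega>. L t \<omega> ^ j)" for j
  have eq: "expectation (\<lambda>\<omega>. real (time_change N L (real n * t) \<omega>) ^ m) / (real n powr \<alpha>) ^ m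
      = (\<Sum>j\<le>m. e j * inverse (real n powr \<alpha>) ^ (m - j))" if n: "0 < n" for n
  proof -
    have pos: "0 < real n powr \<alpha>" using n by simp
    have "expectation (\<lambda>\<omega>. real (time_change N L (real n * t) \<omega>) ^ m)
        = (\<Sum>j\<le>m. c j * (expectation (\<lambda>\<omega>. L (real n * t) \<omega> ^ j) / fact j))"
      unfolding c(2) by (subst Bochner_Integration.integral_sum) (auto intro: int simp: E)
    also have "\<dots> = (\<Sum>j\<le>m. e j * (real n powr \<alpha>) ^ j)"
      unfolding scal[OF n] e_def by (simp add: algebra_simps)
    also have "\<dots> / (real n powr \<alpha>) ^ m = (\<Sum>j\<le>m. e j * inverse (real n powr \<alpha>) ^ (m - j))"
      unfolding sum_divide_distrib
    proof (rule sum.cong[OF refl])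
      fix j assume "j \<in> {..m}"
      then show "e j * (real n powr \<alpha>) ^ j / (real n powr \<alpha>) ^ m = e j * inverse (real n powr \<alpha>) ^ (m - j)"
        using pos by (simp add: power_diff field_simps)
    qed
    finally show ?thesis .
  qed
  have lim0: "(\<lambda>n. inverse (real n powr \<alpha>)) \<longlonglongrightarrow> 0"
    using tendsto_neg_powr[OF _ filterlim_real_sequentially, of "-\<alpha>"] \<open>0 < \<alpha>\<close> by (simp add: powr_minus)
  have "(\<lambda>n. \<Sum>j\<le>m. e j * inverse (real n powr \<alpha>) ^ (m - j)) \<longlonglongrightarrow> (\<Sum>j\<le>m. e j * 0 ^ (m - j))"
    by (intro tendsto_intros lim0)
  also have "(\<Sum>j\<le>m. e j * 0 ^ (m - j)) = e m"
    by (subst sum.remove[of _ m]) (auto intro!: sum.neutral)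
  also have "e m = expectation (\<lambda>\<omega>. L t \<omega> ^ m)"
    by (simp add: e_def c)
  finally show "(\<lambda>n. expectation (\<lambda>\<omega>. real (time_change N L (real n * t) \<omega>) ^ m) / (real n powr \<alpha>) ^ m)
      \<longlonglongrightarrow> expectation (\<lambda>\<omega>. L t \<omega> ^ m)"
    by (rule Lim_transform_eventually) (use eq in \<open>auto intro!: eventually_sequentiallyI[of 1]\<close>)
qed

end

section \<open>Words in independent random walks\<close>

lemma prod_list_map_eq_prod_count:
  fixes f :: "'i \<Rightarrow> 'b :: comm_monoid_mult"
  assumes "finite A" "set cs \<subseteq> A"
  shows "prod_list (map f cs) = (\<Prod>c\<in>A. f c ^ count_list cs c)"
  using assms(2)
proof (induction cs)
  case (Cons a cs)
  have "(\<Prod>c\<in>A. f c ^ count_list (a # cs) c)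
      = (\<Prod>c\<in>A. (if c = a then f c else 1) * f c ^ count_list cs c)"
    by (rule prod.cong) auto
  also have "\<dots> = f a * (\<Prod>c\<in>A. f c ^ count_list cs c)"
    using Cons.prems \<open>finite A\<close> by (simp add: prod.distrib)
  finally show ?case
    using Cons by simp
qed simp

text \<open>The index type stays free so that unordered pairs for \<open>link2\<close> and natural
  numbers for \<open>link1\<close> are instances of the same argument.
  \<open>bounded_moments\<close> is uniform in index and step, which is the source of the uniform
  bounds for words.\<close>

locale walk_family = prob_space +
  fixes X :: "'i \<Rightarrow> nat \<Rightarrow> 'a \<Rightarrow> real"
  assumes indep: "indep_vars (\<lambda>_. borel) (\<lambda>(c, r). X c r) (UNIV \<times> {1..})"
    and mean: "\<And>c r. 1 \<le> r \<Longrightarrow> expectation (X c r) = 0"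
    and second_moment: "\<And>c r. 1 \<le> r \<Longrightarrow> expectation (\<lambda>\<omega>. X c r \<omega> ^ 2) = 1"
    and integrable_step: "\<And>c r q. 1 \<le> r \<Longrightarrow> integrable M (\<lambda>\<omega>. X c r \<omega> ^ q)"
    and bounded_moments: "\<And>q. \<exists>b. \<forall>c r. 1 \<le> r \<longrightarrow> \<bar>expectation (\<lambda>\<omega>. X c r \<omega> ^ q)\<bar> \<le> b"
begin

definition walk :: "'i \<Rightarrow> nat \<Rightarrow> 'a \<Rightarrow> real" where
  "walk c k \<omega> = (\<Sum>r=1..k. X c r \<omega>)"

definition word :: "'i list \<Rightarrow> nat \<Rightarrow> 'a \<Rightarrow> real" where
  "word cs k \<omega> = prod_list (map (\<lambda>c. walk c k \<omega>) cs)"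

lemma step_measurable: "1 \<le> r \<Longrightarrow> X c r \<in> borel_measurable M"
  using indep unfolding indep_vars_def2 by fastforce

lemma walk_0 [simp]: "walk c 0 = (\<lambda>_. 0)"
  by (simp add: walk_def fun_eq_iff)

lemma walk_Suc: "walk c (Suc k) \<omega> = walk c k \<omega> + X c (Suc k) \<omega>"
  by (simp add: walk_def)

lemma walk_measurable [measurable]: "walk c k \<in> borel_measurable M"
  unfolding walk_def[abs_def] by (rule borel_measurable_sum) (simp add: step_measurable)

lemma indep_step_walk: "indep_var borel (walk c k) borel (X c (Suc k))"
proof -
  have "indep_var (PiM ({c} \<times> {1..k}) (\<lambda>_. borel)) (\<lambda>\<omega>. \<lambda>i\<in>{c} \<times> {1..k}. (case i of (c, r) \<Rightarrow> X c r) \<omega>)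
      (PiM {(c, Suc k)} (\<lambda>_. borel)) (\<lambda>\<omega>. \<lambda>i\<in>{(c, Suc k)}. (case i of (c, r) \<Rightarrow> X c r) \<omega>)"
    by (rule indep_var_restrict[OF indep]) auto
  then have "indep_var borel ((\<lambda>x. \<Sum>r=1..k. x (c, r)) \<circ> (\<lambda>\<omega>. \<lambda>i\<in>{c} \<times> {1..k}. (case i of (c, r) \<Rightarrow> X c r) \<omega>))
      borel ((\<lambda>x. x (c, Suc k)) \<circ> (\<lambda>\<omega>. \<lambda>i\<in>{(c, Suc k)}. (case i of (c, r) \<Rightarrow> X c r) \<omega>))"
    by (rule indep_var_compose) (auto intro!: borel_measurable_sum measurable_component_singleton)
  then show ?thesis
    by (simp add: comp_def walk_def[abs_def])
qed

lemma walk_moment_step: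
  assumes int: "\<And>q. integrable M (\<lambda>\<omega>. walk c k \<omega> ^ q)"
  shows "integrable M (\<lambda>\<omega>. walk c (Suc k) \<omega> ^ q)"
    and "expectation (\<lambda>\<omega>. walk c (Suc k) \<omega> ^ q) = (\<Sum>j\<le>q. real (q choose j) *
      (expectation (\<lambda>\<omega>. walk c k \<omega> ^ j) * expectation (\<lambda>\<omega>. X c (Suc k) \<omega> ^ (q - j))))"
proof -
  have ind: "indep_var borel (\<lambda>\<omega>. walk c k \<omega> ^ j) borel (\<lambda>\<omega>. X c (Suc k) \<omega> ^ i)" for i j
    using indep_var_compose[OF indep_step_walk, of "\<lambda>x. x ^ j" borel "\<lambda>x. x ^ i" borel c k] by (simp add: comp_def)
  note i = int integrable_step[of "Suc k" c]
  have eq: "walk c (Suc k) \<omega> ^ q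
      = (\<Sum>j\<le>q. real (q choose j) * (walk c k \<omega> ^ j * X c (Suc k) \<omega> ^ (q - j)))" for \<omega>
    unfolding walk_Suc binomial_ring by (simp add: mult.assoc)
  have int2: "integrable M (\<lambda>\<omega>. walk c k \<omega> ^ j * X c (Suc k) \<omega> ^ (q - j))" for j
    by (rule indep_var_integrable[OF ind]) (use i in auto)
  show "integrable M (\<lambda>\<omega>. walk c (Suc k) \<omega> ^ q)"
    unfolding eq by (intro Bochner_Integration.integrable_sum integrable_mult_right int2)
  show "expectation (\<lambda>\<omega>. walk c (Suc k) \<omega> ^ q) = (\<Sum>j\<le>q. real (q choose j) *
      (expectation (\<lambda>\<omega>. walk c k \<omega> ^ j) * expectation (\<lambda>\<omega>. X c (Suc k) \<omega> ^ (q - j))))"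
    unfolding eq
    by (subst Bochner_Integration.integral_sum)
       (use i int2 in \<open>auto intro!: sum.cong simp: indep_var_lebesgue_integral[OF ind]\<close>)
qed

lemma integrable_walk_power: "integrable M (\<lambda>\<omega>. walk c k \<omega> ^ q)"
proof (induction k arbitrary: q)
  case (Suc k)
  show ?case by (rule walk_moment_step(1)[OF Suc.IH])
qed simp

lemma walk_mean: "expectation (walk c k) = 0"
  by (induction k) (use walk_moment_step(2)[OF integrable_walk_power, of c _ 1] in \<open>auto simp: mean prob_space\<close>)

lemma walk_second_moment: "expectation (\<lambda>\<omega>. walk c k \<omega> ^ 2) = real k"
proof (induction k)
  case (Suc k)
  have "{..2 :: nat} = {0, 1, 2}" by auto
  then show ?case
    using walk_moment_step(2)[OF integrable_walk_power, of c k 2] Suc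
    by (simp add: mean second_moment walk_mean prob_space)
qed simp

text \<open>
  Passing from \<open>k\<close> to \<open>k + 1\<close> steps, the binomial terms of order one in the new step vanish, so the
  increment of the \<open>q\<close>-th moment involves moments of order at most \<open>q - 2\<close>.
\<close>

lemma walk_moment_bound: "\<exists>C\<ge>0. \<forall>c k. \<bar>expectation (\<lambda>\<omega>. walk c k \<omega> ^ q)\<bar> \<le> C * real k ^ (q div 2)"
proof (induction q rule: less_induct)
  case (less q)
  consider "q = 0" | "q = 1" | "2 \<le> q" by linarith
  then show ?case
  proof cases
    case 1
    then show ?thesis by (intro exI[of _ 1]) (simp add: prob_space)
  next
    case 2
    then show ?thesis by (intro exI[of _ 0]) (simp add: walk_mean)
  next
    case 3
    define p where "p = q div 2 - 1"
    have p: "q div 2 = Suc p" using 3 by (simp add: p_def)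
    obtain C where C: "\<And>j. j < q \<Longrightarrow> 0 \<le> C j"
      "\<And>j c k. j < q \<Longrightarrow> \<bar>expectation (\<lambda>\<omega>. walk c k \<omega> ^ j)\<bar> \<le> C j * real k ^ (j div 2)"
      using less.IH by metis
    obtain b where b: "\<And>i c r. 1 \<le> r \<Longrightarrow> \<bar>expectation (\<lambda>\<omega>. X c r \<omega> ^ i)\<bar> \<le> b i"
      using bounded_moments by metis
    define D where "D = (\<Sum>j<q-1. real (q choose j) * (C j * \<bar>b (q - j)\<bar>))"
    have D: "0 \<le> D"
      unfolding D_def by (intro sum_nonneg mult_nonneg_nonneg C) auto
    have step: "\<bar>expectation (\<lambda>\<omega>. walk c (Suc k) \<omega> ^ q)\<bar>
        \<le> \<bar>expectation (\<lambda>\<omega>. walk c k \<omega> ^ q)\<bar> + D * real (Suc k) ^ p" for c k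
    proof -
      let ?t = "\<lambda>j. real (q choose j) *
        (expectation (\<lambda>\<omega>. walk c k \<omega> ^ j) * expectation (\<lambda>\<omega>. X c (Suc k) \<omega> ^ (q - j)))"
      obtain q' where q': "q = Suc (Suc q')"
        using 3 by (metis Suc_le_D Suc_le_mono numeral_2_eq_2)
      have "(\<Sum>j\<le>q. ?t j) = (\<Sum>j<q-1. ?t j) + ?t (q - 1) + ?t q"
        unfolding q' by (simp add: lessThan_Suc_atMost)
      then have "expectation (\<lambda>\<omega>. walk c (Suc k) \<omega> ^ q)
          = expectation (\<lambda>\<omega>. walk c k \<omega> ^ q) + (\<Sum>j<q-1. ?t j)"
        using 3 walk_moment_step(2)[OF integrable_walk_power, of c k q] by (simp add: mean prob_space)
      moreover have "\<bar>\<Sum>j<q-1. ?t j\<bar> \<le> (\<Sum>j<q-1. real (q choose j) * (C j * \<bar>b (q - j)\<bar>) * real (Suc k) ^ p)"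
      proof (rule order_trans[OF sum_abs sum_mono])
        fix j assume "j \<in> {..<q-1}"
        then have j: "j < q" "j div 2 \<le> p" using 3 by (auto simp: p_def)
        have "real k ^ (j div 2) \<le> real (Suc k) ^ (j div 2)"
          by (intro power_mono) auto
        also have "\<dots> \<le> real (Suc k) ^ p"
          using j by (intro power_increasing) auto
        finally have "\<bar>expectation (\<lambda>\<omega>. walk c k \<omega> ^ j)\<bar> \<le> C j * real (Suc k) ^ p"
          using C[OF j(1)] by (meson mult_left_mono order_trans)
        moreover have "\<bar>expectation (\<lambda>\<omega>. X c (Suc k) \<omega> ^ (q - j))\<bar> \<le> \<bar>b (q - j)\<bar>"
          by (rule order_trans[OF b]) auto
        ultimately have "\<bar>?t j\<bar> \<le> real (q choose j) * ((C j * real (Suc k) ^ p) * \<bar>b (q - j)\<bar>)"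
          unfolding abs_mult by (intro mult_mono) (auto intro!: mult_nonneg_nonneg C j)
        then show "\<bar>?t j\<bar> \<le> real (q choose j) * (C j * \<bar>b (q - j)\<bar>) * real (Suc k) ^ p"
          by (simp add: algebra_simps)
      qed
      ultimately show ?thesis
        by (simp add: D_def sum_distrib_right)
    qed
    \<comment> \<open>The increments add up: \<open>k * k ^ p + (k + 1) ^ p\<close> is at most
      \<open>(k + 1) ^ Suc p\<close>. The positive exponent settles \<open>k = 0\<close>.\<close>
    have "\<bar>expectation (\<lambda>\<omega>. walk c k \<omega> ^ q)\<bar> \<le> D * real k ^ Suc p" for c k
    proof (induction k)
      case 0
      then show ?case using 3 by (simp add: power_0_left)
    next
      case (Suc k)
      have "\<bar>expectation (\<lambda>\<omega>. walk c (Suc k) \<omega> ^ q)\<bar> \<le> D * (real k * real k ^ p) + D * real (Suc k) ^ p"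
        using step[of c k] Suc by simp
      also have "\<dots> \<le> D * (real k * real (Suc k) ^ p) + D * real (Suc k) ^ p"
        using D by (intro add_right_mono mult_left_mono power_mono) auto
      also have "\<dots> = D * real (Suc k) ^ Suc p"
        by (simp add: algebra_simps)
      finally show ?case .
    qed
    then show ?thesis
      using D p by (intro exI[of _ D]) auto
  qed
qed

lemma indep_walks: "indep_vars (\<lambda>_. borel) (\<lambda>c. walk c k) A"
proof -
  have "indep_vars (\<lambda>c. PiM ({c} \<times> {1..k}) (\<lambda>_. borel))
      (\<lambda>c \<omega>. \<lambda>i\<in>{c} \<times> {1..k}. (case i of (c, r) \<Rightarrow> X c r) \<omega>) A"
    by (rule indep_vars_restrict[OF indep]) (auto simp: disjoint_family_on_def)
  then have "indep_vars (\<lambda>_. borel)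
      (\<lambda>c \<omega>. (\<lambda>x. \<Sum>r=1..k. x (c, r)) (\<lambda>i\<in>{c} \<times> {1..k}. (case i of (c, r) \<Rightarrow> X c r) \<omega>)) A"
    by (rule indep_vars_compose2) (auto intro!: borel_measurable_sum measurable_component_singleton)
  then show ?thesis
    by (simp add: walk_def[abs_def])
qed

lemma word_eq_prod: "word cs k \<omega> = (\<Prod>c\<in>set cs. walk c k \<omega> ^ count_list cs c)"
  unfolding word_def by (rule prod_list_map_eq_prod_count) auto

lemma word_append: "word (cs @ ds) k \<omega> = word cs k \<omega> * word ds k \<omega>"
  by (simp add: word_def)

lemma
  shows integrable_word: "integrable M (word cs k)"
    and expectation_word: "expectation (word cs k) = (\<Prod>c\<in>set cs. expectation (\<lambda>\<omega>. walk c k \<omega> ^ count_list cs c))"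
proof -
  have ind: "indep_vars (\<lambda>_. borel) (\<lambda>c \<omega>. walk c k \<omega> ^ count_list cs c) (set cs)"
    using indep_vars_compose2[OF indep_walks, of "set cs" "\<lambda>c x. x ^ count_list cs c" "\<lambda>_. borel" k] by simp
  show "integrable M (word cs k)"
    unfolding word_eq_prod[abs_def] by (rule indep_vars_integrable[OF _ ind]) (auto intro: integrable_walk_power)
  show "expectation (word cs k) = (\<Prod>c\<in>set cs. expectation (\<lambda>\<omega>. walk c k \<omega> ^ count_list cs c))"
    unfolding word_eq_prod[abs_def]
    by (rule indep_vars_lebesgue_integral[OF _ ind]) (auto intro: integrable_walk_power)
qed

lemma expectation_word_singleton:
  assumes "count_list cs c = 1"
  shows "expectation (word cs k) = 0"
proof -
  have "c \<in> set cs"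
    using assms by (metis count_notin zero_neq_one)
  then show ?thesis
    unfolding expectation_word using assms by (auto intro!: bexI[of _ c] simp: walk_mean)
qed

lemma length_eq_sum_count: "length cs = (\<Sum>c\<in>set cs. count_list cs c)"
  using sum_count_set[of cs "set cs"] by simp

lemma expectation_word_pairs:
  assumes "\<forall>c\<in>set cs. count_list cs c = 2"
  shows "expectation (word cs k) = real k ^ (length cs div 2)"
  using assms length_eq_sum_count[of cs] unfolding expectation_word
  by (simp add: walk_second_moment)

text \<open>Independence gives one factor per distinct letter. The halves of the multiplicities,
  rounded down, add up to at most \<open>l div 2\<close>, and there are at most \<open>l\<close>
  distinct letters, so \<open>B ^ l\<close> with \<open>1 \<le> B\<close> serves all words.\<close>

lemma expectation_word_bound:
  "\<exists>C\<ge>0. \<forall>cs k. length cs = l \<longrightarrow> \<bar>expectation (word cs k)\<bar> \<le> C * real k ^ (l div 2)"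
proof -
  obtain C where C: "\<And>q. 0 \<le> C q"
    "\<And>q c k. \<bar>expectation (\<lambda>\<omega>. walk c k \<omega> ^ q)\<bar> \<le> C q * real k ^ (q div 2)"
    using walk_moment_bound by metis
  define B where "B = 1 + (\<Sum>q\<le>l. C q)"
  have B: "C q \<le> B" if "q \<le> l" for q
    using member_le_sum[of q "{..l}" C] that C(1) by (simp add: B_def add_increasing)
  have B1: "1 \<le> B"
    by (simp add: B_def sum_nonneg C)
  have "\<bar>expectation (word cs k)\<bar> \<le> B ^ l * real k ^ (l div 2)" if l: "length cs = l" for cs k
  \<comment> \<open>At \<open>k = 0\<close> powers of \<open>k\<close> are not increasing in the
    exponent; there a nonempty word vanishes, and the empty word has all exponents 0.\<close>
  proof (cases "k = 0 \<and> cs \<noteq> []")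
    case True
    then have "expectation (word cs k) = 0"
      by (auto simp: word_def[abs_def] neq_Nil_conv)
    then show ?thesis
      using B1 by simp
  next
    case False
    have cnt: "count_list cs c \<le> l" for c
      using count_le_length[of cs c] l by simp
    have "\<bar>expectation (word cs k)\<bar> = (\<Prod>c\<in>set cs. \<bar>expectation (\<lambda>\<omega>. walk c k \<omega> ^ count_list cs c)\<bar>)"
      unfolding expectation_word by (rule abs_prod)
    also have "\<dots> \<le> (\<Prod>c\<in>set cs. B * real k ^ (count_list cs c div 2))"
      by (intro prod_mono conjI order_trans[OF C(2)] mult_right_mono B cnt) auto
    also have "\<dots> = B ^ card (set cs) * real k ^ (\<Sum>c\<in>set cs. count_list cs c div 2)"
      by (simp add: prod.distrib power_sum)
    also have "\<dots> \<le> B ^ l * real k ^ (l div 2)"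
    proof (intro mult_mono)
      show "B ^ card (set cs) \<le> B ^ l"
        using B1 card_length[of cs] l by (intro power_increasing) auto
      have "2 * (\<Sum>c\<in>set cs. count_list cs c div 2) \<le> (\<Sum>c\<in>set cs. count_list cs c)"
        unfolding sum_distrib_left by (rule sum_mono) simp
      then have "(\<Sum>c\<in>set cs. count_list cs c div 2) \<le> l div 2"
        using l length_eq_sum_count[of cs] by linarith
      then show "real k ^ (\<Sum>c\<in>set cs. count_list cs c div 2) \<le> real k ^ (l div 2)"
        using False l by (cases "k = 0") (auto intro!: power_increasing)
    qed (use B1 in auto)
    finally show ?thesis .
  qed
  then show ?thesis
    using B1 by (intro exI[of _ "B ^ l"]) auto
qed

end

text \<open>Independence from \<open>K\<close> is required for functionals of the whole array of
  steps, since a word mixes several walks that are all stopped by the same \<open>K\<close>.\<close>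

locale stopped_walks = walk_family +
  fixes K :: "'a \<Rightarrow> nat"
  assumes K_measurable [measurable]: "K \<in> measurable M (count_space UNIV)"
    and indep_K: "\<And>u. u \<in> borel_measurable (PiM (UNIV \<times> {1..}) (\<lambda>_. borel)) \<Longrightarrow>
      indep_var borel (\<lambda>\<omega>. u (\<lambda>(c, r)\<in>UNIV \<times> {1..}. X c r \<omega>)) borel (\<lambda>\<omega>. real (K \<omega>))"
    and integrable_K: "\<And>m. integrable M (\<lambda>\<omega>. real (K \<omega>) ^ m)"
begin

lemma
  shows integrable_stopped_word: "integrable M (\<lambda>\<omega>. word cs (K \<omega>) \<omega>)"
    and expectation_stopped_word:
      "expectation (\<lambda>\<omega>. word cs (K \<omega>) \<omega>) = expectation (\<lambda>\<omega>. expectation (word cs (K \<omega>)))"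
proof -
  have ind: "indep_var borel (word cs k) borel (\<lambda>\<omega>. of_nat (K \<omega>))" for k
  proof -
    let ?u = "\<lambda>x. prod_list (map (\<lambda>c. \<Sum>r=1..k. x (c, r) :: real) cs)"
    have "?u \<in> borel_measurable (PiM (UNIV \<times> {1..}) (\<lambda>_. borel))"
      by (induction cs) (auto intro!: borel_measurable_times borel_measurable_sum measurable_component_singleton)
    from indep_K[OF this] show ?thesis
      by (simp add: word_def[abs_def] walk_def)
  qed
  obtain C where C: "0 \<le> C"
    "\<And>ds k. length ds = 2 * length cs \<Longrightarrow> \<bar>expectation (word ds k)\<bar> \<le> C * real k ^ length cs"
    using expectation_word_bound[of "2 * length cs"] by auto
  have E: "expectation (\<lambda>\<omega>. norm (word cs k \<omega>)) \<le> 1 + C * real k ^ length cs" for k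
  proof -
    \<comment> \<open>With this inequality the absolute moment of a word is controlled by the
      ordinary moment of the doubled word \<open>cs @ cs\<close>, to which the bound for words
      applies.\<close>
    have le: "norm x \<le> 1 + x * x" for x :: real
    proof (cases "\<bar>x\<bar> \<le> 1")
      case False
      then have "\<bar>x\<bar> * 1 \<le> \<bar>x\<bar> * \<bar>x\<bar>" by (intro mult_left_mono) auto
      then show ?thesis by simp
    qed (auto intro: add_increasing2)
    have "expectation (\<lambda>\<omega>. norm (word cs k \<omega>)) \<le> expectation (\<lambda>\<omega>. 1 + word (cs @ cs) k \<omega>)"
    proof (rule integral_mono)
      show "integrable M (\<lambda>\<omega>. norm (word cs k \<omega>))" "integrable M (\<lambda>\<omega>. 1 + word (cs @ cs) k \<omega>)"
        using integrable_word by simp_all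
      show "norm (word cs k \<omega>) \<le> 1 + word (cs @ cs) k \<omega>" for \<omega>
        unfolding word_append by (rule le)
    qed
    also have "\<dots> \<le> 1 + C * real k ^ length cs"
      using C(2)[of "cs @ cs" k] by (subst Bochner_Integration.integral_add) (auto simp: prob_space integrable_word)
    finally show ?thesis .
  qed
  have dom: "integrable M (\<lambda>\<omega>. expectation (\<lambda>\<omega>'. norm (word cs (K \<omega>) \<omega>')))"
  proof (rule Bochner_Integration.integrable_bound)
    show "integrable M (\<lambda>\<omega>. 1 + C * real (K \<omega>) ^ length cs)"
      using integrable_K by simp
    show "(\<lambda>\<omega>. expectation (\<lambda>\<omega>'. norm (word cs (K \<omega>) \<omega>'))) \<in> borel_measurable M"
      by (rule measurable_compose[OF K_measurable]) simp
    show "AE \<omega> in M. norm (expectation (\<lambda>\<omega>'. norm (word cs (K \<omega>) \<omega>'))) \<le> norm (1 + C * real (K \<omega>) ^ length cs)"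
      using E C(1) by (auto simp: integral_nonneg_AE)
  qed
  note res = expectation_random_index[OF K_measurable ind integrable_word dom]
  show "integrable M (\<lambda>\<omega>. word cs (K \<omega>) \<omega>)"
    by (rule res)
  show "expectation (\<lambda>\<omega>. word cs (K \<omega>) \<omega>) = expectation (\<lambda>\<omega>. expectation (word cs (K \<omega>)))"
    by (rule res)
qed

lemma expectation_stopped_word_bound:
  assumes "0 \<le> C" "\<And>k. \<bar>expectation (word cs k)\<bar> \<le> C * real k ^ m"
  shows "\<bar>expectation (\<lambda>\<omega>. word cs (K \<omega>) \<omega>)\<bar> \<le> C * expectation (\<lambda>\<omega>. real (K \<omega>) ^ m)"
proof -
  have "\<bar>expectation (\<lambda>\<omega>. word cs (K \<omega>) \<omega>)\<bar> \<le> expectation (\<lambda>\<omega>. \<bar>expectation (word cs (K \<omega>))\<bar>)"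
    unfolding expectation_stopped_word by (rule integral_abs_bound)
  also have "\<dots> \<le> expectation (\<lambda>\<omega>. C * real (K \<omega>) ^ m)"
  proof (rule integral_mono_AE')
    show "integrable M (\<lambda>\<omega>. C * real (K \<omega>) ^ m)"
      using integrable_K by simp
  qed (use assms in auto)
  finally show ?thesis by simp
qed

end

text \<open>A word in \<open>P\<close> has expectation exactly \<open>e n\<close>, a word in
  \<open>R\<close> at most \<open>C * e n\<close>, every other word 0; so only the cardinalities of
  \<open>P\<close> and \<open>R\<close> matter. For odd \<open>l\<close> no word consists of pairs,
  so \<open>P\<close> is empty and \<gamma> is forced to be 0.\<close>

lemma (in walk_family) words_limit:
  fixes K :: "nat \<Rightarrow> 'a \<Rightarrow> nat" and \<Omega> :: "nat \<Rightarrow> 's set" and w :: "nat \<Rightarrow> 's \<Rightarrow> 'i list"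
  assumes sw: "\<And>n. stopped_walks M X (K n)" and "0 < \<alpha>"
    and K: "(\<lambda>n. expectation (\<lambda>\<omega>. real (K n \<omega>) ^ (l div 2)) / (real n powr \<alpha>) ^ (l div 2)) \<longlonglongrightarrow> v"
    and fin: "\<And>n. finite (\<Omega> n)" and len: "\<And>n s. s \<in> \<Omega> n \<Longrightarrow> length (w n s) = l"
    and pairs: "(\<lambda>n. card {s \<in> \<Omega> n. \<forall>c\<in>set (w n s). count_list (w n s) c = 2} / real n powr (1 + l / 2)) \<longlonglongrightarrow> \<gamma>"
    and rest: "(\<lambda>n. card {s \<in> \<Omega> n. (\<forall>c. count_list (w n s) c \<noteq> 1) \<and> \<not> (\<forall>c\<in>set (w n s). count_list (w n s) c = 2)}
        / real n powr (1 + l / 2)) \<longlonglongrightarrow> 0"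
  shows "(\<lambda>n. (\<Sum>s\<in>\<Omega> n. expectation (\<lambda>\<omega>. word (w n s) (K n \<omega>) \<omega>)) * real n powr (- \<alpha> * l / 2) / real n powr (1 + l / 2))
      \<longlonglongrightarrow> \<gamma> * v"
proof -
  define P where "P n = {s \<in> \<Omega> n. \<forall>c\<in>set (w n s). count_list (w n s) c = 2}" for n
  define R where "R n = {s \<in> \<Omega> n. (\<forall>c. count_list (w n s) c \<noteq> 1) \<and> \<not> (\<forall>c\<in>set (w n s). count_list (w n s) c = 2)}" for n
  define m where "m = l div 2"
  define e where "e n = expectation (\<lambda>\<omega>. real (K n \<omega>) ^ m)" for n
  \<comment> \<open>What is left of the normalisation after the moment of order
    \<open>l div 2\<close> has used its share: 1 for even \<open>l\<close>, and at most 1 for odd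
    \<open>l\<close>.\<close>
  define \<rho> where "\<rho> n = real n powr (- \<alpha> * (l mod 2) / 2)" for n
  define E where "E n s = expectation (\<lambda>\<omega>. word (w n s) (K n \<omega>) \<omega>)" for n s
  obtain C where C: "0 \<le> C" "\<And>cs k. length cs = l \<Longrightarrow> \<bar>expectation (word cs k)\<bar> \<le> C * real k ^ m"
    using expectation_word_bound[of l] unfolding m_def by blast
  have e0: "0 \<le> e n" for n
    unfolding e_def by (rule integral_nonneg_AE) auto
  have EP: "E n s = e n" if "s \<in> P n" for n s
    unfolding E_def stopped_walks.expectation_stopped_word[OF sw] using that
    by (auto simp: P_def e_def m_def expectation_word_pairs len)
  have ER: "\<bar>E n s\<bar> \<le> C * e n" if "s \<in> R n" for n s
    unfolding E_def e_def
    by (rule stopped_walks.expectation_stopped_word_bound[OF sw]) (use C that len in \<open>auto simp: R_def\<close>)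
  have E0: "E n s = 0" if s: "s \<in> \<Omega> n" "s \<notin> P n" "s \<notin> R n" for n s
  proof -
    obtain c where "count_list (w n s) c = 1"
      using s by (auto simp: P_def R_def)
    then have "expectation (word (w n s) k) = 0" for k
      by (rule expectation_word_singleton)
    then show ?thesis
      by (simp add: E_def stopped_walks.expectation_stopped_word[OF sw])
  qed
  have finPR: "finite (P n)" "finite (R n)" for n
    using fin by (auto simp: P_def R_def)
  have split: "(\<Sum>s\<in>\<Omega> n. E n s) = card (P n) * e n + (\<Sum>s\<in>R n. E n s)" for n
  proof -
    have "(\<Sum>s\<in>\<Omega> n. E n s) = (\<Sum>s\<in>P n \<union> R n. E n s)"
      by (rule sum.mono_neutral_right) (use fin E0 in \<open>auto simp: P_def R_def\<close>)
    also have "\<dots> = (\<Sum>s\<in>P n. E n s) + (\<Sum>s\<in>R n. E n s)"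
      by (rule sum.union_disjoint) (use finPR in \<open>auto simp: P_def R_def\<close>)
    finally show ?thesis
      by (simp add: EP)
  qed
  have Rsum: "\<bar>\<Sum>s\<in>R n. E n s\<bar> \<le> card (R n) * (C * e n)" for n
    using order_trans[OF sum_abs sum_bounded_above[of "R n" "\<lambda>s. \<bar>E n s\<bar>"]] ER by auto
  have pw: "real n powr (- \<alpha> * l / 2) = \<rho> n / (real n powr \<alpha>) ^ m" if "0 < n" for n
  proof -
    have "real l = 2 * real m + real (l mod 2)"
      using div_mult_mod_eq[of l 2] unfolding m_def by (metis mult.commute of_nat_add of_nat_mult of_nat_numeral)
    then have "- \<alpha> * l / 2 = - \<alpha> * (l mod 2) / 2 - \<alpha> * m"
      by (simp add: field_simps)
    then show ?thesis
      using that by (simp add: \<rho>_def powr_diff powr_powr flip: powr_realpow)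
  qed
  have \<rho>1: "\<rho> n \<le> 1 \<and> 0 \<le> \<rho> n" if "0 < n" for n
    using that \<open>0 < \<alpha>\<close> unfolding \<rho>_def by (auto intro!: powr_le1 simp: powr_le_one_le ge_one_powr_ge_zero powr_minus_divide divide_le_eq_1)
  let ?q = "\<lambda>n. e n / (real n powr \<alpha>) ^ m"
  let ?h = "\<lambda>n. real n powr (1 + l / 2)"
  have q: "?q \<longlonglongrightarrow> v"
    using K by (simp add: e_def m_def)
  have main: "(\<lambda>n. card (P n) / ?h n * ?q n * \<rho> n) \<longlonglongrightarrow> \<gamma> * v"
  proof (cases "even l")
    case True
    have "(\<lambda>n. card (P n) / ?h n * ?q n) \<longlonglongrightarrow> \<gamma> * v"
      using tendsto_mult[OF pairs q] by (simp add: P_def)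
    then show ?thesis
      by (rule Lim_transform_eventually) (use True in \<open>auto intro!: eventually_sequentiallyI[of 1] simp: \<rho>_def\<close>)
  next
    case False
    have "P n = {}" for n
    proof (rule ccontr)
      assume "P n \<noteq> {}"
      then obtain s where s: "s \<in> \<Omega> n" "\<forall>c\<in>set (w n s). count_list (w n s) c = 2"
        by (auto simp: P_def)
      then have "l = (\<Sum>c\<in>set (w n s). 2)"
        using len length_eq_sum_count[of "w n s"] by simp
      then show False
        using False by simp
    qed
    then have "\<gamma> = 0" "P = (\<lambda>_. {})"
      using pairs by (auto simp: P_def[symmetric] LIMSEQ_const_iff)
    then show ?thesis by simp
  qed
  have err: "(\<lambda>n. (\<Sum>s\<in>R n. E n s) * real n powr (- \<alpha> * l / 2) / ?h n) \<longlonglongrightarrow> 0"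
  proof (rule Lim_null_comparison)
    have "(\<lambda>n. card (R n) / ?h n * (C * ?q n)) \<longlonglongrightarrow> 0 * (C * v)"
      using rest unfolding R_def[symmetric] by (intro tendsto_intros q)
    then show "(\<lambda>n. card (R n) / ?h n * (C * ?q n)) \<longlonglongrightarrow> 0" by simp
    show "\<forall>\<^sub>F n in sequentially. norm ((\<Sum>s\<in>R n. E n s) * real n powr (- \<alpha> * l / 2) / ?h n)
        \<le> card (R n) / ?h n * (C * ?q n)"
    proof (rule eventually_sequentiallyI[of 1])
      fix n :: nat assume n: "1 \<le> n"
      have pos: "0 < ?h n" "0 < (real n powr \<alpha>) ^ m"
        using n by auto
      have "norm ((\<Sum>s\<in>R n. E n s) * real n powr (- \<alpha> * l / 2) / ?h n)
          = \<bar>\<Sum>s\<in>R n. E n s\<bar> * (\<rho> n / (real n powr \<alpha>) ^ m) / ?h n"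
        using \<rho>1[of n] n pos pw[of n] by (simp add: abs_mult del: mult_minus_left)
      also have "\<dots> \<le> card (R n) * (C * e n) * (1 / (real n powr \<alpha>) ^ m) / ?h n"
        using \<rho>1[of n] n pos Rsum[of n] C(1) e0[of n]
        by (intro divide_right_mono mult_mono) (auto intro!: divide_right_mono)
      finally show "norm ((\<Sum>s\<in>R n. E n s) * real n powr (- \<alpha> * l / 2) / ?h n)
        \<le> card (R n) / ?h n * (C * ?q n)"
        by (simp add: mult_ac)
    qed
  qed
  have "(\<lambda>n. card (P n) / ?h n * ?q n * \<rho> n + (\<Sum>s\<in>R n. E n s) * real n powr (- \<alpha> * l / 2) / ?h n)
      \<longlonglongrightarrow> \<gamma> * v + 0"
    by (intro tendsto_add main err)
  then have "(\<lambda>n. card (P n) / ?h n * ?q n * \<rho> n + (\<Sum>s\<in>R n. E n s) * real n powr (- \<alpha> * l / 2) / ?h n)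
      \<longlonglongrightarrow> \<gamma> * v" by simp
  then show ?thesis
  proof (rule Lim_transform_eventually, intro eventually_sequentiallyI[of 1])
    fix n :: nat assume n: "1 \<le> n"
    have "real n powr (- \<alpha> * l / 2) = \<rho> n / (real n powr \<alpha>) ^ m"
      using n by (intro pw) simp
    then show "card (P n) / ?h n * ?q n * \<rho> n + (\<Sum>s\<in>R n. E n s) * real n powr (- \<alpha> * l / 2) / ?h n
        = (\<Sum>s\<in>\<Omega> n. expectation (\<lambda>\<omega>. word (w n s) (K n \<omega>) \<omega>)) * real n powr (- \<alpha> * l / 2) / ?h n"
      unfolding E_def[symmetric] split by (simp add: add_divide_distrib distrib_left distrib_right mult_ac)
  qed
qed

section \<open>Lists with few values\<close>

lemma finite_lists_in: "finite {xs. length xs = l \<and> set xs \<subseteq> {..<n :: nat}}"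
  using finite_lists_length_eq[of "{..<n}" l] by (simp add: conj_commute)

lemma card_lists_in: "card {xs. length xs = l \<and> set xs \<subseteq> {..<n :: nat}} = n ^ l"
  using card_lists_length_eq[of "{..<n}" l] by (simp add: conj_commute)

text \<open>Such a list is read off from a table of \<open>b\<close> values and a list of positions
  in it: at most \<open>n ^ b\<close> tables and \<open>b ^ l\<close> position lists. Short tables
  are padded with 0, a legal value because \<open>1 \<le> n\<close>.\<close>

lemma card_lists_few_values:
  assumes "1 \<le> n"
  shows "card {ys. length ys = l \<and> set ys \<subseteq> {..<n :: nat} \<and> card (set ys) \<le> b} \<le> n ^ b * b ^ l"
proof -
  let ?A = "{zs. length zs = b \<and> set zs \<subseteq> {..<n}}" and ?B = "{is. length is = l \<and> set is \<subseteq> {..<b}}"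
  have "{ys. length ys = l \<and> set ys \<subseteq> {..<n} \<and> card (set ys) \<le> b}
      \<subseteq> (\<lambda>(zs, is). map ((!) zs) is) ` (?A \<times> ?B)"
  proof
    fix ys assume "ys \<in> {ys. length ys = l \<and> set ys \<subseteq> {..<n} \<and> card (set ys) \<le> b}"
    then have ys: "length ys = l" "set ys \<subseteq> {..<n}" "card (set ys) \<le> b" by auto
    define zs where "zs = sorted_list_of_set (set ys) @ replicate (b - card (set ys)) 0"
    have zs: "length zs = b" "set zs \<subseteq> {..<n}" "set ys \<subseteq> set zs"
      using ys assms by (auto simp: zs_def)
    have "\<exists>i. i < b \<and> zs ! i = y" if "y \<in> set ys" for y
      using that zs by (metis in_set_conv_nth subsetD)
    then obtain f where f: "\<And>y. y \<in> set ys \<Longrightarrow> f y < b \<and> zs ! f y = y"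
      by metis
    have "ys = map ((!) zs) (map f ys)"
      using f by (simp add: map_idI)
    moreover have "(zs, map f ys) \<in> ?A \<times> ?B"
      using zs ys f by auto
    ultimately show "ys \<in> (\<lambda>(zs, is). map ((!) zs) is) ` (?A \<times> ?B)"
      by (metis (mono_tags, lifting) case_prod_conv image_eqI)
  qed
  then have "card {ys. length ys = l \<and> set ys \<subseteq> {..<n} \<and> card (set ys) \<le> b} \<le> card (?A \<times> ?B)"
    by (intro surj_card_le finite_cartesian_product finite_lists_in)
  then show ?thesis
    by (simp add: card_cartesian_product card_lists_in)
qed

lemma LIMSEQ_power_over_powr:
  assumes "real b < a"
  shows "(\<lambda>n. c * real n ^ b / real n powr a) \<longlonglongrightarrow> 0"
proof -
  have "(\<lambda>n. c * real n powr (real b - a)) \<longlonglongrightarrow> c * 0"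
    by (intro tendsto_intros tendsto_neg_powr filterlim_real_sequentially) (use assms in simp)
  then have "(\<lambda>n. c * real n powr (real b - a)) \<longlonglongrightarrow> 0" by simp
  then show ?thesis
    by (rule Lim_transform_eventually)
       (auto intro!: eventually_sequentiallyI[of 1] simp: powr_diff powr_realpow)
qed

section \<open>Counting closed walks on the complete graph\<close>

text \<open>The value of \<open>link2\<close> at zero-based indices: an undirected edge, loops
  included, coded as an ordered pair.\<close>

definition uedge :: "nat \<Rightarrow> nat \<Rightarrow> nat \<times> nat" where
  "uedge i j = (max (Suc i) (Suc j), min (Suc i) (Suc j))"

lemma uedge_eq_iff: "uedge a b = uedge c d \<longleftrightarrow> (a = c \<and> b = d) \<or> (a = d \<and> b = c)"
  by (auto simp: uedge_def max_def min_def)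

lemma uedge_commute: "uedge a b = uedge b a"
  by (simp add: uedge_eq_iff)

definition uedges_in :: "nat set \<Rightarrow> (nat \<times> nat) set" where
  "uedges_in U = {uedge a b |a b. a \<in> U \<and> b \<in> U}"

lemma uedge_in_iff: "uedge a b \<in> uedges_in U \<longleftrightarrow> a \<in> U \<and> b \<in> U"
  by (auto simp: uedges_in_def uedge_eq_iff)

lemma uedges_in_mono: "U \<subseteq> V \<Longrightarrow> uedges_in U \<subseteq> uedges_in V"
  by (auto simp: uedges_in_def)

fun trail :: "nat \<Rightarrow> nat list \<Rightarrow> (nat \<times> nat) list" where
  "trail j [] = []"
| "trail j (k # xs) = uedge k j # trail k xs"

lemma length_trail [simp]: "length (trail j xs) = length xs"
  by (induction xs arbitrary: j) auto

lemma set_trail_subset: "set (trail j xs) \<subseteq> uedges_in (insert j (set xs))"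
proof (induction xs arbitrary: j)
  case (Cons k xs)
  then show ?case
    using uedges_in_mono[of "insert k (set xs)" "insert j (set (k # xs))"] by (auto simp: uedge_in_iff)
qed simp

text \<open>
  The walk \<open>xs\<close> from \<open>j\<close> is a depth-first traversal of a plane tree: \<open>p\<close> is the path from \<open>j\<close> back to
  the root, \<open>U\<close> the set of vertices visited so far, and each step either goes to a new vertex or
  returns to the parent.
\<close>

fun tree_walk :: "nat \<Rightarrow> nat list \<Rightarrow> nat set \<Rightarrow> nat list \<Rightarrow> bool" where
  "tree_walk j p U [] \<longleftrightarrow> p = []"
| "tree_walk j p U (k # xs) \<longleftrightarrow>
     (if k \<notin> U then tree_walk k (j # p) (insert k U) xs
      else (case p of [] \<Rightarrow> False | b # q \<Rightarrow> k = b \<and> tree_walk b q U xs))"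

lemma tree_walk_last: "tree_walk j p U xs \<Longrightarrow> last (j # xs) = last (j # p)"
proof (induction xs arbitrary: j p U)
  case (Cons k xs)
  then show ?case
    by (cases "k \<in> U"; cases p) fastforce+
qed simp

text \<open>The edges of the path \<open>p\<close> are the debt of the traversal: a step to a new
  vertex adds an edge that must be crossed once more, and a return to the parent pays one off. For a
  walk that starts at the root with no debt, every edge used occurs exactly twice.\<close>

lemma tree_walk_count:
  assumes "tree_walk j p U xs" "distinct (j # p)" "set (j # p) \<subseteq> U"
  shows "count_list (trail j xs) e \<in>
    (if e \<in> set (trail j p) then {1} else if e \<in> uedges_in U then {0} else {0, 2})"
  using assms
proof (induction xs arbitrary: j p U)
  case (Cons k xs)
  have pU: "set (trail j p) \<subseteq> uedges_in U"
    using set_trail_subset[of j p] uedges_in_mono[OF Cons.prems(3)] by auto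
  show ?case
  proof (cases "k \<in> U")
    case False
    have IH: "count_list (trail k xs) e \<in>
      (if e \<in> set (trail k (j # p)) then {1} else if e \<in> uedges_in (insert k U) then {0} else {0, 2})"
      by (rule Cons.IH) (use Cons.prems False in auto)
    have new: "uedge k j \<notin> uedges_in U"
      using False by (simp add: uedge_in_iff)
    have "uedges_in U \<subseteq> uedges_in (insert k U)"
      by (rule uedges_in_mono) auto
    then show ?thesis
      using IH new pU by (auto simp: uedge_commute[of j k] split: if_splits)
  next
    case True
    then obtain q where p: "p = k # q" and tw: "tree_walk k q U xs"
      using Cons.prems(1) by (auto split: list.splits)
    have IH: "count_list (trail k xs) e \<in>
      (if e \<in> set (trail k q) then {1} else if e \<in> uedges_in U then {0} else {0, 2})"
      by (rule Cons.IH[OF tw]) (use Cons.prems p in auto)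
    have "uedge k j \<notin> set (trail k q)"
      using set_trail_subset[of k q] Cons.prems(2) p by (auto simp: uedge_in_iff)
    then show ?thesis
      using IH pU p by (auto split: if_splits)
  qed
qed auto

text \<open>The first step into a new vertex crosses an edge with an end outside \<open>U\<close>,
  hence outside \<open>C\<close>. Enlarging \<open>U\<close> and \<open>C\<close> together keeps the
  edges charged to different vertices distinct.\<close>

lemma card_new_vertices_le:
  assumes "C \<subseteq> uedges_in U" "j \<in> U"
  shows "card (set xs - U) \<le> card (set (trail j xs) - C)"
  using assms
proof (induction xs arbitrary: j U C)
  case (Cons k xs)
  let ?e = "uedge k j"
  show ?case
  proof (cases "k \<in> U")
    case False
    then have eC: "?e \<notin> C"
      using Cons.prems by (auto simp: uedge_in_iff)
    have "card (set xs - insert k U) \<le> card (set (trail k xs) - insert ?e C)"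
      using Cons.prems uedges_in_mono[of U "insert k U"] by (intro Cons.IH) (auto simp: uedge_in_iff)
    moreover have "set (k # xs) - U = insert k (set xs - insert k U)"
      "set (trail j (k # xs)) - C = insert ?e (set (trail k xs) - insert ?e C)"
      using False eC by auto
    ultimately show ?thesis
      by (simp only: card_insert_disjoint) simp
  next
    case True
    then have "card (set (k # xs) - U) = card (set xs - U)"
      by (simp add: insert_Diff_if)
    also have "\<dots> \<le> card (set (trail k xs) - C)"
      using True Cons.prems by (intro Cons.IH) auto
    also have "\<dots> \<le> card (set (trail j (k # xs)) - C)"
      by (intro card_mono) auto
    finally show ?thesis .
  qed
qed simp

lemma tree_walkI:
  assumes "distinct (j # p)" "set (j # p) \<subseteq> U" "C \<subseteq> uedges_in U" "set (trail j p) \<subseteq> C"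
    and "\<And>e. e \<in> C \<Longrightarrow> count_list (trail j xs) e = (if e \<in> set (trail j p) then 1 else 0)"
    and "\<And>e. e \<notin> C \<Longrightarrow> count_list (trail j xs) e \<in> {0, 2}"
    and "card (set (trail j xs) - C) \<le> card (set xs - U)"
  shows "tree_walk j p U xs"
  using assms
proof (induction xs arbitrary: j p U C)
  case Nil
  show ?case
  proof (cases p)
    case (Cons b q)
    then have "uedge b j \<in> C" using Nil.prems(4) by auto
    then show ?thesis using Nil.prems(5)[of "uedge b j"] Cons by auto
  qed simp
next
  case (Cons k xs)
  let ?e = "uedge k j"
  note cnt = Cons.prems(5,6)
  show ?case
  proof (cases "k \<in> U")
    case False
    have eC: "?e \<notin> C"
      using False Cons.prems(3) by (auto simp: uedge_in_iff)
    have C': "insert ?e C \<subseteq> uedges_in (insert k U)"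
      using Cons.prems(2,3) uedges_in_mono[of U "insert k U"] by (auto simp: uedge_in_iff)
    have "tree_walk k (j # p) (insert k U) xs"
    proof (rule Cons.IH[OF _ _ C'])
      fix e
      show "count_list (trail k xs) e = (if e \<in> set (trail k (j # p)) then 1 else 0)" if "e \<in> insert ?e C"
        using that cnt(1)[of e] cnt(2)[of e] eC Cons.prems(4) by (auto simp: uedge_commute[of j k] split: if_splits)
      show "count_list (trail k xs) e \<in> {0, 2}" if "e \<notin> insert ?e C"
        using that cnt(2)[of e] by (auto split: if_splits)
    next
      have "set (k # xs) - U = insert k (set xs - insert k U)"
        "set (trail j (k # xs)) - C = insert ?e (set (trail k xs) - insert ?e C)"
        using False eC by auto
      then have "card (set (k # xs) - U) = Suc (card (set xs - insert k U))"
        "card (set (trail j (k # xs)) - C) = Suc (card (set (trail k xs) - insert ?e C))"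
        by (simp_all only: card_insert_disjoint) simp_all
      then show "card (set (trail k xs) - insert ?e C) \<le> card (set xs - insert k U)"
        using Cons.prems(7) by linarith
    qed (use Cons.prems False in \<open>auto simp: uedge_commute[of j k]\<close>)
    then show ?thesis using False by simp
  next
    case True
    have eU: "?e \<in> uedges_in U"
      using True Cons.prems(2) by (simp add: uedge_in_iff)
    have vert: "set (k # xs) - U = set xs - U"
      using True by auto
    \<comment> \<open>A fresh edge between visited vertices would be charged to no new vertex and
      break the count.\<close>
    have eC: "?e \<in> C"
    proof (rule ccontr)
      assume eC: "?e \<notin> C"
      have "card (set xs - U) \<le> card (set (trail k xs) - insert ?e C)"
        by (rule card_new_vertices_le) (use eU Cons.prems(3) True in auto)
      moreover have "set (trail j (k # xs)) - C = insert ?e (set (trail k xs) - insert ?e C)"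
        using eC by auto
      then have "card (set (trail j (k # xs)) - C) = Suc (card (set (trail k xs) - insert ?e C))"
        by (simp only: card_insert_disjoint) simp
      ultimately show False
        using Cons.prems(7) unfolding vert by linarith
    qed
    then have ep: "?e \<in> set (trail j p)"
      using cnt(1)[of ?e] by (auto split: if_splits)
    then obtain b q where p: "p = b # q" by (cases p) auto
    \<comment> \<open>The path beyond the parent avoids \<open>j\<close>, so the only path edge at
      \<open>j\<close> is the one to the parent.\<close>
    have "uedge k j \<notin> set (trail b q)" for k
      using set_trail_subset[of b q] Cons.prems(1) p by (auto simp: uedge_in_iff)
    then have notin: "?e \<notin> set (trail b q)" "?e = uedge b j"
      using ep p by auto
    then have kb: "k = b"
      by (auto simp: uedge_eq_iff)
    have "tree_walk b q U xs"
    proof (rule Cons.IH)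
      fix e
      show "count_list (trail b xs) e = (if e \<in> set (trail b q) then 1 else 0)" if "e \<in> C"
        using that cnt(1)[of e] p kb notin by (auto split: if_splits)
      show "count_list (trail b xs) e \<in> {0, 2}" if "e \<notin> C"
        using that cnt(2)[of e] p kb eC by (auto split: if_splits)
    next
      show "card (set (trail b xs) - C) \<le> card (set xs - U)"
        using Cons.prems(7) eC kb unfolding vert by (simp add: insert_Diff_if)
    qed (use Cons.prems p in auto)
    then show ?thesis using True p kb by simp
  qed
qed

text \<open>With \<open>V\<close> vertices and \<open>E\<close> edges,
  \<open>2 * (V - 1) \<le> 2 * E \<le> length xs\<close>. If the claimed bound failed, equality
  would hold throughout: every edge would occur exactly twice and \<open>E = V - 1\<close>, which
  makes the walk a tree walk.\<close>

lemma tree_walk_or_few_vertices: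
  assumes no1: "\<And>e. count_list (trail j xs) e \<noteq> 1" and notree: "\<not> tree_walk j [] {j} xs"
  shows "2 * card (set (j # xs)) \<le> length xs + 1"
proof (rule ccontr)
  assume "\<not> ?thesis"
  then have big: "length xs + 2 \<le> 2 * card (set (j # xs))" by simp
  let ?E = "set (trail j xs)" and ?c = "count_list (trail j xs)"
  have V: "card (set (j # xs)) = Suc (card (set xs - {j}))"
    using card.insert_remove[of "set xs" j] by simp
  have VE: "card (set xs - {j}) \<le> card ?E"
    using card_new_vertices_le[of "{}" "{j}" j xs] by simp
  have c2: "2 \<le> ?c e" if "e \<in> ?E" for e
  proof -
    have "?c e \<noteq> 0" using that by (simp add: count_list_0_iff)
    then show ?thesis using no1[of e] by linarith
  qed
  have len: "length xs = (\<Sum>e\<in>?E. ?c e)"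
    using sum_count_set[of "trail j xs" ?E] by simp
  have "(\<Sum>e\<in>?E. 2) \<le> (\<Sum>e\<in>?E. ?c e)"
    by (rule sum_mono) (rule c2)
  then have eq: "card (set xs - {j}) = card ?E" "(\<Sum>e\<in>?E. 2) = (\<Sum>e\<in>?E. ?c e)"
    using big V VE len by auto
  have "?c e = 2" if "e \<in> ?E" for e
    using sum_mono_inv[OF eq(2) c2 that] by simp
  then have "?c e \<in> {0, 2}" for e
    by (cases "e \<in> ?E") (auto simp: count_notin)
  then have "tree_walk j [] {j} xs"
    by (intro tree_walkI[where C = "{}"]) (use eq in auto)
  then show False using notree by simp
qed

section \<open>The asymptotic number of tree walks\<close>

text \<open>Here \<open>d\<close> is the present depth, \<open>u\<close> the number of visited
  vertices and the last argument the number of steps left. A step down the tree has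
  \<open>n - u\<close> choices, a return has one.\<close>

fun tree_count :: "nat \<Rightarrow> nat \<Rightarrow> nat \<Rightarrow> nat \<Rightarrow> nat" where
  "tree_count n d u 0 = (if d = 0 then 1 else 0)"
| "tree_count n d u (Suc r) = (n - u) * tree_count n (Suc d) (Suc u) r
     + (if d = 0 then 0 else tree_count n (d - 1) u r)"

lemma card_tree_walks:
  assumes "U \<subseteq> {..<n}" "set (j # p) \<subseteq> U"
  shows "card {xs. length xs = r \<and> set xs \<subseteq> {..<n} \<and> tree_walk j p U xs} = tree_count n (length p) (card U) r"
  using assms
proof (induction r arbitrary: j p U)
  case 0
  have "{xs. length xs = 0 \<and> set xs \<subseteq> {..<n} \<and> tree_walk j p U xs} = (if p = [] then {[]} else {})"
    by auto
  then show ?case by simp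
next
  case (Suc r)
  have finU: "finite U" using Suc.prems(1) finite_subset by blast
  let ?S = "\<lambda>j p U. {xs. length xs = r \<and> set xs \<subseteq> {..<n} \<and> tree_walk j p U xs}"
  let ?N = "\<Union>k\<in>{..<n} - U. Cons k ` ?S k (j # p) (insert k U)"
  let ?P = "case p of [] \<Rightarrow> {} | b # q \<Rightarrow> Cons b ` ?S b q U"
  have fin: "finite (?S j p U)" for j p U
    by (rule finite_subset[OF _ finite_lists_in[of r n]]) auto
  have "{xs. length xs = Suc r \<and> set xs \<subseteq> {..<n} \<and> tree_walk j p U xs} = ?N \<union> ?P"
  proof (rule Set.set_eqI)
    fix xs
    show "xs \<in> {xs. length xs = Suc r \<and> set xs \<subseteq> {..<n} \<and> tree_walk j p U xs} \<longleftrightarrow> xs \<in> ?N \<union> ?P"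
      using Suc.prems by (cases xs; cases p) (auto split: if_splits)
  qed
  moreover have "?N \<inter> ?P = {}"
    using Suc.prems by (auto split: list.splits)
  moreover have "finite ?N" "finite ?P"
    using fin by (auto split: list.splits)
  ultimately have "card {xs. length xs = Suc r \<and> set xs \<subseteq> {..<n} \<and> tree_walk j p U xs} = card ?N + card ?P"
    by (simp add: card_Un_disjoint)
  moreover have "card ?N = (\<Sum>k\<in>{..<n} - U. card (Cons k ` ?S k (j # p) (insert k U)))"
    by (rule card_UN_disjoint) (use fin in auto)
  moreover have "\<dots> = (\<Sum>k\<in>{..<n} - U. tree_count n (Suc (length p)) (Suc (card U)) r)"
  proof (rule sum.cong[OF refl])
    fix k assume k: "k \<in> {..<n} - U"
    have "card (?S k (j # p) (insert k U)) = tree_count n (length (j # p)) (card (insert k U)) r"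
      by (rule Suc.IH) (use k Suc.prems in auto)
    then show "card (Cons k ` ?S k (j # p) (insert k U)) = tree_count n (Suc (length p)) (Suc (card U)) r"
      using k finU by (simp add: card_image)
  qed
  moreover have "\<dots> = (n - card U) * tree_count n (Suc (length p)) (Suc (card U)) r"
    using Suc.prems(1) finU by (simp add: card_Diff_subset)
  moreover have "card ?P = (if length p = 0 then 0 else tree_count n (length p - 1) (card U) r)"
  proof (cases p)
    case (Cons b q)
    have "card (?S b q U) = tree_count n (length q) (card U) r"
      by (rule Suc.IH) (use Cons Suc.prems in auto)
    then show ?thesis using Cons by (simp add: card_image)
  qed simp
  ultimately show ?case by simp
qed

text \<open>The number of Dyck path completions of length \<open>r\<close> from height \<open>d\<close> down to height \<open>0\<close>.\<close>

fun dyck_count :: "nat \<Rightarrow> nat \<Rightarrow> nat" where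
  "dyck_count d 0 = (if d = 0 then 1 else 0)"
| "dyck_count d (Suc r) = dyck_count (Suc d) r + (if d = 0 then 0 else dyck_count (d - 1) r)"

text \<open>The exponent is the number of steps to new vertices among \<open>r\<close> steps that
  lead from depth \<open>d\<close> to the root. Each offers about \<open>n\<close> choices, and what
  remains is the shape, a Dyck path.\<close>

lemma tree_count_limit:
  "(\<lambda>n. real (tree_count n d u r) / real n powr ((real r - real d) / 2)) \<longlonglongrightarrow> real (dyck_count d r)"
proof (induction r arbitrary: d u)
  case 0
  show ?case
  proof (cases "d = 0")
    case True
    show ?thesis
      by (rule Lim_transform_eventually[OF tendsto_const])
         (use True in \<open>auto intro!: eventually_sequentiallyI[of 1]\<close>)
  qed simp
next
  case (Suc r)
  let ?up = "\<lambda>n. real (tree_count n (Suc d) (Suc u) r) / real n powr ((real r - real (Suc d)) / 2)"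
  let ?dn = "\<lambda>n. if d = 0 then 0 else real (tree_count n (d - 1) u r) / real n powr ((real r - real (d - 1)) / 2)"
  have inv: "(\<lambda>n. 1 - real u / real n) \<longlonglongrightarrow> 1 - 0"
    by (intro tendsto_intros lim_const_over_n)
  have up: "(\<lambda>n. (1 - real u / real n) * ?up n) \<longlonglongrightarrow> (1 - 0) * real (dyck_count (Suc d) r)"
    by (intro tendsto_mult[OF inv] Suc.IH)
  have dn: "?dn \<longlonglongrightarrow> (if d = 0 then 0 else real (dyck_count (d - 1) r))"
    using Suc.IH[of "d - 1" u] by (cases "d = 0") auto
  have "(\<lambda>n. (1 - real u / real n) * ?up n + ?dn n) \<longlonglongrightarrow> real (dyck_count d (Suc r))"
  proof -
    have "(1 - 0) * real (dyck_count (Suc d) r) + (if d = 0 then 0 else real (dyck_count (d - 1) r))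
        = real (dyck_count d (Suc r))"
      by simp
    then show ?thesis
      using tendsto_add[OF up dn] by (simp only:)
  qed
  then show ?case
  proof (rule Lim_transform_eventually, intro eventually_sequentiallyI[of "Suc u"])
    fix n assume n: "Suc u \<le> n"
    have e1: "real n powr ((real (Suc r) - real d) / 2) = real n powr ((real r - real (Suc d)) / 2) * real n"
    proof -
      have "(real (Suc r) - real d) / 2 = (real r - real (Suc d)) / 2 + 1" by (simp add: field_simps)
      then show ?thesis using n by (simp only: powr_add) simp
    qed
    have "(1 - real u / real n) * ?up n
        = real ((n - u) * tree_count n (Suc d) (Suc u) r) / real n powr ((real (Suc r) - real d) / 2)"
      unfolding e1 using n by (simp add: of_nat_diff field_simps)
    moreover have "?dn n = real (if d = 0 then 0 else tree_count n (d - 1) u r) / real n powr ((real (Suc r) - real d) / 2)"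
      by (simp add: of_nat_diff algebra_simps)
    ultimately show "(1 - real u / real n) * ?up n + ?dn n
        = real (tree_count n d u (Suc r)) / real n powr ((real (Suc r) - real d) / 2)"
      by (simp add: add_divide_distrib)
  qed
qed

definition closed_walks :: "nat \<Rightarrow> nat \<Rightarrow> (nat \<times> nat list) set" where
  "closed_walks l n = {(j, xs). j < n \<and> length xs = l \<and> set xs \<subseteq> {..<n} \<and> last (j # xs) = j}"

lemma finite_closed_walks: "finite (closed_walks l n)"
  by (rule finite_subset[OF _ finite_cartesian_product[OF finite_lessThan[of n] finite_lists_in[of l n]]])
     (auto simp: closed_walks_def)

lemma card_few_vertices:
  assumes "1 \<le> n" and sub: "S \<subseteq> {s \<in> closed_walks l n. 2 * card (set (fst s # snd s)) \<le> l + 1}"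
  shows "real (card S) \<le> real (((l + 1) div 2) ^ (l + 1)) * real n ^ ((l + 1) div 2)"
proof -
  let ?b = "(l + 1) div 2"
  have "card S = card ((\<lambda>(j, xs). j # xs) ` S)"
    by (rule card_image[symmetric]) (auto simp: inj_on_def)
  also have "\<dots> \<le> card {ys. length ys = l + 1 \<and> set ys \<subseteq> {..<n} \<and> card (set ys) \<le> ?b}"
    by (rule card_mono[OF finite_subset[OF _ finite_lists_in[of "l + 1" n]]])
       (auto simp: closed_walks_def dest!: subsetD[OF sub])
  also have "\<dots> \<le> n ^ ?b * ?b ^ (l + 1)"
    by (rule card_lists_few_values) fact
  finally show ?thesis
    by (simp flip: of_nat_power of_nat_mult add: mult.commute)
qed

text \<open>Walks made of pairs without being tree walks, and walks without single edges that are
  not made of pairs, both have at most \<open>(l + 1) div 2\<close> vertices. There are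
  \<open>O(n ^ ((l + 1) div 2))\<close> of them, of lower order than
  \<open>n powr (1 + l / 2)\<close>, so the tree walks decide both limits.\<close>

lemma closed_walks_limits:
  defines "pairs \<equiv> \<lambda>j xs. \<forall>e\<in>set (trail j xs). count_list (trail j xs) e = 2"
  shows "(\<lambda>n. card {(j, xs) \<in> closed_walks l n. pairs j xs} / real n powr (1 + l / 2)) \<longlonglongrightarrow> real (dyck_count 0 l)"
    and "(\<lambda>n. card {(j, xs) \<in> closed_walks l n. (\<forall>e. count_list (trail j xs) e \<noteq> 1) \<and> \<not> pairs j xs}
      / real n powr (1 + l / 2)) \<longlonglongrightarrow> 0"
proof -
  define T where "T n = {(j, xs) \<in> closed_walks l n. tree_walk j [] {j} xs}" for n
  define P where "P n = {(j, xs) \<in> closed_walks l n. pairs j xs}" for n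
  define R where "R n = {(j, xs) \<in> closed_walks l n. (\<forall>e. count_list (trail j xs) e \<noteq> 1) \<and> \<not> pairs j xs}" for n
  let ?h = "\<lambda>n :: nat. real n powr (1 + l / 2)"
  have TP: "pairs j xs" if "tree_walk j [] {j} xs" for j xs
    unfolding pairs_def
  proof
    fix e assume "e \<in> set (trail j xs)"
    then have "count_list (trail j xs) e \<noteq> 0" by (simp add: count_list_0_iff)
    then show "count_list (trail j xs) e = 2"
      using tree_walk_count[OF that, of e] by (auto split: if_splits)
  qed
  have pairs1: "count_list (trail j xs) e \<noteq> 1" if "pairs j xs" for j xs e
    using that by (cases "e \<in> set (trail j xs)") (auto simp: pairs_def count_notin)
  have "(j, xs) \<in> closed_walks l n \<longleftrightarrow> j < n \<and> length xs = l \<and> set xs \<subseteq> {..<n}" if "tree_walk j [] {j} xs" for j xs n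
    using tree_walk_last[OF that] by (auto simp: closed_walks_def)
  then have "T n = (SIGMA j:{..<n}. {xs. length xs = l \<and> set xs \<subseteq> {..<n} \<and> tree_walk j [] {j} xs})" for n
    unfolding T_def by blast
  moreover have "finite {xs. length xs = l \<and> set xs \<subseteq> {..<n} \<and> tree_walk j [] {j} xs}" for j n
    by (rule finite_subset[OF _ finite_lists_in[of l n]]) auto
  ultimately have cT: "card (T n) = n * tree_count n 0 1 l" for n
    by (simp add: card_tree_walks)
  let ?F = "\<lambda>n. real (((l + 1) div 2) ^ (l + 1)) * real n ^ ((l + 1) div 2) / ?h n"
  have F: "?F \<longlonglongrightarrow> 0"
    by (rule LIMSEQ_power_over_powr) linarith
  have few: "real (card S) / ?h n \<le> ?F n" if "1 \<le> n"
    "S \<subseteq> {s \<in> closed_walks l n. 2 * card (set (fst s # snd s)) \<le> l + 1}" for S n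
    by (intro divide_right_mono card_few_vertices[OF that]) simp
  have T: "(\<lambda>n. card (T n) / ?h n) \<longlonglongrightarrow> real (dyck_count 0 l)"
    by (rule Lim_transform_eventually[OF tree_count_limit[of 0 1 l]])
       (auto intro!: eventually_sequentiallyI[of 1] simp: cT powr_add)
  have finP: "finite (P n)" "finite (T n)" for n
    by (auto simp: P_def T_def intro: finite_subset[OF _ finite_closed_walks[of l n]])
  have T_sub: "T n \<subseteq> P n" for n
    using TP by (auto simp: T_def P_def)
  have fewP: "P n - T n \<subseteq> {s \<in> closed_walks l n. 2 * card (set (fst s # snd s)) \<le> l + 1}" for n
    using tree_walk_or_few_vertices pairs1 by (fastforce simp: P_def T_def closed_walks_def)
  have fewR: "R n \<subseteq> {s \<in> closed_walks l n. 2 * card (set (fst s # snd s)) \<le> l + 1}" for n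
    using tree_walk_or_few_vertices TP by (fastforce simp: R_def closed_walks_def)
  have PT: "(\<lambda>n. card (P n - T n) / ?h n) \<longlonglongrightarrow> 0"
    by (rule Lim_null_comparison[OF _ F]) (use few fewP in \<open>auto intro!: eventually_sequentiallyI[of 1]\<close>)
  have "card (P n) = card (T n) + card (P n - T n)" for n
    using T_sub finP by (simp add: card_Diff_subset card_mono)
  then show "(\<lambda>n. card (P n) / ?h n) \<longlonglongrightarrow> real (dyck_count 0 l)"
    using tendsto_add[OF T PT] by (simp add: add_divide_distrib)
  show "(\<lambda>n. card (R n) / ?h n) \<longlonglongrightarrow> 0"
    by (rule Lim_null_comparison[OF _ F]) (use few fewR in \<open>auto intro!: eventually_sequentiallyI[of 1]\<close>)
qed

section \<open>Counting closed walks on the cycle\<close>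

text \<open>The value of \<open>link1\<close> when the indices differ by \<open>d\<close> modulo
  \<open>n\<close>. The matrix is a symmetric circulant, and \<open>d\<close> and
  \<open>n - d\<close> share an input variable.\<close>

definition cycle_dist :: "nat \<Rightarrow> nat \<Rightarrow> nat" where
  "cycle_dist n d = min d (n - d)"

lemma cycle_dist_eq_iff:
  assumes "x < n" "y < n"
  shows "cycle_dist n x = cycle_dist n y \<longleftrightarrow> y = x \<or> y = (n - x) mod n"
proof (cases "x = 0")
  case True
  then show ?thesis using assms by (auto simp: cycle_dist_def min_def)
next
  case False
  then have "(n - x) mod n = n - x" using assms by simp
  then show ?thesis using assms False by (auto simp: cycle_dist_def min_def)
qed

abbreviation steps :: "nat \<Rightarrow> nat \<Rightarrow> nat list set" where
  "steps l n \<equiv> {ds. length ds = l \<and> set ds \<subseteq> {..<n}}"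

text \<open>The number of perfect matchings of the positions that pair equal letters.\<close>

function matchings :: "nat list \<Rightarrow> nat" where
  "matchings [] = 1"
| "matchings (c # cs) = (\<Sum>i<length cs. if cs ! i = c then matchings (take i cs @ drop (Suc i) cs) else 0)"
  by pat_completeness auto
termination
  by (relation "inv_image less_than length") auto

lemma count_list_remove_nth:
  assumes "i < length cs"
  shows "count_list cs d = count_list (take i cs @ drop (Suc i) cs) d + (if d = cs ! i then 1 else 0)"
proof -
  have "count_list cs d = count_list (take i cs @ cs ! i # drop (Suc i) cs) d"
    using assms by (simp add: id_take_nth_drop[symmetric])
  then show ?thesis
    by (simp add: count_list_append)
qed

lemma matchings_even:
  "matchings cs \<noteq> 0 \<Longrightarrow> even (count_list cs d)"
proof (induction cs arbitrary: d rule: matchings.induct)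
  case (2 c cs)
  then obtain i where i: "i < length cs" "cs ! i = c" "matchings (take i cs @ drop (Suc i) cs) \<noteq> 0"
    by (auto split: if_splits)
  have "even (count_list (take i cs @ drop (Suc i) cs) d)"
    by (rule "2.IH") (use i in auto)
  then show ?case
    using count_list_remove_nth[OF i(1), of d] i(2) by auto
qed simp

lemma matchings_le_fact: "matchings cs \<le> fact (length cs)"
proof (induction cs rule: matchings.induct)
  case (2 c cs)
  have "matchings (c # cs) \<le> (\<Sum>i<length cs. fact (length cs - 1))"
    unfolding matchings.simps
  proof (rule sum_mono)
    fix i assume "i \<in> {..<length cs}"
    then have i: "i < length cs" by simp
    then have "length (take i cs @ drop (Suc i) cs) = length cs - 1" by auto
    then show "(if cs ! i = c then matchings (take i cs @ drop (Suc i) cs) else 0) \<le> fact (length cs - 1)"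
      using "2.IH"[of i] i by auto
  qed
  also have "\<dots> = length cs * fact (length cs - 1)" by simp
  also have "\<dots> \<le> fact (length (c # cs))"
    by (cases "length cs") auto
  finally show ?case .
qed simp

text \<open>The partner of the first letter is forced, and removing the pair keeps the property. So
  the weight \<open>matchings\<close> counts exactly once each word that consists of pairs, while it
  satisfies a recursion that direct counting lacks.\<close>

lemma matchings_pairs:
  assumes "\<forall>c\<in>set cs. count_list cs c = 2"
  shows "matchings cs = 1"
  using assms
proof (induction cs rule: matchings.induct)
  case (2 c cs)
  have "count_list cs c = 1" using "2.prems" by auto
  then have "card {i. i < length cs \<and> cs ! i = c} = 1"
    by (simp add: count_list_eq_length_filter length_filter_conv_card eq_commute)
  then obtain i0 where i0: "{i. i < length cs \<and> cs ! i = c} = {i0}"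
    by (rule card_1_singletonE)
  then have i: "i0 < length cs" "cs ! i0 = c" by auto
  have "matchings (c # cs) = (\<Sum>i\<in>{i. i < length cs \<and> cs ! i = c}. matchings (take i cs @ drop (Suc i) cs))"
    unfolding matchings.simps
    by (rule sum.mono_neutral_cong_right) auto
  also have "\<dots> = matchings (take i0 cs @ drop (Suc i0) cs)"
    unfolding i0 by simp
  also have "\<dots> = 1"
  proof (rule "2.IH")
    show "\<forall>d\<in>set (take i0 cs @ drop (Suc i0) cs). count_list (take i0 cs @ drop (Suc i0) cs) d = 2"
    proof
      fix d assume d: "d \<in> set (take i0 cs @ drop (Suc i0) cs)"
      then have pos: "count_list (take i0 cs @ drop (Suc i0) cs) d \<noteq> 0"
        by (simp add: count_list_0_iff)
      have dc: "d \<in> set cs" using d by (auto dest: in_set_takeD in_set_dropD)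
      show "count_list (take i0 cs @ drop (Suc i0) cs) d = 2"
      proof (cases "d = c")
        case True
        then show ?thesis
          using count_list_remove_nth[OF i(1), of d] i(2) \<open>count_list cs c = 1\<close> pos by simp
      next
        case False
        then show ?thesis
          using count_list_remove_nth[OF i(1), of d] i(2) "2.prems" dc by (auto split: if_splits)
      qed
    qed
  qed (use i in auto)
  finally show ?case .
qed simp

section \<open>Weighted sums over words of displacements\<close>

lemma sum_lists_Suc:
  "(\<Sum>ds\<in>steps (Suc l) n. f ds) = (\<Sum>x<n. \<Sum>es\<in>steps l n. f (x # es))"
  unfolding sum.cartesian_product
  by (rule sum.reindex_bij_witness[where i = "\<lambda>(x, es). x # es" and j = "\<lambda>ds. (hd ds, tl ds)"])
     (auto simp: length_Suc_conv)

lemma sum_lists_insert: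
  assumes "i \<le> l"
  shows "(\<Sum>ds\<in>steps (Suc l) n. f (ds ! i) (take i ds @ drop (Suc i) ds)) = (\<Sum>y<n. \<Sum>es\<in>steps l n. f y es)"
  unfolding sum.cartesian_product
proof (rule sum.reindex_bij_witness[where i = "\<lambda>(y, es). take i es @ y # drop i es"
      and j = "\<lambda>ds. (ds ! i, take i ds @ drop (Suc i) ds)"])
  fix ds assume ds: "ds \<in> steps (Suc l) n"
  then have il: "i < length ds" using assms by auto
  show "(case (ds ! i, take i ds @ drop (Suc i) ds) of (y, es) \<Rightarrow> take i es @ y # drop i es) = ds"
    using il by (simp add: min_def id_take_nth_drop[symmetric])
  have "ds ! i < n"
    using ds nth_mem[OF il] by (auto simp del: nth_mem)
  then show "(ds ! i, take i ds @ drop (Suc i) ds) \<in> {..<n} \<times> steps l n"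
    using ds il set_take_subset[of i ds] set_drop_subset[of "Suc i" ds] by auto
next
  fix b assume b: "b \<in> {..<n} \<times> steps l n"
  obtain y es where yes: "b = (y, es)" by (cases b)
  have il: "i \<le> length es" using b assms yes by auto
  have id: "take i es @ drop i es = es" by simp
  show "((case b of (y, es) \<Rightarrow> take i es @ y # drop i es) ! i,
         take i (case b of (y, es) \<Rightarrow> take i es @ y # drop i es) @
         drop (Suc i) (case b of (y, es) \<Rightarrow> take i es @ y # drop i es)) = b"
    using il yes by (simp add: nth_append)
  show "(case b of (y, es) \<Rightarrow> take i es @ y # drop i es) \<in> steps (Suc l) n"
    using b yes il set_take_subset[of i es] set_drop_subset[of i es] by auto
qed auto

text \<open>The test function of the total displacement lets the recursion close: removing a pair of
  letters \<open>x\<close>, \<open>y\<close> shifts its argument by \<open>x + y\<close>. The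
  indicator of 0 selects closed walks, and the constant 1 serves for crude bounds.\<close>

definition matched_sum :: "nat \<Rightarrow> nat \<Rightarrow> (nat \<Rightarrow> nat) \<Rightarrow> nat" where
  "matched_sum l n g = (\<Sum>ds\<in>steps l n. g (sum_list ds mod n) * matchings (map (cycle_dist n) ds))"

lemma matched_sum_0: "matched_sum 0 n g = g 0"
proof -
  have "steps 0 n = {[]}" by auto
  then show ?thesis by (simp add: matched_sum_def)
qed

lemma matched_sum_1: "matched_sum (Suc 0) n g = 0"
  unfolding matched_sum_def by (rule sum.neutral) (auto simp: length_Suc_conv)

text \<open>Summation over the partner position, the partner letter and the remaining word.\<close>

lemma matched_sum_Suc_Suc:
  "matched_sum (Suc (Suc l)) n g =
    Suc l * (\<Sum>x<n. \<Sum>y\<in>{y. y < n \<and> cycle_dist n y = cycle_dist n x}. matched_sum l n (\<lambda>a. g ((x + y + a) mod n)))"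
proof -
  let ?c = "cycle_dist n"
  define G where "G x y es = (if ?c y = ?c x then g ((x + y + sum_list es) mod n) * matchings (map ?c es) else 0)"
    for x y and es :: "nat list"
  have "matched_sum (Suc (Suc l)) n g
      = (\<Sum>x<n. \<Sum>ds\<in>steps (Suc l) n. g (sum_list (x # ds) mod n) * matchings (map ?c (x # ds)))"
    unfolding matched_sum_def by (rule sum_lists_Suc)
  also have "\<dots> = (\<Sum>x<n. \<Sum>ds\<in>steps (Suc l) n. \<Sum>i<Suc l. G x (ds ! i) (take i ds @ drop (Suc i) ds))"
  proof (intro sum.cong refl)
    fix x ds assume ds: "ds \<in> steps (Suc l) n"
    have "sum_list ds = ds ! i + sum_list (take i ds @ drop (Suc i) ds)" if "i < Suc l" for i
    proof -
      have "sum_list ds = sum_list (take i ds @ ds ! i # drop (Suc i) ds)"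
        using that ds by (simp add: id_take_nth_drop[symmetric])
      then show ?thesis by simp
    qed
    then have "(\<Sum>i<Suc l. G x (ds ! i) (take i ds @ drop (Suc i) ds))
        = (\<Sum>i<Suc l. g (sum_list (x # ds) mod n) * (if map ?c ds ! i = ?c x
            then matchings (take i (map ?c ds) @ drop (Suc i) (map ?c ds)) else 0))"
      using ds by (intro sum.cong refl) (auto simp: G_def take_map drop_map add.assoc)
    then show "g (sum_list (x # ds) mod n) * matchings (map ?c (x # ds))
        = (\<Sum>i<Suc l. G x (ds ! i) (take i ds @ drop (Suc i) ds))"
      using ds by (simp add: sum_distrib_left del: sum.lessThan_Suc)
  qed
  also have "\<dots> = (\<Sum>x<n. \<Sum>i<Suc l. \<Sum>ds\<in>steps (Suc l) n. G x (ds ! i) (take i ds @ drop (Suc i) ds))"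
    by (rule sum.cong[OF refl]) (rule sum.swap)
  also have "\<dots> = (\<Sum>x<n. \<Sum>i<Suc l. \<Sum>y<n. \<Sum>es\<in>steps l n. G x y es)"
    by (intro sum.cong refl sum_lists_insert) simp
  also have "\<dots> = Suc l * (\<Sum>x<n. \<Sum>y<n. \<Sum>es\<in>steps l n. G x y es)"
    by (simp add: sum_distrib_left del: mult_Suc)
  also have "(\<Sum>x<n. \<Sum>y<n. \<Sum>es\<in>steps l n. G x y es)
      = (\<Sum>x<n. \<Sum>y\<in>{y. y < n \<and> ?c y = ?c x}. matched_sum l n (\<lambda>a. g ((x + y + a) mod n)))"
  proof (rule sum.cong[OF refl])
    fix x
    show "(\<Sum>y<n. \<Sum>es\<in>steps l n. G x y es)
      = (\<Sum>y\<in>{y. y < n \<and> ?c y = ?c x}. matched_sum l n (\<lambda>a. g ((x + y + a) mod n)))"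
      by (rule sum.mono_neutral_cong_right) (auto simp: G_def matched_sum_def mod_add_right_eq)
  qed
  finally show ?thesis .
qed

lemma cycle_class:
  assumes "x < n"
  shows "{y. y < n \<and> cycle_dist n y = cycle_dist n x} = {(n - x) mod n, x}"
proof -
  have "cycle_dist n y = cycle_dist n x \<longleftrightarrow> y = x \<or> y = (n - x) mod n" if "y < n" for y
    using cycle_dist_eq_iff[OF assms that] by metis
  then show ?thesis
    using assms by auto
qed

lemma matched_sum_sum: "matched_sum l n (\<lambda>a. \<Sum>x\<in>A. g x a) = (\<Sum>x\<in>A. matched_sum l n (g x))"
  unfolding matched_sum_def sum_distrib_right by (rule sum.swap)

lemma matched_sum_mono: "(\<And>a. g a \<le> h a) \<Longrightarrow> matched_sum l n g \<le> matched_sum l n h"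
  unfolding matched_sum_def by (intro sum_mono mult_right_mono) auto

lemma matched_sum_const: "matched_sum l n (\<lambda>_. c) = c * matched_sum l n (\<lambda>_. 1)"
  by (simp add: matched_sum_def sum_distrib_left)

lemma matched_sum_cong:
  "0 < n \<Longrightarrow> (\<And>a. a < n \<Longrightarrow> g a = h a) \<Longrightarrow> matched_sum l n g = matched_sum l n h"
  unfolding matched_sum_def by (intro sum.cong refl) auto

text \<open>The doubles of two distinct solutions differ by a multiple of \<open>n\<close> that is
  less than \<open>2 * n\<close>, so the solutions are exactly \<open>n / 2\<close> apart. Three
  numbers cannot have this distance pairwise.\<close>

lemma card_double_solutions:
  fixes n a :: nat
  shows "card {x. x < n \<and> (2 * x + a) mod n = 0} \<le> 2"
proof (cases "n = 0")
  case False
  show ?thesis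
  proof (rule ccontr)
    assume "\<not> ?thesis"
    then have "3 \<le> card {x. x < n \<and> (2 * x + a) mod n = 0}" by simp
    then obtain T where T: "T \<subseteq> {x. x < n \<and> (2 * x + a) mod n = 0}" "card T = 3"
      by (rule obtain_subset_with_card_n) 
    from T(2) obtain x y z where xyz: "T = {x, y, z}" "x \<noteq> y" "y \<noteq> z" "x \<noteq> z"
      unfolding card_3_iff by blast
    have two: "x' = y' \<or> 2 * x' = 2 * y' + n \<or> 2 * y' = 2 * x' + n"
      if h: "x' < n" "y' < n" "(2 * x' + a) mod n = 0" "(2 * y' + a) mod n = 0" for x' y' :: nat
    proof -
      obtain u where u: "2 * x' + a = n * u" using h(3) by (auto simp: mod_eq_0_iff_dvd)
      obtain v where v: "2 * y' + a = n * v" using h(4) by (auto simp: mod_eq_0_iff_dvd)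
      have "u < v + 2"
      proof (rule ccontr)
        assume "\<not> u < v + 2"
        then have "n * (v + 2) \<le> n * u" by (intro mult_le_mono2) simp
        then have "2 * y' + a + 2 * n \<le> 2 * x' + a" unfolding u v by (simp add: algebra_simps)
        then show False using h(1) by linarith
      qed
      moreover have "v < u + 2"
      proof (rule ccontr)
        assume "\<not> v < u + 2"
        then have "n * (u + 2) \<le> n * v" by (intro mult_le_mono2) simp
        then have "2 * x' + a + 2 * n \<le> 2 * y' + a" unfolding u v by (simp add: algebra_simps)
        then show False using h(2) by linarith
      qed
      ultimately consider "u = v" | "u = v + 1" | "v = u + 1" by linarith
      then show ?thesis
      proof cases
        case 1
        then have "2 * x' + a = 2 * y' + a" using u v by simp
        then show ?thesis by simp
      next
        case 2
        then have "n * u = n * v + n" by simp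
        then have "2 * x' = 2 * y' + n" using u v by linarith
        then show ?thesis by simp
      next
        case 3
        then have "n * v = n * u + n" by simp
        then have "2 * y' = 2 * x' + n" using u v by linarith
        then show ?thesis by simp
      qed
    qed
    have mem: "x < n" "(2 * x + a) mod n = 0" "y < n" "(2 * y + a) mod n = 0" "z < n" "(2 * z + a) mod n = 0"
      using T(1) unfolding xyz(1) by blast+
    have "2 * x = 2 * y + n \<or> 2 * y = 2 * x + n" "2 * y = 2 * z + n \<or> 2 * z = 2 * y + n"
      "2 * x = 2 * z + n \<or> 2 * z = 2 * x + n"
      using two[of x y] two[of y z] two[of x z] mem xyz(2-4) by blast+
    then show False
      using False by linarith
  qed
qed simp

text \<open>Each pair costs a factor \<open>n\<close> for its first letter, at most 2 for the
  partner letter and the number of partner positions; the constant is generous.\<close>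

lemma matched_sum_total_bound: "matched_sum l n (\<lambda>_. 1) \<le> fact l * 2 ^ l * n ^ (l div 2)"
proof (induction l rule: nat_less_induct)
  case (1 l)
  consider "l = 0" | "l = 1" | k where "l = Suc (Suc k)"
    by (metis One_nat_def not0_implies_Suc)
  then show ?case
  proof cases
    case 3
    have "matched_sum l n (\<lambda>_. 1) = Suc k * (\<Sum>x<n. \<Sum>y\<in>{y. y < n \<and> cycle_dist n y = cycle_dist n x}. matched_sum k n (\<lambda>a. 1))"
      unfolding 3 by (rule matched_sum_Suc_Suc)
    also have "\<dots> \<le> Suc k * (\<Sum>x<n. 2 * matched_sum k n (\<lambda>a. 1))"
    proof (intro mult_le_mono2 sum_mono)
      fix x assume "x \<in> {..<n}"
      then show "(\<Sum>y\<in>{y. y < n \<and> cycle_dist n y = cycle_dist n x}. matched_sum k n (\<lambda>a. 1)) \<le> 2 * matched_sum k n (\<lambda>a. 1)"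
        using cycle_class[of x n] by (simp add: card_insert_if)
    qed
    also have "\<dots> = Suc k * 2 * n * matched_sum k n (\<lambda>a. 1)"
      by (simp add: algebra_simps)
    also have "\<dots> \<le> Suc k * 2 * n * (fact k * 2 ^ k * n ^ (k div 2))"
      using 1 3 by (intro mult_le_mono2) auto
    also have "\<dots> = (Suc k * fact k) * (2 * 2 ^ k) * (n * n ^ (k div 2))"
      by (simp only: mult_ac)
    also have "\<dots> = fact (Suc k) * 2 ^ Suc k * n ^ (l div 2)"
      by (simp add: 3)
    also have "\<dots> \<le> fact l * 2 ^ l * n ^ (l div 2)"
      by (intro mult_le_mono1 mult_le_mono fact_mono_nat power_increasing) (auto simp: 3)
    finally show ?thesis .
  qed (simp_all add: matched_sum_0 matched_sum_1)
qed

definition zero_ind :: "nat \<Rightarrow> nat" where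
  "zero_ind a = (if a = 0 then 1 else 0)"

text \<open>
  The main term comes from the partner letter \<open>- x\<close>; the partner \<open>x\<close> itself forces \<open>2 x\<close> to take a
  prescribed value modulo \<open>n\<close>.
\<close>

lemma matched_sum_recursion:
  assumes n: "0 < n"
  shows "Suc l * n * matched_sum l n zero_ind \<le> matched_sum (Suc (Suc l)) n zero_ind"
    and "matched_sum (Suc (Suc l)) n zero_ind
      \<le> Suc l * n * matched_sum l n zero_ind + Suc l * (2 * matched_sum l n (\<lambda>_. 1))"
proof -
  let ?M = "\<lambda>x y. matched_sum l n (\<lambda>a. zero_ind ((x + y + a) mod n))"
  let ?m = "\<lambda>x. (n - x) mod n"
  have opp: "?M x (?m x) = matched_sum l n zero_ind" if "x < n" for x
  proof (rule matched_sum_cong[OF n])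
    fix a assume "a < n"
    have "(x + ?m x + a) mod n = (x + (n - x) + a) mod n"
      by (metis mod_add_left_eq mod_add_right_eq)
    also have "\<dots> = a" using \<open>a < n\<close> \<open>x < n\<close> by simp
    finally show "zero_ind ((x + ?m x + a) mod n) = zero_ind a" by simp
  qed
  have rec: "matched_sum (Suc (Suc l)) n zero_ind = Suc l * (\<Sum>x<n. \<Sum>y\<in>{?m x, x}. ?M x y)"
    unfolding matched_sum_Suc_Suc by (intro arg_cong2[of _ _ _ _ "(*)"] refl sum.cong) (auto simp: cycle_class)
  have "(\<Sum>x<n. ?M x (?m x)) \<le> (\<Sum>x<n. \<Sum>y\<in>{?m x, x}. ?M x y)"
    by (rule sum_mono, rule member_le_sum) auto
  moreover have "(\<Sum>x<n. ?M x (?m x)) = n * matched_sum l n zero_ind"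
    by (simp add: opp)
  ultimately show "Suc l * n * matched_sum l n zero_ind \<le> matched_sum (Suc (Suc l)) n zero_ind"
    unfolding rec mult.assoc by (intro mult_le_mono2) simp
  have "(\<Sum>x<n. \<Sum>y\<in>{?m x, x}. ?M x y) \<le> (\<Sum>x<n. ?M x (?m x) + ?M x x)"
    by (rule sum_mono) (simp add: sum.insert_if)
  also have "\<dots> = n * matched_sum l n zero_ind + (\<Sum>x<n. ?M x x)"
    by (simp add: sum.distrib opp)
  also have "(\<Sum>x<n. ?M x x) \<le> 2 * matched_sum l n (\<lambda>_. 1)"
  proof -
    \<comment> \<open>After exchanging the sums, the remaining word fixes its total
      \<open>a\<close>, and at most two letters \<open>x\<close> solve \<open>2 * x + a = 0\<close>
      modulo \<open>n\<close>.\<close>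
    have "(\<Sum>x<n. ?M x x) = matched_sum l n (\<lambda>a. \<Sum>x<n. zero_ind ((x + x + a) mod n))"
      by (rule matched_sum_sum[symmetric])
    also have "\<dots> \<le> matched_sum l n (\<lambda>a. 2)"
    proof (rule matched_sum_mono)
      fix a
      have "(\<Sum>x<n. zero_ind ((x + x + a) mod n)) = card {x. x < n \<and> (2 * x + a) mod n = 0}"
        unfolding zero_ind_def by (subst sum.If_cases) (auto simp: mult_2 intro!: arg_cong[where f = card])
      then show "(\<Sum>x<n. zero_ind ((x + x + a) mod n)) \<le> 2"
        using card_double_solutions[of n a] by simp
    qed
    also have "\<dots> = 2 * matched_sum l n (\<lambda>_. 1)"
      by (rule matched_sum_const)
    finally show ?thesis .
  qed
  finally show "matched_sum (Suc (Suc l)) n zero_ind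
      \<le> Suc l * n * matched_sum l n zero_ind + Suc l * (2 * matched_sum l n (\<lambda>_. 1))"
    unfolding rec mult.assoc distrib_left[symmetric] by (intro mult_le_mono2) simp
qed

text \<open>The moments of the standard normal law: \<open>(l - 1)!!\<close> for even
  \<open>l\<close> and 0 for odd \<open>l\<close>.\<close>

fun gauss_moment :: "nat \<Rightarrow> nat" where
  "gauss_moment 0 = 1"
| "gauss_moment (Suc 0) = 0"
| "gauss_moment (Suc (Suc l)) = Suc l * gauss_moment l"

text \<open>The recursion for \<open>matched_sum\<close> is that of the Gaussian moments, up to an
  error of order \<open>n ^ (l div 2)\<close> against the normalisation
  \<open>n powr (l / 2 + 1)\<close>.\<close>

lemma matched_sum_limit:
  "(\<lambda>n. real (matched_sum l n zero_ind) / real n powr (l / 2)) \<longlonglongrightarrow> real (gauss_moment l)"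
proof (induction l rule: gauss_moment.induct)
  case 1
  show ?case
    by (rule Lim_transform_eventually[OF tendsto_const])
       (auto intro!: eventually_sequentiallyI[of 1] simp: matched_sum_0 zero_ind_def)
next
  case 2
  show ?case by (simp add: matched_sum_1)
next
  case (3 l)
  let ?f = "\<lambda>n. real (matched_sum l n zero_ind) / real n powr (l / 2)"
  let ?g = "\<lambda>n. real (matched_sum (Suc (Suc l)) n zero_ind) / real n powr (Suc (Suc l) / 2)"
  let ?e = "\<lambda>n. real (Suc l * (2 * (fact l * 2 ^ l))) * real n ^ (l div 2) / real n powr (Suc (Suc l) / 2)"
  have lo: "(\<lambda>n. real (Suc l) * ?f n) \<longlonglongrightarrow> real (gauss_moment (Suc (Suc l)))"
    using tendsto_mult_left[OF "3.IH", of "real (Suc l)"] by (simp only: gauss_moment.simps of_nat_mult)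
  have "?e \<longlonglongrightarrow> 0"
  proof (rule LIMSEQ_power_over_powr)
    have "2 * (l div 2) \<le> l" by simp
    then have "2 * real (l div 2) \<le> real l" by linarith
    then show "real (l div 2) < real (Suc (Suc l)) / 2" by simp
  qed
  then have hi: "(\<lambda>n. real (Suc l) * ?f n + ?e n) \<longlonglongrightarrow> real (gauss_moment (Suc (Suc l)))"
    using tendsto_add[OF lo] by fastforce
  have pw: "real n powr (Suc (Suc l) / 2) = real n * real n powr (l / 2)" if "0 < n" for n
  proof -
    have "Suc (Suc l) / 2 = 1 + l / 2" by (simp add: field_simps)
    then show ?thesis using that by (simp only: powr_add) simp
  qed
  show ?case
  proof (rule tendsto_sandwich[OF _ _ lo hi]; rule eventually_sequentiallyI[of 1])
    fix n :: nat assume "1 \<le> n"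
    then have n: "0 < n" by simp
    have "real (Suc l) * ?f n = real (Suc l * n * matched_sum l n zero_ind) / real n powr (Suc (Suc l) / 2)"
      using n unfolding pw[OF n] by (simp add: field_simps)
    moreover have "\<dots> \<le> ?g n"
      using matched_sum_recursion(1)[OF n, of l] by (intro divide_right_mono) (simp_all only: of_nat_le_iff powr_ge_zero)
    ultimately show "real (Suc l) * ?f n \<le> ?g n" by simp
    have "matched_sum (Suc (Suc l)) n zero_ind
        \<le> Suc l * n * matched_sum l n zero_ind + Suc l * (2 * (fact l * 2 ^ l)) * n ^ (l div 2)"
    proof (rule order_trans[OF matched_sum_recursion(2)[OF n, of l]])
      have "Suc l * (2 * matched_sum l n (\<lambda>_. 1)) \<le> Suc l * (2 * (fact l * 2 ^ l * n ^ (l div 2)))"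
        by (intro mult_le_mono2 matched_sum_total_bound)
      then show "Suc l * n * matched_sum l n zero_ind + Suc l * (2 * matched_sum l n (\<lambda>_. 1))
          \<le> Suc l * n * matched_sum l n zero_ind + Suc l * (2 * (fact l * 2 ^ l)) * n ^ (l div 2)"
        by (simp only: mult.assoc add_le_cancel_left)
    qed
    then have "?g n \<le> real (Suc l * n * matched_sum l n zero_ind + Suc l * (2 * (fact l * 2 ^ l)) * n ^ (l div 2))
        / real n powr (Suc (Suc l) / 2)"
      by (intro divide_right_mono) (simp_all only: of_nat_le_iff powr_ge_zero)
    also have "\<dots> = real (Suc l) * ?f n + ?e n"
      using \<open>real (Suc l) * ?f n = real (Suc l * n * matched_sum l n zero_ind) / real n powr (Suc (Suc l) / 2)\<close>
      by (simp only: of_nat_add add_divide_distrib of_nat_mult of_nat_power)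
    finally show "?g n \<le> real (Suc l) * ?f n + ?e n" .
  qed
qed

text \<open>Closed walks coded by the starting point and the successive displacements modulo
  \<open>n\<close>. In these coordinates the input indices met depend on the displacements alone,
  and the starting point is a free factor \<open>n\<close>.\<close>

definition closed_steps :: "nat \<Rightarrow> nat \<Rightarrow> (nat \<times> nat list) set" where
  "closed_steps l n = {(j, ds). j < n \<and> ds \<in> steps l n \<and> sum_list ds mod n = 0}"

lemma finite_closed_steps: "finite (closed_steps l n)"
  by (rule finite_subset[OF _ finite_cartesian_product[OF finite_lessThan[of n] finite_lists_in[of l n]]])
     (auto simp: closed_steps_def)

text \<open>A displacement is known from its class together with one bit telling on which half of
  the cycle it lies; the bits account for \<open>2 ^ l\<close>.\<close>

lemma card_steps_few_classes:
  assumes n: "1 \<le> n"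
  shows "card {ds \<in> steps l n. card (set (map (cycle_dist n) ds)) \<le> b} \<le> 2 ^ l * b ^ l * n ^ b"
proof -
  let ?A = "{cs. length cs = l \<and> set cs \<subseteq> {..<n} \<and> card (set cs) \<le> b}"
  let ?B = "{bs :: bool list. set bs \<subseteq> UNIV \<and> length bs = l}"
  let ?D = "{ds \<in> steps l n. card (set (map (cycle_dist n) ds)) \<le> b}"
  let ?f = "\<lambda>ds. (map (cycle_dist n) ds, map (\<lambda>d. d \<le> n - d) ds)"
  have "inj_on ?f ?D"
  proof (rule inj_onI)
    fix ds ds' assume h: "ds \<in> ?D" "ds' \<in> ?D" "?f ds = ?f ds'"
    show "ds = ds'"
    proof (rule nth_equalityI)
      show "length ds = length ds'" using h by simp
      fix i assume i: "i < length ds"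
      then have "ds ! i < n" "ds' ! i < n" using h by (auto simp: subset_iff)
      moreover have "cycle_dist n (ds ! i) = cycle_dist n (ds' ! i)"
        using h i by (metis (mono_tags, lifting) Pair_inject length_map nth_map)
      moreover have "(ds ! i \<le> n - ds ! i) = (ds' ! i \<le> n - ds' ! i)"
        using h i by (metis (mono_tags, lifting) Pair_inject length_map nth_map)
      ultimately show "ds ! i = ds' ! i"
        by (auto simp: cycle_dist_def min_def split: if_splits)
    qed
  qed
  then have "card ?D \<le> card (?A \<times> ?B)"
  proof (rule card_inj_on_le)
    show "?f ` ?D \<subseteq> ?A \<times> ?B"
    proof (rule image_subsetI)
      fix ds assume ds: "ds \<in> ?D"
      then have "set (map (cycle_dist n) ds) \<subseteq> {..<n}"
        by (auto simp: cycle_dist_def subset_iff min_less_iff_disj)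
      then show "?f ds \<in> ?A \<times> ?B"
        using ds by simp
    qed
    show "finite (?A \<times> ?B)"
      by (intro finite_cartesian_product finite_lists_length_eq finite_subset[OF _ finite_lists_in[of l n]]) auto
  qed
  also have "\<dots> = card ?A * 2 ^ l"
    using card_lists_length_eq[of "UNIV :: bool set" l] by (simp add: card_cartesian_product)
  also have "\<dots> \<le> (n ^ b * b ^ l) * 2 ^ l"
    by (intro mult_le_mono1 card_lists_few_values[OF n])
  finally show ?thesis by (simp add: mult_ac)
qed

lemma few_letters:
  assumes "\<And>c. count_list cs c \<noteq> 1" and "\<not> (\<forall>c\<in>set cs. count_list cs c = 2)"
  shows "2 * card (set cs) < length cs"
proof -
  have c2: "2 \<le> count_list cs c" if "c \<in> set cs" for c
    using assms(1)[of c] that count_list_0_iff[of cs c] by linarith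
  obtain d where d: "d \<in> set cs" "count_list cs d \<noteq> 2"
    using assms(2) by blast
  have "(\<Sum>c\<in>set cs. 2) < (\<Sum>c\<in>set cs. count_list cs c)"
    by (rule sum_strict_mono_ex1) (use c2 d in \<open>auto intro!: bexI[of _ d] simp: order.not_eq_order_implies_strict\<close>)
  then show ?thesis
    using sum_count_set[of cs "set cs"] by simp
qed

text \<open>\<open>matched_sum\<close> gives weight 1 to the words made of pairs. Any other word of
  nonzero weight has only even multiplicities, hence few letters, and its weight is at most
  \<open>fact l\<close>; such words are too few to affect the limit. So the asymptotics of the
  weighted sum are those of the count.\<close>

lemma closed_steps_limits:
  defines "w \<equiv> \<lambda>n. map (cycle_dist n)"
  defines "pairs \<equiv> \<lambda>n ds. \<forall>c\<in>set (w n ds). count_list (w n ds) c = 2"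
  shows "(\<lambda>n. card {(j, ds) \<in> closed_steps l n. pairs n ds} / real n powr (1 + l / 2)) \<longlonglongrightarrow> real (gauss_moment l)"
    and "(\<lambda>n. card {(j, ds) \<in> closed_steps l n. (\<forall>c. count_list (w n ds) c \<noteq> 1) \<and> \<not> pairs n ds}
      / real n powr (1 + l / 2)) \<longlonglongrightarrow> 0"
proof -
  \<comment> \<open>The strict bound \<open>2 * card < l\<close> is the same as
    \<open>card \<le> (l - 1) div 2\<close> for positive \<open>l\<close>. At \<open>l = 0\<close>
    the subtraction truncates, so \<open>Few\<close> is made empty there.\<close>
  let ?b = "(l - 1) div 2"
  define Z where "Z n = {ds \<in> steps l n. sum_list ds mod n = 0}" for n
  define Q where "Q n = {ds \<in> Z n. pairs n ds}" for n
  define Few where "Few n = {ds \<in> steps l n. l \<noteq> 0 \<and> card (set (w n ds)) \<le> ?b}" for n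
  have finZ: "finite (Z n)" "finite (Q n)" "finite (Few n)" for n
    by (auto simp: Z_def Q_def Few_def intro: finite_subset[OF _ finite_lists_in[of l n]])
  have fewI: "ds \<in> Few n" if "ds \<in> steps l n" "\<forall>c. count_list (w n ds) c \<noteq> 1" "\<not> pairs n ds" for ds n
  proof -
    have "2 * card (set (w n ds)) < l"
      using few_letters[of "w n ds"] that by (auto simp: pairs_def w_def)
    then show ?thesis using that by (auto simp: Few_def)
  qed
  have cardFew: "real (card (Few n)) \<le> real (2 ^ l * ?b ^ l) * (if l = 0 then 0 else real n ^ ?b)" if n: "1 \<le> n" for n
  proof (cases "l = 0")
    case False
    then have "Few n = {ds \<in> steps l n. card (set (map (cycle_dist n) ds)) \<le> ?b}"
      by (simp add: Few_def w_def)
    then have "card (Few n) \<le> 2 ^ l * ?b ^ l * n ^ ?b"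
      using card_steps_few_classes[OF n, of l ?b] by simp
    then have "real (card (Few n)) \<le> real (2 ^ l * ?b ^ l * n ^ ?b)"
      by (simp only: of_nat_le_iff)
    then show ?thesis using False by simp
  qed (simp add: Few_def)
  have limFew: "(\<lambda>n. c * real (card (Few n)) / real n powr (l / 2)) \<longlonglongrightarrow> 0" if c: "0 \<le> c" for c
  proof (cases "l = 0")
    case False
    then have b: "real ?b < l / 2" by linarith
    show ?thesis
    proof (rule Lim_null_comparison[OF _ LIMSEQ_power_over_powr[OF b]])
      show "\<forall>\<^sub>F n in sequentially. norm (c * real (card (Few n)) / real n powr (l / 2))
          \<le> c * real (2 ^ l * ?b ^ l) * real n ^ ?b / real n powr (l / 2)"
        using cardFew False c
        by (intro eventually_sequentiallyI[of 1]) (auto intro!: divide_right_mono mult_left_mono simp: mult.assoc)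
    qed
  qed (simp add: Few_def)
  have sum_split: "matched_sum l n zero_ind = card (Q n) + (\<Sum>ds\<in>Z n - Q n. matchings (w n ds))" for n
  proof -
    have "matched_sum l n zero_ind = (\<Sum>ds\<in>Z n. matchings (w n ds))"
      unfolding matched_sum_def w_def
      by (rule sum.mono_neutral_cong_right) (auto simp: finite_lists_in Z_def zero_ind_def)
    also have "\<dots> = (\<Sum>ds\<in>Q n. matchings (w n ds)) + (\<Sum>ds\<in>Z n - Q n. matchings (w n ds))"
      using sum.subset_diff[of "Q n" "Z n" "\<lambda>ds. matchings (w n ds)"] finZ by (simp add: Q_def add.commute)
    also have "(\<Sum>ds\<in>Q n. matchings (w n ds)) = card (Q n)"
      by (simp add: Q_def pairs_def matchings_pairs)
    finally show ?thesis .
  qed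
  have rest_le: "(\<Sum>ds\<in>Z n - Q n. matchings (w n ds)) \<le> fact l * card (Few n)" for n
  proof -
    have "(\<Sum>ds\<in>Z n - Q n. matchings (w n ds)) \<le> (\<Sum>ds\<in>Few n. fact l)"
    proof -
      have "(\<Sum>ds\<in>Z n - Q n. matchings (w n ds)) = (\<Sum>ds\<in>(Z n - Q n) \<inter> Few n. matchings (w n ds))"
      proof (rule sum.mono_neutral_right)
        show "\<forall>ds\<in>Z n - Q n - (Z n - Q n) \<inter> Few n. matchings (w n ds) = 0"
        proof (rule ballI, rule ccontr)
          fix ds assume ds: "ds \<in> Z n - Q n - (Z n - Q n) \<inter> Few n" "matchings (w n ds) \<noteq> 0"
          have "count_list (w n ds) c \<noteq> 1" for c
            using matchings_even[OF ds(2), of c] by (metis odd_one)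
          then show False
            using ds fewI[of ds n] by (auto simp: Z_def Q_def)
        qed
      qed (use finZ in auto)
      also have "\<dots> \<le> (\<Sum>ds\<in>(Z n - Q n) \<inter> Few n. fact l)"
      proof (rule sum_mono)
        fix ds assume "ds \<in> (Z n - Q n) \<inter> Few n"
        then have "length (w n ds) = l" by (auto simp: Z_def w_def)
        then show "matchings (w n ds) \<le> fact l" using matchings_le_fact[of "w n ds"] by simp
      qed
      also have "\<dots> \<le> (\<Sum>ds\<in>Few n. fact l)"
        by (rule sum_mono2) (use finZ in auto)
      finally show ?thesis .
    qed
    then show ?thesis by (simp add: mult.commute)
  qed
  have Q: "(\<lambda>n. real (card (Q n)) / real n powr (l / 2)) \<longlonglongrightarrow> real (gauss_moment l)"
  proof -
    let ?r = "\<lambda>n. real (\<Sum>ds\<in>Z n - Q n. matchings (w n ds)) / real n powr (l / 2)"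
    have "?r \<longlonglongrightarrow> 0"
    proof (rule Lim_null_comparison[OF always_eventually limFew[of "fact l"]], rule allI)
      fix n
      have "real (\<Sum>ds\<in>Z n - Q n. matchings (w n ds)) \<le> real (fact l * card (Few n))"
        using rest_le[of n] by (simp only: of_nat_le_iff)
      then have "real (\<Sum>ds\<in>Z n - Q n. matchings (w n ds)) \<le> fact l * real (card (Few n))"
        by (simp only: of_nat_mult of_nat_fact)
      then show "norm (?r n) \<le> fact l * real (card (Few n)) / real n powr (l / 2)"
        by (auto intro!: divide_right_mono simp del: of_nat_sum)
    qed simp
    from tendsto_diff[OF matched_sum_limit[of l] this] show ?thesis
      unfolding sum_split by (simp add: add_divide_distrib del: of_nat_sum)
  qed
  have "{(j, ds) \<in> closed_steps l n. pairs n ds} = {..<n} \<times> Q n" for n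
    by (auto simp: closed_steps_def Q_def Z_def)
  then have cP: "card {(j, ds) \<in> closed_steps l n. pairs n ds} = n * card (Q n)" for n
    by (simp add: card_cartesian_product)
  have pw: "real n powr (1 + l / 2) = real n * real n powr (l / 2)" if "1 \<le> n" for n
    using that by (simp add: powr_add)
  show "(\<lambda>n. card {(j, ds) \<in> closed_steps l n. pairs n ds} / real n powr (1 + l / 2)) \<longlonglongrightarrow> real (gauss_moment l)"
    by (rule Lim_transform_eventually[OF Q]) (auto intro!: eventually_sequentiallyI[of 1] simp: cP pw)
  let ?R = "\<lambda>n. {(j, ds) \<in> closed_steps l n. (\<forall>c. count_list (w n ds) c \<noteq> 1) \<and> \<not> pairs n ds}"
  show "(\<lambda>n. card (?R n) / real n powr (1 + l / 2)) \<longlonglongrightarrow> 0"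
  proof (rule Lim_null_comparison[OF _ limFew[of 1]])
    show "\<forall>\<^sub>F n in sequentially. norm (card (?R n) / real n powr (1 + l / 2)) \<le> 1 * real (card (Few n)) / real n powr (l / 2)"
    proof (rule eventually_sequentiallyI[of 1])
      fix n :: nat assume n: "1 \<le> n"
      have "?R n \<subseteq> {..<n} \<times> Few n"
        using fewI by (auto simp: closed_steps_def)
      then have "card (?R n) \<le> n * card (Few n)"
        using card_mono[of "{..<n} \<times> Few n" "?R n"] finZ by (simp add: card_cartesian_product)
      then have "real (card (?R n)) \<le> real n * real (card (Few n))"
        by (simp only: of_nat_le_iff flip: of_nat_mult)
      then have "real (card (?R n)) / real n powr (1 + l / 2) \<le> real n * real (card (Few n)) / (real n * real n powr (l / 2))"
        unfolding pw[OF n] by (intro divide_right_mono) auto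
      then show "norm (card (?R n) / real n powr (1 + l / 2)) \<le> 1 * real (card (Few n)) / real n powr (l / 2)"
        using n by simp
    qed
  qed simp
qed

section \<open>Traces of powers\<close>

text \<open>\<open>^\<^sub>m\<close> appends its new factor on the right, so the expansion of an
  entry starts at the column index and ends at the row index; hence the order of the arguments in
  \<open>b k j\<close>.\<close>

fun walk_weight :: "(nat \<Rightarrow> nat \<Rightarrow> 'b :: comm_semiring_1) \<Rightarrow> nat \<Rightarrow> nat list \<Rightarrow> 'b" where
  "walk_weight b j [] = 1"
| "walk_weight b j (k # xs) = b k j * walk_weight b k xs"

lemma pow_mat_entry:
  fixes b :: "nat \<Rightarrow> nat \<Rightarrow> 'b :: comm_semiring_1"
  assumes "i < n" "j < n"
  shows "(mat n n (\<lambda>(i, j). b i j) ^\<^sub>m l) $$ (i, j)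
    = (\<Sum>xs\<in>steps l n. if last (j # xs) = i then walk_weight b j xs else 0)"
  using assms(2)
proof (induction l arbitrary: j)
  case 0
  have "steps 0 n = {[]}" by auto
  then show ?case using assms 0 by (auto simp: one_mat_def)
next
  case (Suc l)
  let ?A = "mat n n (\<lambda>(i, j). b i j)"
  have "(?A ^\<^sub>m Suc l) $$ (i, j) = (\<Sum>k<n. (?A ^\<^sub>m l) $$ (i, k) * b k j)"
    using assms(1) Suc.prems by (simp add: scalar_prod_def atLeast0LessThan)
  also have "\<dots> = (\<Sum>k<n. \<Sum>xs\<in>steps l n. if last (j # k # xs) = i then walk_weight b j (k # xs) else 0)"
  proof (rule sum.cong[OF refl])
    fix k assume "k \<in> {..<n}"
    then have "(?A ^\<^sub>m l) $$ (i, k) * b k j = (\<Sum>xs\<in>steps l n. (if last (k # xs) = i then walk_weight b k xs else 0) * b k j)"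
      by (simp only: Suc.IH lessThan_iff sum_distrib_right)
    also have "\<dots> = (\<Sum>xs\<in>steps l n. if last (j # k # xs) = i then walk_weight b j (k # xs) else 0)"
      by (intro sum.cong refl) (simp add: mult.commute)
    finally show "(?A ^\<^sub>m l) $$ (i, k) * b k j
        = (\<Sum>xs\<in>steps l n. if last (j # k # xs) = i then walk_weight b j (k # xs) else 0)" .
  qed
  also have "\<dots> = (\<Sum>xs\<in>steps (Suc l) n. if last (j # xs) = i then walk_weight b j xs else 0)"
    by (rule sum_lists_Suc[symmetric])
  finally show ?case .
qed

lemma mat_trace_pow:
  "mat_trace (mat n n (\<lambda>(i, j). b i j) ^\<^sub>m l)
    = (\<Sum>j<n. \<Sum>xs\<in>steps l n. if last (j # xs) = j then walk_weight b j xs else 0)"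
proof -
  have "dim_row (mat n n (\<lambda>(i, j). b i j) ^\<^sub>m l) = n"
    by (cases l) auto
  then show ?thesis
    unfolding mat_trace_def by (simp add: pow_mat_entry)
qed

lemma walk_weight_trail: "walk_weight (\<lambda>i j. s (uedge i j)) j xs = prod_list (map s (trail j xs))"
  by (induction xs arbitrary: j) auto

lemma mat_trace_pow_link2:
  "mat_trace (mat n n (\<lambda>(i, j). complex_of_real (s (link2 n (Suc i) (Suc j)))) ^\<^sub>m l)
    = complex_of_real (\<Sum>(j, xs)\<in>closed_walks l n. prod_list (map s (trail j xs)))"
proof -
  have of_real_weight: "walk_weight (\<lambda>i j. complex_of_real (b i j)) j xs = complex_of_real (walk_weight b j xs)" for b j xs
    by (induction xs arbitrary: j) auto
  have "mat_trace (mat n n (\<lambda>(i, j). complex_of_real (s (link2 n (Suc i) (Suc j)))) ^\<^sub>m l)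
      = (\<Sum>j<n. \<Sum>xs\<in>steps l n. complex_of_real (if last (j # xs) = j then prod_list (map s (trail j xs)) else 0))"
    unfolding mat_trace_pow link2_def uedge_def[symmetric] of_real_weight walk_weight_trail
    by (intro sum.cong refl) simp
  also have "\<dots> = complex_of_real (\<Sum>(j, xs)\<in>{..<n} \<times> steps l n. if last (j # xs) = j then prod_list (map s (trail j xs)) else 0)"
    by (simp add: sum.cartesian_product[symmetric])
  also have "(\<Sum>(j, xs)\<in>{..<n} \<times> steps l n. if last (j # xs) = j then prod_list (map s (trail j xs)) else 0)
      = (\<Sum>(j, xs)\<in>closed_walks l n. prod_list (map s (trail j xs)))"
    by (rule sum.mono_neutral_cong_right) (auto simp: closed_walks_def finite_lists_in split: if_splits)
  finally show ?thesis .
qed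

text \<open>For fixed \<open>j\<close> the map from \<open>d\<close> to \<open>(j + d) mod n\<close>
  permutes the vertices. Substituting it step by step turns entries that depend on the difference
  only into factors indexed by the displacements.\<close>

lemma sum_walks_eq_sum_steps:
  assumes b: "\<And>j d. j < n \<Longrightarrow> d < n \<Longrightarrow> b ((j + d) mod n) j = s (cycle_dist n d)"
    and "i < n" "j < n"
  shows "(\<Sum>xs\<in>steps l n. if last (j # xs) = i then walk_weight b j xs else 0)
    = (\<Sum>ds\<in>steps l n. if (j + sum_list ds) mod n = i then prod_list (map s (map (cycle_dist n) ds)) else 0)"
  using assms(3)
proof (induction l arbitrary: j)
  case 0
  have steps_0: "steps 0 n = {[]}" by auto
  show ?case unfolding steps_0 using 0 by simp
next
  case (Suc l)
  let ?r = "\<lambda>k. \<Sum>ds\<in>steps l n. if (k + sum_list ds) mod n = i then prod_list (map s (map (cycle_dist n) ds)) else 0"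
  have bij: "bij_betw (\<lambda>d. (j + d) mod n) {..<n} {..<n}"
  proof (rule bij_betw_byWitness[where f' = "\<lambda>k. (k + (n - j)) mod n"])
    show "\<forall>d\<in>{..<n}. ((j + d) mod n + (n - j)) mod n = d"
    proof
      fix d assume "d \<in> {..<n}"
      then have "((j + d) mod n + (n - j)) mod n = (j + d + (n - j)) mod n"
        by (simp add: mod_add_left_eq)
      also have "\<dots> = d"
        using Suc.prems \<open>d \<in> {..<n}\<close> by simp
      finally show "((j + d) mod n + (n - j)) mod n = d" .
    qed
    show "\<forall>k\<in>{..<n}. (j + (k + (n - j)) mod n) mod n = k"
    proof
      fix k assume "k \<in> {..<n}"
      then have "(j + (k + (n - j)) mod n) mod n = (j + (k + (n - j))) mod n"
        by (simp add: mod_add_right_eq)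
      also have "\<dots> = k"
        using Suc.prems \<open>k \<in> {..<n}\<close> by simp
      finally show "(j + (k + (n - j)) mod n) mod n = k" .
    qed
  qed (use Suc.prems in auto)
  have "(\<Sum>xs\<in>steps (Suc l) n. if last (j # xs) = i then walk_weight b j xs else 0)
      = (\<Sum>k<n. \<Sum>xs\<in>steps l n. if last (j # k # xs) = i then walk_weight b j (k # xs) else 0)"
    by (rule sum_lists_Suc)
  also have "\<dots> = (\<Sum>k<n. b k j * (\<Sum>xs\<in>steps l n. if last (k # xs) = i then walk_weight b k xs else 0))"
    unfolding sum_distrib_left by (intro sum.cong refl) simp
  also have "\<dots> = (\<Sum>k<n. b k j * ?r k)"
    by (rule sum.cong[OF refl]) (simp only: Suc.IH lessThan_iff)
  also have "\<dots> = (\<Sum>d<n. b ((j + d) mod n) j * ?r ((j + d) mod n))"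
    by (rule sum.reindex_bij_betw[OF bij, symmetric])
  also have "\<dots> = (\<Sum>d<n. s (cycle_dist n d) *
      (\<Sum>ds\<in>steps l n. if (j + (d + sum_list ds)) mod n = i then prod_list (map s (map (cycle_dist n) ds)) else 0))"
    by (rule sum.cong[OF refl]) (simp only: b[OF Suc.prems] lessThan_iff mod_add_left_eq add.assoc)
  also have "\<dots> = (\<Sum>d<n. \<Sum>ds\<in>steps l n. if (j + sum_list (d # ds)) mod n = i
      then prod_list (map s (map (cycle_dist n) (d # ds))) else 0)"
    unfolding sum_distrib_left by (intro sum.cong refl) simp
  also have "\<dots> = (\<Sum>ds\<in>steps (Suc l) n. if (j + sum_list ds) mod n = i then prod_list (map s (map (cycle_dist n) ds)) else 0)"
    by (rule sum_lists_Suc[symmetric])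
  finally show ?case .
qed

lemma link1_eq_cycle_dist:
  assumes "j < n" "d < n"
  shows "link1 n (Suc ((j + d) mod n)) (Suc j) = cycle_dist n d"
proof -
  have eq: "\<bar>real (Suc ((j + d) mod n)) - real (Suc j)\<bar> = real (if j + d < n then d else n - d)"
  proof (cases "j + d < n")
    case False
    then have "(j + d) mod n = (j + d - n) mod n"
      by (intro le_mod_geq) simp
    also have "\<dots> = j + d - n"
      using assms by simp
    finally have "(j + d) mod n = j + d - n" .
    then show ?thesis using False assms by (simp add: of_nat_diff)
  qed simp
  have "real n / 2 - \<bar>real n / 2 - real (if j + d < n then d else n - d)\<bar> = real (cycle_dist n d)"
    using assms by (auto simp: cycle_dist_def min_def of_nat_diff abs_if field_simps)
  then show ?thesis
    unfolding link1_def eq by simp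
qed

lemma mat_trace_pow_link1:
  "mat_trace (mat n n (\<lambda>(i, j). complex_of_real (s (link1 n (Suc i) (Suc j)))) ^\<^sub>m l)
    = complex_of_real (\<Sum>(j, ds)\<in>closed_steps l n. prod_list (map s (map (cycle_dist n) ds)))"
proof -
  let ?b = "\<lambda>i j. complex_of_real (s (link1 n (Suc i) (Suc j)))"
  let ?s = "\<lambda>c. complex_of_real (s c)"
  have prod: "prod_list (map ?s cs) = complex_of_real (prod_list (map s cs))" for cs
    by (induction cs) auto
  have zero: "(j + a) mod n = j \<longleftrightarrow> a mod n = 0" if "j < n" for j a :: nat
  proof -
    have "(j + m) mod n = j \<longleftrightarrow> m = 0" if "m < n" for m
    proof (cases "j + m < n")
      case False
      then have "(j + m) mod n = (j + m - n) mod n"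
        by (intro le_mod_geq) simp
      also have "\<dots> = j + m - n"
        using \<open>j < n\<close> that by simp
      finally show ?thesis
        using False that \<open>j < n\<close> by simp
    qed simp
    from this[of "a mod n"] show ?thesis
      using that by (simp add: mod_add_right_eq)
  qed
  have "mat_trace (mat n n (\<lambda>(i, j). ?b i j) ^\<^sub>m l)
      = (\<Sum>j<n. \<Sum>ds\<in>steps l n. if (j + sum_list ds) mod n = j then prod_list (map ?s (map (cycle_dist n) ds)) else 0)"
    unfolding mat_trace_pow
    by (rule sum.cong[OF refl], rule sum_walks_eq_sum_steps) (auto simp: link1_eq_cycle_dist)
  also have "\<dots> = (\<Sum>j<n. \<Sum>ds\<in>steps l n. complex_of_real (if sum_list ds mod n = 0 then prod_list (map s (map (cycle_dist n) ds)) else 0))"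
    by (intro sum.cong refl) (auto simp: zero prod simp del: map_map)
  also have "\<dots> = complex_of_real (\<Sum>(j, ds)\<in>{..<n} \<times> steps l n. if sum_list ds mod n = 0 then prod_list (map s (map (cycle_dist n) ds)) else 0)"
    by (simp add: sum.cartesian_product[symmetric])
  also have "(\<Sum>(j, ds)\<in>{..<n} \<times> steps l n. if sum_list ds mod n = 0 then prod_list (map s (map (cycle_dist n) ds)) else 0)
      = (\<Sum>(j, ds)\<in>closed_steps l n. prod_list (map s (map (cycle_dist n) ds)))"
    by (rule sum.mono_neutral_cong_right) (auto simp: closed_steps_def finite_lists_in split: if_splits)
  finally show ?thesis .
qed

lemma normalized_link_matrix_eq:
  "normalized_link_matrix \<alpha> link X N n t \<omega> = mat n n (\<lambda>(i, j). complex_of_real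
    (real n powr (- 1 / 2) * real n powr (- \<alpha> / 2) * (\<Sum>k=1..N (real n * t) \<omega>. X (link n (Suc i) (Suc j)) k \<omega>)))"
  by (rule eq_matI) (auto simp: normalized_link_matrix_def link_matrix_def stopped_walk_def)

context stopped_walks
begin

lemma integrable_stopped_walk_power: "integrable M (\<lambda>\<omega>. walk c (K \<omega>) \<omega> ^ q)"
  using integrable_stopped_word[of "replicate q c"] by (simp add: word_def)

lemma normalized_link_matrix_in_algebra:
  assumes K: "K = N (real n * t)"
  shows "normalized_link_matrix \<alpha> link X N n t \<in> random_matrix_algebra M n"
proof -
  have "(\<lambda>\<omega>. complex_of_real (a * walk c (K \<omega>) \<omega>)) \<in> Lp_intersection M" for a c
    unfolding Lp_intersection_def
  proof (intro CollectI conjI allI impI)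
    have [measurable]: "(\<lambda>\<omega>. walk c (K \<omega>) \<omega>) \<in> borel_measurable M"
      using borel_measurable_integrable[OF integrable_stopped_walk_power[of c 1]] by simp
    show "(\<lambda>\<omega>. complex_of_real (a * walk c (K \<omega>) \<omega>)) \<in> borel_measurable M"
      by measurable
    fix p :: real assume p: "1 \<le> p"
    \<comment> \<open>\<open>2 * q\<close> is an even integer at least \<open>p\<close>, so the
      absolute moment of order \<open>p\<close> is dominated by an ordinary moment.\<close>
    define q where "q = nat \<lceil>p\<rceil>"
    have le: "\<bar>x\<bar> powr p \<le> 1 + x ^ (2 * q)" for x :: real
    proof (cases "\<bar>x\<bar> \<le> 1")
      case True
      then have "\<bar>x\<bar> powr p \<le> 1" using p by (intro powr_le1) auto
      then show ?thesis by (intro add_increasing2) auto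
    next
      case False
      have "\<bar>x\<bar> powr p \<le> \<bar>x\<bar> powr real (2 * q)"
      proof (rule powr_mono)
        have "p \<le> real q" unfolding q_def by (rule real_nat_ceiling_ge)
        then show "p \<le> real (2 * q)" by simp
      qed (use False in simp)
      also have "\<dots> = x ^ (2 * q)"
        using False by (subst powr_realpow) (auto simp: power_even_abs)
      finally show ?thesis by simp
    qed
    show "integrable M (\<lambda>\<omega>. norm (complex_of_real (a * walk c (K \<omega>) \<omega>)) powr p)"
    proof (rule Bochner_Integration.integrable_bound)
      show "integrable M (\<lambda>\<omega>. 1 + (a * walk c (K \<omega>) \<omega>) ^ (2 * q))"
        unfolding power_mult_distrib
        by (intro Bochner_Integration.integrable_add integrable_mult_right integrable_stopped_walk_power) simp
      show "AE \<omega> in M. norm (norm (complex_of_real (a * walk c (K \<omega>) \<omega>)) powr p)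
          \<le> norm (1 + (a * walk c (K \<omega>) \<omega>) ^ (2 * q))"
        using le by (intro AE_I2) (simp del: of_real_mult add: norm_of_real)
    qed measurable
  qed
  from this[of "real n powr (- 1 / 2) * real n powr (- \<alpha> / 2)"] show ?thesis
    unfolding random_matrix_algebra_def normalized_link_matrix_eq[abs_def] K walk_def by simp
qed

text \<open>The link enters only through the deterministic expansion \<open>tr\<close>, used at each
  sample point with the scaled walks as entries. Of the denominator
  \<open>n powr (1 + l / 2)\<close>, one factor \<open>n\<close> comes from \<open>tau_n\<close> and
  the rest from the scaling of the matrix by \<open>n powr (- 1 / 2)\<close>.\<close>

lemma tau_n_power:
  assumes K: "K = N (real n * t)" and n: "0 < n" and len: "\<And>x. x \<in> \<Omega> \<Longrightarrow> length (w x) = l"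
    and tr: "\<And>s. mat_trace (mat n n (\<lambda>(i, j). complex_of_real (s (link n (Suc i) (Suc j)))) ^\<^sub>m l)
      = complex_of_real (\<Sum>x\<in>\<Omega>. prod_list (map s (w x)))"
  shows "tau_n M n (\<lambda>\<omega>. normalized_link_matrix \<alpha> link X N n t \<omega> ^\<^sub>m l)
    = complex_of_real ((\<Sum>x\<in>\<Omega>. expectation (\<lambda>\<omega>. word (w x) (K \<omega>) \<omega>)) * real n powr (- \<alpha> * l / 2) / real n powr (1 + l / 2))"
proof -
  define c where "c = real n powr (- 1 / 2) * real n powr (- \<alpha> / 2)"
  have "c ^ l / real n = real n powr (- \<alpha> * l / 2) / real n powr (1 + l / 2)"
  proof -
    have pow: "(real n powr e) ^ l / real n = real n powr (e * l - 1)" for e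
      using n by (simp add: powr_diff powr_powr flip: powr_realpow)
    have "c = real n powr (- 1 / 2 - \<alpha> / 2)"
      using n by (simp add: c_def flip: powr_add)
    then have "c ^ l / real n = real n powr ((- 1 / 2 - \<alpha> / 2) * l - 1)"
      by (simp only: pow)
    also have "(- 1 / 2 - \<alpha> / 2) * l - 1 = - \<alpha> * l / 2 - (1 + l / 2)"
      by (simp add: field_simps)
    finally show ?thesis
      by (simp only: powr_diff)
  qed
  then have c: "c ^ l * a / real n = a * real n powr (- \<alpha> * l / 2) / real n powr (1 + l / 2)" for a
    by (metis mult.commute times_divide_eq_right)
  have scale: "prod_list (map (\<lambda>e. c * s e) cs) = c ^ length cs * prod_list (map s cs)" for s :: "'i \<Rightarrow> real" and cs
    by (induction cs) auto
  have "mat_trace (normalized_link_matrix \<alpha> link X N n t \<omega> ^\<^sub>m l)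
      = complex_of_real (c ^ l * (\<Sum>x\<in>\<Omega>. word (w x) (K \<omega>) \<omega>))" for \<omega>
  proof -
    have "mat_trace (normalized_link_matrix \<alpha> link X N n t \<omega> ^\<^sub>m l)
        = complex_of_real (\<Sum>x\<in>\<Omega>. prod_list (map (\<lambda>e. c * walk e (K \<omega>) \<omega>) (w x)))"
      using tr[of "\<lambda>e. c * walk e (K \<omega>) \<omega>"] unfolding normalized_link_matrix_eq c_def walk_def K .
    also have "(\<Sum>x\<in>\<Omega>. prod_list (map (\<lambda>e. c * walk e (K \<omega>) \<omega>) (w x))) = c ^ l * (\<Sum>x\<in>\<Omega>. word (w x) (K \<omega>) \<omega>)"
      unfolding sum_distrib_left by (intro sum.cong refl) (simp add: scale len word_def)
    finally show ?thesis .
  qed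
  then have "tau_n M n (\<lambda>\<omega>. normalized_link_matrix \<alpha> link X N n t \<omega> ^\<^sub>m l)
      = complex_of_real (c ^ l * (\<Sum>x\<in>\<Omega>. expectation (\<lambda>\<omega>. word (w x) (K \<omega>) \<omega>)) / real n)"
    unfolding tau_n_def by (simp add: integrable_stopped_word del: of_real_mult of_real_sum)
  then show ?thesis
    unfolding c .
qed

end

section \<open>The input variables\<close>

context prob_space
begin

text \<open>The moment assumption starts at order 3, so a moment of order \<open>q\<close> is
  controlled by the absolute moment of order \<open>q + 3\<close>, through
  \<open>\<bar>x\<bar> ^ q \<le> 1 + \<bar>x\<bar> ^ (q + 3)\<close>.\<close>

lemma moments_of_higher_moment:
  fixes Y :: "'a \<Rightarrow> real"
  assumes [measurable]: "Y \<in> borel_measurable M" and "(\<integral>\<^sup>+\<omega>. ennreal (\<bar>Y \<omega>\<bar> ^ (q + 3)) \<partial>M) \<le> ennreal B" "0 \<le> B"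
  shows "integrable M (\<lambda>\<omega>. Y \<omega> ^ q)" and "\<bar>expectation (\<lambda>\<omega>. Y \<omega> ^ q)\<bar> \<le> 1 + B"
proof -
  have int: "integrable M (\<lambda>\<omega>. \<bar>Y \<omega>\<bar> ^ (q + 3))"
  proof (rule integrableI_bounded)
    show "(\<integral>\<^sup>+\<omega>. ennreal (norm (\<bar>Y \<omega>\<bar> ^ (q + 3))) \<partial>M) < \<infinity>"
      using le_less_trans[OF assms(2)] by simp
  qed measurable
  have E: "expectation (\<lambda>\<omega>. \<bar>Y \<omega>\<bar> ^ (q + 3)) \<le> B"
    by (rule integral_real_bounded) (use assms in auto)
  have le: "\<bar>x\<bar> ^ q \<le> 1 + \<bar>x\<bar> ^ (q + 3)" for x :: real
  proof (cases "\<bar>x\<bar> \<le> 1")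
    case True
    then have "\<bar>x\<bar> ^ q \<le> 1" by (intro power_le_one) auto
    then show ?thesis by (intro add_increasing2) auto
  next
    case False
    then have "\<bar>x\<bar> ^ q \<le> \<bar>x\<bar> ^ (q + 3)" by (intro power_increasing) auto
    then show ?thesis by simp
  qed
  show i: "integrable M (\<lambda>\<omega>. Y \<omega> ^ q)"
    by (rule Bochner_Integration.integrable_bound[of _ "\<lambda>\<omega>. 1 + \<bar>Y \<omega>\<bar> ^ (q + 3)"])
       (use int le in \<open>auto simp: power_abs\<close>)
  have "\<bar>expectation (\<lambda>\<omega>. Y \<omega> ^ q)\<bar> \<le> expectation (\<lambda>\<omega>. \<bar>Y \<omega> ^ q\<bar>)"
    by (rule integral_abs_bound)
  also have "\<dots> \<le> expectation (\<lambda>\<omega>. 1 + \<bar>Y \<omega>\<bar> ^ (q + 3))"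
    by (rule integral_mono) (use integrable_abs[OF i] int le in \<open>auto simp: power_abs\<close>)
  also have "\<dots> \<le> 1 + B"
    using int E by (simp add: prob_space)
  finally show "\<bar>expectation (\<lambda>\<omega>. Y \<omega> ^ q)\<bar> \<le> 1 + B" .
qed

lemma indep_vars_inj_image:
  assumes "indep_vars (\<lambda>_. borel) Y I" "inj_on f J" "f ` J \<subseteq> I"
  shows "indep_vars (\<lambda>_. borel) (\<lambda>j. Y (f j)) J"
proof -
  have "indep_vars (\<lambda>j. PiM {f j} (\<lambda>_. borel)) (\<lambda>j \<omega>. restrict (\<lambda>i. Y i \<omega>) {f j}) J"
    by (rule indep_vars_restrict[OF assms(1)])
       (use assms(2,3) in \<open>auto simp: disjoint_family_on_def inj_on_def\<close>)
  then have "indep_vars (\<lambda>_. borel) (\<lambda>j \<omega>. (\<lambda>x. x (f j)) (restrict (\<lambda>i. Y i \<omega>) {f j})) J"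
    by (rule indep_vars_compose2) (auto intro!: measurable_component_singleton)
  then show ?thesis by simp
qed

text \<open>The injection \<open>f\<close> singles out one of the two kinds of input variables. The
  supremum in \<open>assumption_I\<close> bounds the sum of both kinds; \<open>dom\<close> says that
  the chosen kind is one of the summands, so it inherits the bound.\<close>

lemma walk_family_input:
  fixes X :: "'i \<Rightarrow> nat \<Rightarrow> 'a \<Rightarrow> real"
  assumes A: "assumption_I X2 X1"
    and f: "inj f" "\<And>c r. 1 \<le> r \<Longrightarrow> f (c, r) \<in> input_index"
      "\<And>c r. input_family X2 X1 (f (c, r)) = X c r"
    and dom: "\<And>c. \<exists>i j. \<forall>r \<omega> q. \<bar>X c r \<omega>\<bar> ^ q \<le> \<bar>X2 (i, j) r \<omega>\<bar> ^ q + \<bar>X1 i r \<omega>\<bar> ^ q"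
  shows "walk_family M X"
proof (intro_locales, unfold_locales)
  have ind: "indep_vars (\<lambda>_. borel) (input_family X2 X1) input_index"
    and E: "\<And>a. a \<in> input_index \<Longrightarrow> expectation (input_family X2 X1 a) = 0 \<and> variance (input_family X2 X1 a) = 1"
    and S: "\<And>l. 3 \<le> l \<Longrightarrow> (SUP i :: nat. SUP j :: nat. SUP k \<in> {1 :: nat..}.
        \<integral>\<^sup>+\<omega>. ennreal (\<bar>X2 (i, j) k \<omega>\<bar> ^ l + \<bar>X1 i k \<omega>\<bar> ^ l) \<partial>M) < \<infinity>"
    using A by (auto simp: assumption_I_def)
  have "indep_vars (\<lambda>_. borel) (\<lambda>p. input_family X2 X1 (f p)) (UNIV \<times> {1..})"
    by (rule indep_vars_inj_image[OF ind]) (use f in \<open>auto intro: inj_on_subset\<close>)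
  then show ind: "indep_vars (\<lambda>_. borel) (\<lambda>(c, r). X c r) (UNIV \<times> {1..})"
    by (rule indep_vars_cong[THEN iffD1, rotated -1]) (auto simp: f)
  have meas: "X c r \<in> borel_measurable M" if "1 \<le> r" for c r
    using ind that unfolding indep_vars_def2 by fastforce
  show mean: "expectation (X c r) = 0" if "1 \<le> r" for c r
    using E[OF f(2)[OF that, of c]] by (simp add: f)
  show "expectation (\<lambda>\<omega>. X c r \<omega> ^ 2) = 1" if "1 \<le> r" for c r
    using E[OF f(2)[OF that, of c]] mean[OF that, of c] by (simp add: f)
  have bound: "\<exists>B\<ge>0. \<forall>c r. 1 \<le> r \<longrightarrow> (\<integral>\<^sup>+\<omega>. ennreal (\<bar>X c r \<omega>\<bar> ^ (q + 3)) \<partial>M) \<le> ennreal B" for q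
  proof -
    let ?I = "\<lambda>i j k. \<integral>\<^sup>+\<omega>. ennreal (\<bar>X2 (i, j) k \<omega>\<bar> ^ (q + 3) + \<bar>X1 i k \<omega>\<bar> ^ (q + 3)) \<partial>M"
    let ?s = "SUP i :: nat. SUP j :: nat. SUP k \<in> {1 :: nat..}. ?I i j k"
    have s: "?s < \<infinity>" by (rule S) simp
    have le: "?I i j k \<le> ?s" if "1 \<le> k" for i j k
      by (rule SUP_upper2[of i], simp, rule SUP_upper2[of j], simp, rule SUP_upper2[of k]) (use that in auto)
    show ?thesis
    proof (intro exI[of _ "enn2real ?s"] conjI allI impI)
      fix c and r :: nat assume r: "1 \<le> r"
      obtain i j where ij: "\<And>r \<omega> q. \<bar>X c r \<omega>\<bar> ^ q \<le> \<bar>X2 (i, j) r \<omega>\<bar> ^ q + \<bar>X1 i r \<omega>\<bar> ^ q"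
        using dom[of c] by blast
      have "(\<integral>\<^sup>+\<omega>. ennreal (\<bar>X c r \<omega>\<bar> ^ (q + 3)) \<partial>M) \<le> ?I i j r"
        by (intro nn_integral_mono ennreal_leI ij)
      also have "\<dots> \<le> ?s" by (rule le[OF r])
      also have "?s = ennreal (enn2real ?s)" using s by simp
      finally show "(\<integral>\<^sup>+\<omega>. ennreal (\<bar>X c r \<omega>\<bar> ^ (q + 3)) \<partial>M) \<le> ennreal (enn2real ?s)" .
    qed simp
  qed
  show "integrable M (\<lambda>\<omega>. X c r \<omega> ^ q)" if "1 \<le> r" for c r q
    using bound[of q] moments_of_higher_moment(1)[OF meas[OF that]] that by blast
  show "\<exists>b. \<forall>c r. 1 \<le> r \<longrightarrow> \<bar>expectation (\<lambda>\<omega>. X c r \<omega> ^ q)\<bar> \<le> b" for q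
  proof -
    obtain B where "0 \<le> B" "\<And>c r. 1 \<le> r \<Longrightarrow> (\<integral>\<^sup>+\<omega>. ennreal (\<bar>X c r \<omega>\<bar> ^ (q + 3)) \<partial>M) \<le> ennreal B"
      using bound[of q] by blast
    then show ?thesis
      using moments_of_higher_moment(2)[OF meas] by (intro exI[of _ "1 + B"]) blast
  qed
qed

lemma stopped_walks_input:
  fixes X :: "'i \<Rightarrow> nat \<Rightarrow> 'a \<Rightarrow> real"
  assumes wf: "walk_family M X"
    and ind: "indep_families input_index borel (input_family X2 X1) {0..} (count_space UNIV) N\<alpha>" and r: "0 \<le> r"
    and f: "\<And>c r. 1 \<le> r \<Longrightarrow> f (c, r) \<in> input_index" "\<And>c r. input_family X2 X1 (f (c, r)) = X c r"
    and K: "N\<alpha> r \<in> measurable M (count_space UNIV)" "\<And>m. integrable M (\<lambda>\<omega>. real (N\<alpha> r \<omega>) ^ m)"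
  shows "stopped_walks M X (N\<alpha> r)"
proof -
  interpret walk_family M X by fact
  show ?thesis
  proof unfold_locales
    fix u :: "('i \<times> nat \<Rightarrow> real) \<Rightarrow> real"
    assume u: "u \<in> borel_measurable (PiM (UNIV \<times> {1..}) (\<lambda>_. borel))"
    have "(\<lambda>x. \<lambda>p\<in>UNIV \<times> {1..}. x (f p)) \<in> measurable (PiM input_index (\<lambda>_. borel)) (PiM (UNIV \<times> {1..}) (\<lambda>_. borel :: real measure))"
      by (rule measurable_restrict) (use f(1) in \<open>auto intro!: measurable_component_singleton\<close>)
    from measurable_compose[OF this u]
    have u': "(\<lambda>x. u (\<lambda>p\<in>UNIV \<times> {1..}. x (f p))) \<in> borel_measurable (PiM input_index (\<lambda>_. borel))" .
    have v: "(\<lambda>y. real (y r)) \<in> borel_measurable (PiM {0..} (\<lambda>_. count_space (UNIV :: nat set)))"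
      by (rule measurable_compose[OF measurable_component_singleton]) (use r in auto)
    have eq: "(\<lambda>p\<in>UNIV \<times> {1..}. (\<lambda>a\<in>input_index. input_family X2 X1 a \<omega>) (f p)) = (\<lambda>(c, r)\<in>UNIV \<times> {1..}. X c r \<omega>)" for \<omega>
      using f by (auto simp: fun_eq_iff restrict_def)
    have "indep_var borel (\<lambda>\<omega>. u (\<lambda>p\<in>UNIV \<times> {1..}. (\<lambda>a\<in>input_index. input_family X2 X1 a \<omega>) (f p)))
        borel (\<lambda>\<omega>. real ((\<lambda>s\<in>{0..}. N\<alpha> s \<omega>) r))"
      by (rule indep_families_imp_indep_var[OF ind _ _ u' v]) simp_all
    then show "indep_var borel (\<lambda>\<omega>. u (\<lambda>(c, r)\<in>UNIV \<times> {1..}. X c r \<omega>)) borel (\<lambda>\<omega>. real (N\<alpha> r \<omega>))"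
      unfolding eq using r by simp
  qed (use K in auto)
qed

end

section \<open>Moments of the semicircle law\<close>

lemma dyck_count_odd: "odd (d + r) \<Longrightarrow> dyck_count d r = 0"
proof (induction r arbitrary: d)
  case 0
  then have "d \<noteq> 0" by (cases "d = 0") simp_all
  then show ?case by simp
next
  case (Suc r)
  have "dyck_count (Suc d) r = 0"
    by (rule Suc.IH) (use Suc.prems in simp)
  moreover have "dyck_count (d - 1) r = 0" if "d \<noteq> 0"
    by (rule Suc.IH) (use Suc.prems that in \<open>cases d, simp_all\<close>)
  ultimately show ?case by simp
qed

lemma has_integral_cos_multiple:
  "((\<lambda>\<theta>. cos (real k * \<theta>)) has_integral (if k = 0 then pi else 0)) {0..pi}"
proof (cases "k = 0")
  case True
  then show ?thesis
    using has_integral_const_real[of "1 :: real" 0 pi] by simp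
next
  case False
  have "((\<lambda>\<theta>. cos (real k * \<theta>)) has_integral (sin (real k * pi) / real k - sin (real k * 0) / real k)) {0..pi}"
  proof (rule fundamental_theorem_of_calculus)
    fix x :: real
    show "((\<lambda>\<theta>. sin (real k * \<theta>) / real k) has_vector_derivative cos (real k * x)) (at x within {0..pi})"
      unfolding has_real_derivative_iff_has_vector_derivative[symmetric]
      using False by (auto intro!: derivative_eq_intros simp: field_simps)
  qed simp
  then show ?thesis
    using False by simp
qed

text \<open>
  The functions \<open>sin ((d + 1) \<theta>) / sin \<theta>\<close> are the Chebyshev polynomials of the second kind in
  \<open>2 cos \<theta>\<close>; their three-term recurrence is the recurrence of \<open>dyck_count\<close>.
\<close>

lemma has_integral_dyck_count:
  "((\<lambda>\<theta>. (2 * cos \<theta>) ^ r * sin (real (Suc d) * \<theta>) * sin \<theta>) has_integral (pi / 2 * dyck_count d r)) {0..pi}"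
proof (induction r arbitrary: d)
  case 0
  have "((\<lambda>\<theta>. (cos (real d * \<theta>) - cos (real (d + 2) * \<theta>)) / 2) has_integral ((if d = 0 then pi else 0) - 0) / 2) {0..pi}"
    using has_integral_diff[OF has_integral_cos_multiple[of d] has_integral_cos_multiple[of "d + 2"]]
    by (intro has_integral_divide) auto
  moreover have "(cos (real d * \<theta>) - cos (real (d + 2) * \<theta>)) / 2 = (2 * cos \<theta>) ^ 0 * sin (real (Suc d) * \<theta>) * sin \<theta>" for \<theta>
  proof -
    have "real d * \<theta> = real (Suc d) * \<theta> - \<theta>" "real (d + 2) * \<theta> = real (Suc d) * \<theta> + \<theta>"
      by (simp_all add: algebra_simps)
    then show ?thesis
      by (simp only: cos_diff cos_add) simp
  qed
  ultimately show ?case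
    by (simp only: if_distrib) (cases "d = 0", simp_all)
next
  case (Suc r)
  have id: "2 * cos \<theta> * sin (real (Suc d) * \<theta>) = sin (real (Suc (Suc d)) * \<theta>) + sin (real d * \<theta>)" for \<theta>
  proof -
    have "real (Suc (Suc d)) * \<theta> = real (Suc d) * \<theta> + \<theta>" "real d * \<theta> = real (Suc d) * \<theta> - \<theta>"
      by (simp_all add: algebra_simps)
    then show ?thesis
      by (simp only: sin_diff sin_add) simp
  qed
  let ?f = "\<lambda>d \<theta>. (2 * cos \<theta>) ^ r * sin (real (Suc d) * \<theta>) * sin \<theta>"
  have eq: "(2 * cos \<theta>) ^ Suc r * sin (real (Suc d) * \<theta>) * sin \<theta>
      = ?f (Suc d) \<theta> + (if d = 0 then 0 else ?f (d - 1) \<theta>)" for \<theta>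
  proof -
    have "(2 * cos \<theta>) ^ Suc r * sin (real (Suc d) * \<theta>) * sin \<theta>
        = (2 * cos \<theta>) ^ r * (2 * cos \<theta> * sin (real (Suc d) * \<theta>)) * sin \<theta>"
      by (simp only: power_Suc2 mult.assoc)
    then show ?thesis
      unfolding id by (cases d) (simp_all add: algebra_simps)
  qed
  have low: "((\<lambda>\<theta>. if d = 0 then 0 else ?f (d - 1) \<theta>) has_integral
      (if d = 0 then 0 else pi / 2 * dyck_count (d - 1) r)) {0..pi}"
    using Suc.IH[of "d - 1"] by (cases "d = 0") simp_all
  have "pi / 2 * dyck_count (Suc d) r + (if d = 0 then 0 else pi / 2 * dyck_count (d - 1) r)
      = pi / 2 * real (dyck_count d (Suc r))"
    by (simp add: distrib_left)
  then show ?case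
    using has_integral_add[OF Suc.IH[of "Suc d"] low] unfolding eq by (simp only:)
qed

text \<open>The substitution \<open>x = - 2 * sqrt v * cos \<theta>\<close> turns the density into
  \<open>2 / pi * (sin \<theta>)\<^sup>2\<close> on \<open>{0..pi}\<close>, which leaves the
  trigonometric integral for Dyck paths that start at height 0.\<close>

lemma semicircle_moment:
  assumes v: "0 < v"
  shows "(\<integral>x. x ^ l * semicircle_density v x \<partial>lborel) = v ^ (l div 2) * real (dyck_count 0 l)"
proof -
  define c where "c = sqrt v"
  have c: "0 < c" "c\<^sup>2 = v" using v by (auto simp: c_def)
  define f where "f x = x ^ l * (sqrt (4 * v - x\<^sup>2) / (2 * pi * v))" for x
  \<comment> \<open>The sign makes \<open>g\<close> increasing on \<open>{0..pi}\<close>, as the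
    substitution rule requires. It leaves the factor \<open>(-c) ^ l\<close>, harmless because the
    Dyck counts of odd length vanish.\<close>
  define g where "g \<theta> = - 2 * c * cos \<theta>" for \<theta>
  define h where "h \<theta> = (-c) ^ l * (2 / pi) * ((2 * cos \<theta>) ^ l * sin (real (Suc 0) * \<theta>) * sin \<theta>)" for \<theta>
  have ends: "g 0 = - 2 * c" "g pi = 2 * c" by (auto simp: g_def)
  have set: "x\<^sup>2 \<le> 4 * v \<longleftrightarrow> x \<in> {g 0..g pi}" for x
  proof -
    have "4 * v = (2 * c)\<^sup>2"
      using c by (simp add: power_mult_distrib)
    then have "x\<^sup>2 \<le> 4 * v \<longleftrightarrow> \<bar>x\<bar> \<le> \<bar>2 * c\<bar>"
      by (simp only: abs_le_square_iff)
    also have "\<dots> \<longleftrightarrow> \<bar>x\<bar> \<le> 2 * c"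
      using c by simp
    finally show ?thesis
      unfolding ends by auto
  qed
  have fg: "f (g \<theta>) * (2 * c * sin \<theta>) = h \<theta>" if "\<theta> \<in> {0..pi}" for \<theta>
  proof -
    have "4 * v - (g \<theta>)\<^sup>2 = (2 * c * sin \<theta>)\<^sup>2"
      unfolding g_def c(2)[symmetric] by (simp add: power_mult_distrib sin_squared_eq algebra_simps)
    moreover have "0 \<le> sin \<theta>"
      using that by (intro sin_ge_zero) auto
    ultimately have "sqrt (4 * v - (g \<theta>)\<^sup>2) = 2 * c * sin \<theta>"
      using c by simp
    then have "f (g \<theta>) * (2 * c * sin \<theta>) = (g \<theta>) ^ l * ((2 * c * sin \<theta>) * (2 * c * sin \<theta>) / (2 * pi * v))"
      by (simp add: f_def)
    also have "(2 * c * sin \<theta>) * (2 * c * sin \<theta>) / (2 * pi * v) = 2 / pi * (sin \<theta> * sin \<theta>)"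
      using c v by (simp add: c(2)[symmetric] power2_eq_square)
    also have "(g \<theta>) ^ l = (-c) ^ l * (2 * cos \<theta>) ^ l"
    proof -
      have "g \<theta> = (-c) * (2 * cos \<theta>)" by (simp add: g_def)
      then show ?thesis by (simp only: power_mult_distrib)
    qed
    finally show ?thesis
      by (simp add: h_def)
  qed
  have contf: "continuous_on {g 0..g pi} f"
    unfolding f_def using v by (intro continuous_intros) auto
  have conth: "continuous_on {0..pi} h"
    unfolding h_def by (intro continuous_intros)
  have "(\<integral>x. x ^ l * semicircle_density v x \<partial>lborel) = (\<integral>x. f x * indicator {g 0..g pi} x \<partial>lborel)"
    by (rule Bochner_Integration.integral_cong) (auto simp: semicircle_density_def set f_def indicator_def)
  also have "\<dots> = (\<integral>\<theta>. f (g \<theta>) * (2 * c * sin \<theta>) * indicator {0..pi} \<theta> \<partial>lborel)"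
  proof (rule integral_substitution)
    show "set_integrable lborel {g 0..g pi} f"
      by (rule borel_integrable_atLeastAtMost'[OF contf])
    show "(g has_real_derivative 2 * c * sin \<theta>) (at \<theta>)" for \<theta>
      unfolding g_def by (auto intro!: derivative_eq_intros)
    show "continuous_on {0..pi} (\<lambda>\<theta>. 2 * c * sin \<theta>)"
      by (intro continuous_intros)
    show "0 \<le> 2 * c * sin \<theta>" if "\<theta> \<in> {0..pi}" for \<theta>
      using c that by (auto intro!: mult_nonneg_nonneg sin_ge_zero)
  qed simp
  also have "\<dots> = (LINT \<theta>:{0..pi}|lborel. h \<theta>)"
    unfolding set_lebesgue_integral_def
  proof (rule Bochner_Integration.integral_cong[OF refl])
    fix \<theta>
    show "f (g \<theta>) * (2 * c * sin \<theta>) * indicator {0..pi} \<theta> = indicator {0..pi} \<theta> *\<^sub>R h \<theta>"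
    proof (cases "\<theta> \<in> {0..pi}")
      case True
      then show ?thesis
        by (simp only: fg indicator_simps mult_1_right scaleR_one)
    qed simp
  qed
  also have "\<dots> = integral {0..pi} h"
    by (rule set_borel_integral_eq_integral(2)[OF borel_integrable_atLeastAtMost'[OF conth]])
  also have "\<dots> = (-c) ^ l * (2 / pi) * (pi / 2 * dyck_count 0 l)"
    unfolding h_def by (rule integral_unique[OF has_integral_mult_right[OF has_integral_dyck_count]])
  also have "\<dots> = v ^ (l div 2) * real (dyck_count 0 l)"
  proof (cases "even l")
    case True
    then obtain m where "l = 2 * m" by blast
    then show ?thesis by (simp add: power_mult c)
  next
    case False
    then show ?thesis by (simp add: dyck_count_odd)
  qed
  finally show ?thesis .
qed

section \<open>Free Brownian motion\<close>

context nc_prob_space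
begin

lemma state_sum: "\<tau> (\<Sum>i\<in>I. a i) = (\<Sum>i\<in>I. \<tau> (a i))"
proof -
  have "\<tau> 0 = 0" using state_scale[of 0 0] by simp
  then show ?thesis
    by (induction I rule: infinite_finite_induct) (auto simp: state_add)
qed

lemma state_minus: "\<tau> (a - b) = \<tau> a - \<tau> b"
  using state_add[of "a - b" b] by simp

text \<open>The definition prescribes increments of positive length only, so \<open>s = r\<close> is
  separate. There \<open>p = 1\<close> is the delicate order: the power of \<open>r - s\<close> is
  1, and the value 0 comes from the Dyck count.\<close>

lemma free_brownian_motion_increment:
  assumes B: "free_brownian_motion B" and "0 \<le> s" "s \<le> r"
  shows "\<tau> ((B r - B s) ^ p) = complex_of_real ((r - s) ^ (p div 2) * dyck_count 0 p)"
proof (cases "s = r")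
  case True
  have "\<tau> 0 = 0" using state_scale[of 0 0] by simp
  then show ?thesis
    using True state_one by (cases "p = 0"; cases "p = 1") (auto simp: power_0_left)
next
  case False
  then have pos: "0 < r - s" using assms by simp
  have "semicircular (r - s) (B (s + (r - s)) - B s)"
    using B assms(2) pos unfolding free_brownian_motion_def by blast
  then show ?thesis
    using semicircle_moment[OF pos, of p] by (simp add: semicircular_def)
qed

lemma free_brownian_motion_moment:
  assumes "free_brownian_motion B" "0 \<le> s"
  shows "\<tau> (B s ^ p) = complex_of_real (s ^ (p div 2) * dyck_count 0 p)"
proof -
  have "B 0 = 0"
    using assms(1) by (simp add: free_brownian_motion_def)
  then show ?thesis
    using free_brownian_motion_increment[OF assms(1) order_refl assms(2), of p] by simp
qed

text \<open>Polynomials in \<open>d x\<close> whose coefficients are measurable in \<open>x\<close>.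
  The algebra carries no \<sigma>-algebra, so measurable dependence on \<open>x\<close> can only be
  expressed through complex coefficients and through values of the state.\<close>

inductive_set poly_functions :: "'x measure \<Rightarrow> ('x \<Rightarrow> 'b) \<Rightarrow> ('x \<Rightarrow> 'b) set" for S d where
  monomial: "c \<in> borel_measurable S \<Longrightarrow> (\<lambda>x. scaleC (c x) (d x ^ e)) \<in> poly_functions S d"
| sum: "\<lbrakk>a \<in> poly_functions S d; b \<in> poly_functions S d\<rbrakk> \<Longrightarrow> (\<lambda>x. a x + b x) \<in> poly_functions S d"

lemma poly_functions_self: "d \<in> poly_functions S d"
  using poly_functions.monomial[of "\<lambda>_. 1" S d 1] by simp

lemma poly_functions_mult:
  assumes "a \<in> poly_functions S d" "b \<in> poly_functions S d"
  shows "(\<lambda>x. a x * b x) \<in> poly_functions S d"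
  using assms(1)
proof induction
  case (monomial c e)
  note c = monomial
  from assms(2) show ?case
  proof induction
    case (monomial c' e')
    have "(\<lambda>x. scaleC (c x * c' x) (d x ^ (e + e'))) \<in> poly_functions S d"
      by (rule poly_functions.monomial) (use c monomial in measurable)
    moreover have "scaleC (c x * c' x) (d x ^ (e + e')) = scaleC (c x) (d x ^ e) * scaleC (c' x) (d x ^ e')" for x
      by (simp add: power_add scale_mult_left[symmetric] scale_mult_right[symmetric])
    ultimately show ?case by simp
  next
    case (sum a b)
    then show ?case using poly_functions.sum by (fastforce simp: distrib_left)
  qed
next
  case (sum a a')
  then show ?case using poly_functions.sum by (fastforce simp: distrib_right)
qed

lemma poly_functions_subalgebra: "a \<in> poly_functions S d \<Longrightarrow> a x \<in> star_subalgebra_generated {d x}"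
proof (induction rule: poly_functions.induct)
  case (monomial c e)
  have "d x ^ e \<in> star_subalgebra_generated {d x}"
    by (induction e) (auto intro: star_subalgebra_generated.intros)
  then show ?case by (rule star_subalgebra_generated.scale)
qed (auto intro: star_subalgebra_generated.add)

lemma poly_functions_state:
  assumes "a \<in> poly_functions S d" "\<And>p. (\<lambda>x. \<tau> (d x ^ p)) \<in> borel_measurable S"
  shows "(\<lambda>x. \<tau> (a x)) \<in> borel_measurable S"
  using assms(1)
proof induction
  case (monomial c e)
  then show ?case using assms(2) by (simp add: state_scale)
qed (simp add: state_add)

lemma poly_functions_centre:
  assumes "a \<in> poly_functions S d" "\<And>p. (\<lambda>x. \<tau> (d x ^ p)) \<in> borel_measurable S"
  shows "(\<lambda>x. a x - scaleC (\<tau> (a x)) 1) \<in> poly_functions S d"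
proof -
  have "(\<lambda>x. scaleC (- \<tau> (a x)) (d x ^ 0)) \<in> poly_functions S d"
    by (rule poly_functions.monomial) (use poly_functions_state[OF assms] in measurable)
  from poly_functions.sum[OF assms(1) this] show ?thesis
    by simp
qed

text \<open>
  Freeness determines mixed moments recursively: equal neighbours are merged, and the factors of an
  alternating product are centred one by one, which either shortens the product or leads to a
  product of centred factors, whose state vanishes.
\<close>

lemma measurable_free_moment:
  fixes d :: "nat \<Rightarrow> 'x \<Rightarrow> 'b"
  assumes free: "\<And>x. x \<in> space S \<Longrightarrow> freely_independent {..<m} (\<lambda>j. d j x)"
    and mom: "\<And>j p. j < m \<Longrightarrow> (\<lambda>x. \<tau> (d j x ^ p)) \<in> borel_measurable S"
    and F: "\<forall>(j, a)\<in>set F. j < m \<and> a \<in> poly_functions S (d j)"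
  shows "(\<lambda>x. \<tau> (prod_list (map (\<lambda>(j, a). a x) F))) \<in> borel_measurable S"
  using F
proof (induction "length F" arbitrary: F rule: less_induct)
  case less
  show ?case
  proof (cases "\<forall>k. Suc k < length F \<longrightarrow> fst (F ! k) \<noteq> fst (F ! Suc k)")
    case False
    then obtain k where k: "Suc k < length F" "fst (F ! k) = fst (F ! Suc k)" by blast
    obtain j a b where ab: "F ! k = (j, a)" "F ! Suc k = (j, b)"
      using k(2) by (metis prod.collapse)
    define G where "G = take k F @ (j, \<lambda>x. a x * b x) # drop (Suc (Suc k)) F"
    have F_eq: "F = take k F @ (j, a) # (j, b) # drop (Suc (Suc k)) F"
      using k(1) ab by (metis Cons_nth_drop_Suc Suc_lessD id_take_nth_drop)
    have "(j, a) \<in> set F" "(j, b) \<in> set F"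
      using ab k(1) by (metis Suc_lessD nth_mem)+
    then have "j < m \<and> (\<lambda>x. a x * b x) \<in> poly_functions S (d j)"
      using less.prems poly_functions_mult by blast
    then have "\<forall>(j, a)\<in>set G. j < m \<and> a \<in> poly_functions S (d j)"
      using less.prems unfolding G_def by (auto dest: in_set_takeD in_set_dropD)
    moreover have "length G < length F"
      using k(1) by (simp add: G_def)
    ultimately have "(\<lambda>x. \<tau> (prod_list (map (\<lambda>(j, a). a x) G))) \<in> borel_measurable S"
      using less.hyps by blast
    moreover have "prod_list (map (\<lambda>(j, a). a x) G) = prod_list (map (\<lambda>(j, a). a x) F)" for x
      by (subst F_eq) (simp add: G_def mult.assoc)
    ultimately show ?thesis by simp
  next
    case True
    \<comment> \<open>\<open>C\<close> collects the factors already centred and \<open>R\<close>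
      those still to be treated. Once \<open>R\<close> is exhausted, freeness applies and the state
      is 0.\<close>
    have main: "(\<lambda>x. \<tau> (prod_list (map (\<lambda>(j, a). a x) (C @ R)))) \<in> borel_measurable S"
      if "length (C @ R) = length F" "\<forall>(j, a)\<in>set (C @ R). j < m \<and> a \<in> poly_functions S (d j)"
        "\<forall>k. Suc k < length (C @ R) \<longrightarrow> fst ((C @ R) ! k) \<noteq> fst ((C @ R) ! Suc k)"
        "\<forall>(j, a)\<in>set C. \<forall>x\<in>space S. \<tau> (a x) = 0" for C R
      using that
    proof (induction R arbitrary: C)
      case Nil
      show ?case
      proof (cases "C = []")
        case False
        have "\<tau> (prod_list (map (\<lambda>(j, a). a x) C)) = 0" if x: "x \<in> space S" for x
        proof -
          let ?js = "map fst C" and ?xs = "map (\<lambda>(j, a). a x) C"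
          have el: "fst (C ! k) < m" "snd (C ! k) \<in> poly_functions S (d (fst (C ! k)))" "\<tau> (snd (C ! k) x) = 0"
            if "k < length C" for k
            using Nil.prems(2,4) nth_mem[OF that] x by (auto simp: case_prod_beta)
          have "?xs ! k \<in> star_subalgebra_generated {d (?js ! k) x} \<and> \<tau> (?xs ! k) = 0" if "k < length ?xs" for k
            using el[of k] that poly_functions_subalgebra by (simp add: case_prod_beta)
          moreover have "set ?js \<subseteq> {..<m}"
            using Nil.prems(2) by (auto simp: case_prod_beta)
          moreover have "\<forall>k. Suc k < length ?js \<longrightarrow> ?js ! k \<noteq> ?js ! Suc k"
            using Nil.prems(3) by simp
          moreover have "length ?js = length ?xs" "?xs \<noteq> []"
            using False by simp_all
          ultimately show ?thesis
            using free[OF x] unfolding freely_independent_def by blast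
        qed
        then show ?thesis
          by (subst measurable_cong[of _ _ "\<lambda>_. 0"]) simp_all
      qed simp
    next
      case (Cons r R)
      obtain j a where r: "r = (j, a)" by (cases r)
      have ja: "j < m" "a \<in> poly_functions S (d j)"
        using Cons.prems(2) r by auto
      define a' where "a' = (\<lambda>x. a x - scaleC (\<tau> (a x)) 1)"
      have a': "a' \<in> poly_functions S (d j)"
        unfolding a'_def by (rule poly_functions_centre[OF ja(2) mom[OF ja(1)]])
      have centred: "\<tau> (a' x) = 0" for x
        by (simp add: a'_def state_minus state_scale state_one)
      have m1: "(\<lambda>x. \<tau> (prod_list (map (\<lambda>(j, a). a x) ((C @ [(j, a')]) @ R)))) \<in> borel_measurable S"
      proof (rule Cons.IH)
        have eq: "map fst ((C @ [(j, a')]) @ R) = map fst (C @ r # R)"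
          using r by simp
        have "fst (((C @ [(j, a')]) @ R) ! k) = fst ((C @ r # R) ! k)" if "k < length (C @ r # R)" for k
          using arg_cong[OF eq, of "\<lambda>xs. xs ! k"] that by (simp del: map_append)
        then show "\<forall>k. Suc k < length ((C @ [(j, a')]) @ R) \<longrightarrow>
            fst (((C @ [(j, a')]) @ R) ! k) \<noteq> fst (((C @ [(j, a')]) @ R) ! Suc k)"
          using Cons.prems(3) by simp
      qed (use Cons.prems a' ja centred in auto)
      have m2: "(\<lambda>x. \<tau> (prod_list (map (\<lambda>(j, a). a x) (C @ R)))) \<in> borel_measurable S"
        using Cons.prems by (intro less.hyps) auto
      have m3: "(\<lambda>x. \<tau> (a x)) \<in> borel_measurable S"
        by (rule poly_functions_state[OF ja(2) mom[OF ja(1)]])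
      \<comment> \<open>The second summand lacks the factor \<open>r\<close> altogether. Its product
        is shorter, so the outer induction covers it even when equal indices have become
        neighbours.\<close>
      have "\<tau> (prod_list (map (\<lambda>(j, a). a x) (C @ r # R)))
          = \<tau> (prod_list (map (\<lambda>(j, a). a x) ((C @ [(j, a')]) @ R)))
            + \<tau> (a x) * \<tau> (prod_list (map (\<lambda>(j, a). a x) (C @ R)))" for x
      proof -
        let ?P = "\<lambda>F. prod_list (map (\<lambda>(j, a). a x) F)"
        have "?P (C @ r # R) = ?P C * (a' x + scaleC (\<tau> (a x)) 1) * ?P R"
          by (simp add: r a'_def mult.assoc)
        also have "\<dots> = ?P ((C @ [(j, a')]) @ R) + scaleC (\<tau> (a x)) (?P (C @ R))"
          by (simp add: algebra_simps scale_mult_left[symmetric] scale_mult_right[symmetric])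
        finally show ?thesis
          by (simp only: state_add state_scale)
      qed
      then show ?case
        using m1 m2 m3 by simp
    qed
    show ?thesis
      using main[of "[]" F] less.prems True by simp
  qed
qed

text \<open>The product of partial sums is expanded one factor at a time; \<open>F\<close> gathers
  the increments chosen so far, and linearity of the state ends with pure products of
  increments.\<close>

lemma measurable_free_sum_moment:
  fixes d :: "nat \<Rightarrow> 'x \<Rightarrow> 'b"
  assumes free: "\<And>x. x \<in> space S \<Longrightarrow> freely_independent {..<m} (\<lambda>j. d j x)"
    and mom: "\<And>j p. j < m \<Longrightarrow> (\<lambda>x. \<tau> (d j x ^ p)) \<in> borel_measurable S"
    and r: "\<forall>r\<in>set rs. r \<le> m" and F: "\<forall>(j, a)\<in>set F. j < m \<and> a \<in> poly_functions S (d j)"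
  shows "(\<lambda>x. \<tau> (prod_list (map (\<lambda>(j, a). a x) F) * prod_list (map (\<lambda>r. \<Sum>j<r. d j x) rs))) \<in> borel_measurable S"
  using r F
proof (induction rs arbitrary: F)
  case Nil
  then show ?case using measurable_free_moment[OF free mom] by simp
next
  case (Cons r rs)
  have "(\<lambda>x. \<Sum>j<r. \<tau> (prod_list (map (\<lambda>(j, a). a x) (F @ [(j, d j)])) * prod_list (map (\<lambda>r. \<Sum>j<r. d j x) rs)))
      \<in> borel_measurable S"
    by (intro borel_measurable_sum Cons.IH) (use Cons.prems poly_functions_self in auto)
  moreover have "prod_list (map (\<lambda>(j, a). a x) F) * prod_list (map (\<lambda>r. \<Sum>j<r. d j x) (r # rs))
      = (\<Sum>j<r. prod_list (map (\<lambda>(j, a). a x) (F @ [(j, d j)])) * prod_list (map (\<lambda>r. \<Sum>j<r. d j x) rs))" for x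
    by (simp add: sum_distrib_left sum_distrib_right mult.assoc)
  ultimately show ?case
    by (simp only: state_sum)
qed

text \<open>
  The time integral in \<open>time_changed_moment\<close> is taken against a law on a product space, so the joint moment has to
  be measurable off the diagonal as well. On each cell of times sorted by a fixed permutation the increments are free.
\<close>

lemma measurable_free_brownian_joint_moment:
  assumes B: "free_brownian_motion B"
  shows "(\<lambda>x. indicator {x. \<forall>i<l. 0 \<le> x i} x *\<^sub>R \<tau> (prod_list (map (\<lambda>i. B (x i)) [0..<l])))
    \<in> borel_measurable (PiM {..<l} (\<lambda>_. borel :: real measure))"
    (is "?f \<in> borel_measurable ?P")
proof -
  define Pos where "Pos = {x :: nat \<Rightarrow> real. \<forall>i<l. 0 \<le> x i}"
  \<comment> \<open>The cell of times that the list \<open>is\<close> puts in increasing order.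
    Cells overlap where times coincide, which the piecewise criterion tolerates.\<close>
  define C where "C is = {x \<in> Pos. \<forall>k\<in>{..<l-1}. x (is ! k) \<le> x (is ! Suc k)}" for "is" :: "nat list"
  define Perms where "Perms = {is. length is = l \<and> set is = {..<l}}"
  have comp: "(\<lambda>x. x i) \<in> borel_measurable ?P" if "i < l" for i
    using that by (intro measurable_component_singleton) simp
  have Pos_eq: "Pos \<inter> space ?P = {x \<in> space ?P. \<forall>i\<in>{..<l}. 0 \<le> x i}"
    by (auto simp: Pos_def)
  have Pos_sets: "Pos \<inter> space ?P \<in> sets ?P"
    unfolding Pos_eq by (intro sets.sets_Collect_finite_All borel_measurable_le comp) auto
  have C_sets: "C is \<inter> space ?P \<in> sets ?P" if "is \<in> Perms" for "is"
  proof -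
    have il: "is ! k < l" if "k < l" for k
      using \<open>is \<in> Perms\<close> nth_mem[of k "is"] that by (auto simp: Perms_def)
    have eq: "C is \<inter> space ?P = (Pos \<inter> space ?P) \<inter> {x \<in> space ?P. \<forall>k\<in>{..<l-1}. x (is ! k) \<le> x (is ! Suc k)}"
      unfolding C_def by blast
    have "{x \<in> space ?P. \<forall>k\<in>{..<l-1}. x (is ! k) \<le> x (is ! Suc k)} \<in> sets ?P"
      by (intro sets.sets_Collect_finite_All borel_measurable_le comp il) auto
    then show ?thesis
      unfolding eq using Pos_sets by blast
  qed
  show ?thesis
  proof (rule measurable_piecewise_restrict)
    show "countable (insert (- Pos) (C ` Perms))"
      by (simp add: countableI_type)
    show "\<Omega> \<inter> space ?P \<in> sets ?P" if "\<Omega> \<in> insert (- Pos) (C ` Perms)" for \<Omega>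
    proof (cases "\<Omega> = - Pos")
      case True
      have "- Pos \<inter> space ?P = space ?P - Pos \<inter> space ?P" by auto
      then show ?thesis using True Pos_sets by auto
    next
      case False
      then show ?thesis using that C_sets by auto
    qed
    show "space ?P \<subseteq> \<Union> (insert (- Pos) (C ` Perms))"
    proof
      fix x assume "x \<in> space ?P"
      show "x \<in> \<Union> (insert (- Pos) (C ` Perms))"
      proof (cases "x \<in> Pos")
        case True
        define ks where "ks = sort_key x [0..<l]"
        have ks: "ks \<in> Perms"
          by (auto simp: Perms_def ks_def)
        have "sorted (map x ks)"
          by (simp add: ks_def)
        then have "x \<in> C ks"
          using True ks by (auto simp: C_def Perms_def sorted_iff_nth_mono)
        then show ?thesis using ks by blast
      qed simp
    qed
    show "?f \<in> borel_measurable (restrict_space ?P \<Omega>)" if \<Omega>: "\<Omega> \<in> insert (- Pos) (C ` Perms)" for \<Omega>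
    proof (cases "\<Omega> = - Pos")
      case True
      have zero: "?f x = 0" if "x \<in> space (restrict_space ?P \<Omega>)" for x
        using that by (auto simp: space_restrict_space True Pos_def)
      show ?thesis
        by (subst measurable_cong[OF zero]) simp_all
    next
      case False
      then obtain ks where ks: "ks \<in> Perms" "\<Omega> = C ks"
        using \<Omega> by blast
      let ?S = "restrict_space ?P (C ks)"
      have ksl: "ks ! k < l" if "k < l" for k
        using ks(1) nth_mem[of k ks] that by (auto simp: Perms_def)
      \<comment> \<open>The sorted times preceded by 0, so that partial sums of increments give
        \<open>B\<close> itself, and frozen from index \<open>l\<close> on, because free increments
        are stated for monotone infinite sequences.\<close>
      define T where "T x k = (if k = 0 then 0 else if l = 0 then 0 else x (ks ! (min k l - 1)))" for x :: "nat \<Rightarrow> real" and k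
      define d where "d j x = B (T x (Suc j)) - B (T x j)" for j x
      have Tm: "(\<lambda>x. T x k) \<in> borel_measurable ?S" for k
      proof (cases "k = 0 \<or> l = 0")
        case False
        then have "ks ! (min k l - 1) < l"
          by (intro ksl) auto
        then show ?thesis
          using False unfolding T_def by (auto intro!: measurable_restrict_space1 comp)
      next
        case True
        then have "(\<lambda>x. T x k) = (\<lambda>_. 0)"
          by (auto simp: T_def fun_eq_iff)
        then show ?thesis by simp
      qed
      have T0: "0 \<le> T x k" and Tmono: "T x k \<le> T x (Suc k)" if "x \<in> C ks" for x k
      proof -
        show nn: "0 \<le> T x k" for k
          using that ksl[of "min k l - 1"] by (auto simp: T_def C_def Pos_def)
        show "T x k \<le> T x (Suc k)"
        proof (cases "k = 0 \<or> l = 0 \<or> l \<le> k")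
          case True
          then show ?thesis
            using nn[of "Suc k"] by (auto simp: T_def min_def)
        next
          case False
          then obtain k' where "k = Suc k'" "Suc k' < l"
            by (cases k) auto
          then show ?thesis
            using that by (auto simp: T_def C_def min_def)
        qed
      qed
      have B0: "B 0 = 0"
        using B by (simp add: free_brownian_motion_def)
      have telescope: "(\<Sum>j<k. d j x) = B (T x k)" for k x
        by (induction k) (auto simp: d_def T_def B0)
      have free: "freely_independent {..<l} (\<lambda>j. d j x)" if "x \<in> space ?S" for x
      proof -
        have x: "x \<in> C ks" using that by (auto simp: space_restrict_space)
        have "mono (T x)"
          unfolding mono_iff_le_Suc using Tmono[OF x] by blast
        then show ?thesis
          using B T0[OF x, of 0] unfolding free_brownian_motion_def d_def by blast
      qed
      have mom: "(\<lambda>x. \<tau> (d j x ^ p)) \<in> borel_measurable ?S" for j p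
      proof -
        have eq: "\<tau> (d j x ^ p) = complex_of_real ((T x (Suc j) - T x j) ^ (p div 2) * dyck_count 0 p)"
          if "x \<in> space ?S" for x
          unfolding d_def using that T0 Tmono
          by (intro free_brownian_motion_increment[OF B]) (auto simp: space_restrict_space)
        note [measurable] = Tm
        show ?thesis
          by (subst measurable_cong[OF eq]) measurable
      qed
      have "\<exists>k<l. ks ! k = i" if "i < l" for i
        using ks(1) that by (auto simp: Perms_def) (metis in_set_conv_nth lessThan_iff)
      then obtain pos where pos: "\<And>i. i < l \<Longrightarrow> pos i < l \<and> ks ! (pos i) = i"
        by metis
      have Bx: "B (x i) = (\<Sum>j<Suc (pos i). d j x)" if "i < l" for x i
      proof -
        have "T x (Suc (pos i)) = x i"
          using pos[OF that] by (auto simp: T_def min_def)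
        then show ?thesis
          unfolding telescope by simp
      qed
      have "(\<lambda>x. \<tau> (prod_list (map (\<lambda>(j, a). a x) ([] :: (nat \<times> _) list)) * prod_list (map (\<lambda>r. \<Sum>j<r. d j x) (map (\<lambda>i. Suc (pos i)) [0..<l]))))
          \<in> borel_measurable ?S"
        by (rule measurable_free_sum_moment[OF free mom]) (use pos in \<open>auto simp: Suc_le_eq\<close>)
      moreover have "prod_list (map (\<lambda>r. \<Sum>j<r. d j x) (map (\<lambda>i. Suc (pos i)) [0..<l])) = prod_list (map (\<lambda>i. B (x i)) [0..<l])" for x
        by (intro arg_cong[where f = prod_list]) (simp add: Bx comp_def del: sum.lessThan_Suc)
      ultimately have "(\<lambda>x. \<tau> (prod_list (map (\<lambda>i. B (x i)) [0..<l]))) \<in> borel_measurable ?S"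
        by simp
      moreover have "?f x = \<tau> (prod_list (map (\<lambda>i. B (x i)) [0..<l]))" if "x \<in> space ?S" for x
        using that by (auto simp: space_restrict_space C_def Pos_def)
      ultimately show ?thesis
        unfolding ks(2) by (subst measurable_cong) auto
    qed
  qed
qed

text \<open>The joint law at equal times sits on the diagonal of the orthant, so the multiple
  integral collapses to an integral over the sample space, where the moment of the free Brownian
  motion at a fixed time is known.\<close>

lemma time_changed_moment_eq:
  assumes B: "free_brownian_motion B" and [measurable]: "L t \<in> borel_measurable M"
    and nonneg: "\<And>\<omega>. \<omega> \<in> space M \<Longrightarrow> 0 \<le> L t \<omega>"
  shows "time_changed_moment M L \<tau> B (replicate l t) = (\<integral>\<omega>. \<tau> (B (L t \<omega>) ^ l) \<partial>M)"
    and "time_changed_moment M L \<tau> B (replicate l t) = complex_of_real ((\<integral>\<omega>. L t \<omega> ^ (l div 2) \<partial>M) * dyck_count 0 l)"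
proof -
  let ?X = "\<lambda>\<omega>. \<lambda>i\<in>{..<l}. L (replicate l t ! i) \<omega>"
  have X: "?X \<in> measurable M (PiM {..<l} (\<lambda>_. borel))"
    by (rule measurable_restrict) simp
  have "time_changed_moment M L \<tau> B (replicate l t)
      = (\<integral>\<omega>. indicator {x. \<forall>i<l. 0 \<le> x i} (?X \<omega>) *\<^sub>R \<tau> (prod_list (map (\<lambda>i. B (?X \<omega> i)) [0..<l])) \<partial>M)"
    unfolding time_changed_moment_def joint_law_def set_lebesgue_integral_def length_replicate
    by (rule integral_distr[OF X measurable_free_brownian_joint_moment[OF B]])
  also have "\<dots> = (\<integral>\<omega>. \<tau> (B (L t \<omega>) ^ l) \<partial>M)"
  proof (rule Bochner_Integration.integral_cong[OF refl])
    fix \<omega> assume \<omega>: "\<omega> \<in> space M"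
    have "map (\<lambda>i. B (?X \<omega> i)) [0..<l] = map (\<lambda>_. B (L t \<omega>)) [0..<l]"
      by (rule map_cong) auto
    also have "\<dots> = replicate l (B (L t \<omega>))"
      by (simp add: map_replicate_const)
    finally have "prod_list (map (\<lambda>i. B (?X \<omega> i)) [0..<l]) = B (L t \<omega>) ^ l"
      by (simp only: prod_list_replicate)
    moreover have "?X \<omega> \<in> {x. \<forall>i<l. 0 \<le> x i}"
      using nonneg[OF \<omega>] by simp
    ultimately show "indicator {x. \<forall>i<l. 0 \<le> x i} (?X \<omega>) *\<^sub>R \<tau> (prod_list (map (\<lambda>i. B (?X \<omega> i)) [0..<l]))
        = \<tau> (B (L t \<omega>) ^ l)"
      by (simp only: indicator_simps scaleR_one)
  qed
  finally show eq: "time_changed_moment M L \<tau> B (replicate l t) = (\<integral>\<omega>. \<tau> (B (L t \<omega>) ^ l) \<partial>M)" .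
  also have "\<dots> = (\<integral>\<omega>. complex_of_real (L t \<omega> ^ (l div 2) * dyck_count 0 l) \<partial>M)"
    by (rule Bochner_Integration.integral_cong[OF refl]) (rule free_brownian_motion_moment[OF B nonneg])
  also have "\<dots> = complex_of_real ((\<integral>\<omega>. L t \<omega> ^ (l div 2) \<partial>M) * dyck_count 0 l)"
    unfolding integral_complex_of_real by simp
  finally show "time_changed_moment M L \<tau> B (replicate l t) = complex_of_real ((\<integral>\<omega>. L t \<omega> ^ (l div 2) \<partial>M) * dyck_count 0 l)" .
qed

text \<open>Positivity holds because the functional is an average of states: its value at
  \<open>p\<close> is the expectation of \<tau> at \<open>p\<close> evaluated in
  \<open>B (L t \<omega>)\<close>, and each such evaluation is positive.\<close>

lemma nc_prob_space_time_changed_state: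
  assumes B: "free_brownian_motion B" and M: "prob_space M" and L [measurable]: "L t \<in> borel_measurable M"
    and nonneg: "\<And>\<omega>. \<omega> \<in> space M \<Longrightarrow> 0 \<le> L t \<omega>" and int: "\<And>m. integrable M (\<lambda>\<omega>. L t \<omega> ^ m)"
  shows "nc_prob_space Polynomial.smult (map_poly cnj) (time_changed_state M L \<tau> B t)"
    and "time_changed_state M L \<tau> B t (monom 1 l) = time_changed_moment M L \<tau> B (replicate l t)"
proof -
  interpret M: prob_space M by fact
  define mo where "mo l = time_changed_moment M L \<tau> B (replicate l t)" for l
  let ?S = "time_changed_state M L \<tau> B t"
  \<comment> \<open>Summing up to any bound on the degree puts two polynomials and their sum on a
    common range.\<close>
  have S: "?S p = (\<Sum>l\<le>n. coeff p l * mo l)" if "degree p \<le> n" for p n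
    unfolding time_changed_state_def mo_def
    by (rule sum.mono_neutral_left) (use that in \<open>auto simp: coeff_eq_0 not_le\<close>)
  have add: "?S (p + q) = ?S p + ?S q" for p q
    using S[of p "max (degree p) (degree q)"] S[of q "max (degree p) (degree q)"]
      S[of "p + q" "max (degree p) (degree q)"]
    by (simp add: degree_add_le_max distrib_right sum.distrib)
  have S0: "?S 0 = 0" by (simp add: S[of 0 0])
  have monom: "?S (monom c l) = c * mo l" for c l
    using S[of "monom c l" l] degree_monom_le[of c l]
    by (simp add: sum.If_cases if_distrib if_distribR coeff_monom cong: if_cong)
  show "?S (monom 1 l) = time_changed_moment M L \<tau> B (replicate l t)"
    by (simp add: monom mo_def)
  have sum: "?S (\<Sum>i\<in>I. f i) = (\<Sum>i\<in>I. ?S (f i))" for f :: "nat \<Rightarrow> complex poly" and I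
    by (induction I rule: infinite_finite_induct) (auto simp: S0 add)
  have pos: "?S (map_poly cnj p * p) \<in> \<real>\<^sub>\<ge>\<^sub>0" for p
  proof -
    define n where "n = degree p"
    have deg: "degree (map_poly cnj p) \<le> n" unfolding n_def by (rule map_poly_degree_leq)
    have "map_poly cnj p = (\<Sum>i\<le>n. monom (cnj (coeff p i)) i)"
      using poly_as_sum_of_monoms'[OF deg] by (simp add: coeff_map_poly)
    moreover have "p = (\<Sum>j\<le>n. monom (coeff p j) j)"
      using poly_as_sum_of_monoms[of p] by (simp add: n_def)
    ultimately have "map_poly cnj p * p = (\<Sum>i\<le>n. monom (cnj (coeff p i)) i) * (\<Sum>j\<le>n. monom (coeff p j) j)"
      by metis
    also have "\<dots> = (\<Sum>i\<le>n. \<Sum>j\<le>n. monom (cnj (coeff p i) * coeff p j) (i + j))"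
      by (simp add: sum_product mult_monom)
    finally have "?S (map_poly cnj p * p) = (\<Sum>i\<le>n. \<Sum>j\<le>n. cnj (coeff p i) * coeff p j * mo (i + j))"
      by (simp only: sum monom)
    define b where "b \<omega> = B (L t \<omega>)" for \<omega>
    \<comment> \<open>The polynomial \<open>p\<close> evaluated at the self-adjoint element
      \<open>B (L t \<omega>)\<close>.\<close>
    define P where "P \<omega> = (\<Sum>j\<le>n. scaleC (coeff p j) (b \<omega> ^ j))" for \<omega>
    have b_int: "integrable M (\<lambda>\<omega>. \<tau> (b \<omega> ^ l))" for l
    proof -
      have "integrable M (\<lambda>\<omega>. complex_of_real (L t \<omega> ^ (l div 2) * dyck_count 0 l))"
        using int by (intro integrable_of_real integrable_mult_left) auto
      then show ?thesis
        by (rule Bochner_Integration.integrable_cong[THEN iffD1, rotated -1])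
           (auto simp: b_def free_brownian_motion_moment[OF B nonneg])
    qed
    have star_b: "star (b \<omega> ^ j) = b \<omega> ^ j" if "\<omega> \<in> space M" for \<omega> j
    proof -
      have sb: "star (b \<omega>) = b \<omega>"
        using B nonneg[OF that] by (simp add: free_brownian_motion_def b_def)
      have "star 1 = 1"
        using star_mult[of "star 1" 1] by (simp add: star_star)
      then show ?thesis
        by (induction j) (simp_all add: star_mult sb power_commutes)
    qed
    have star0: "star 0 = 0"
      using star_add[of 0 0] by simp
    have star_sum: "star (\<Sum>j\<in>J. f j) = (\<Sum>j\<in>J. star (f j))" for f :: "nat \<Rightarrow> 'b" and J
      by (induction J rule: infinite_finite_induct) (auto simp: star0 star_add)
    have expand: "\<tau> (star (P \<omega>) * P \<omega>) = (\<Sum>i\<le>n. \<Sum>j\<le>n. cnj (coeff p i) * coeff p j * \<tau> (b \<omega> ^ (i + j)))"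
      if "\<omega> \<in> space M" for \<omega>
      unfolding P_def
      by (simp add: star_sum star_scale star_b[OF that] sum_product state_sum state_scale power_add mult_ac
          scale_mult_left[symmetric] scale_mult_right[symmetric])
    note \<open>?S (map_poly cnj p * p) = (\<Sum>i\<le>n. \<Sum>j\<le>n. cnj (coeff p i) * coeff p j * mo (i + j))\<close>
    also have "(\<Sum>i\<le>n. \<Sum>j\<le>n. cnj (coeff p i) * coeff p j * mo (i + j))
        = (\<integral>\<omega>. (\<Sum>i\<le>n. \<Sum>j\<le>n. cnj (coeff p i) * coeff p j * \<tau> (b \<omega> ^ (i + j))) \<partial>M)"
    proof -
      have "mo l = (\<integral>\<omega>. \<tau> (b \<omega> ^ l) \<partial>M)" for l
        unfolding mo_def b_def by (rule time_changed_moment_eq(1)[where L = L and t = t, OF B L nonneg])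
      then show ?thesis
        by (simp add: Bochner_Integration.integral_sum b_int)
    qed
    also have "\<dots> = (\<integral>\<omega>. \<tau> (star (P \<omega>) * P \<omega>) \<partial>M)"
      by (rule Bochner_Integration.integral_cong[OF refl]) (simp add: expand)
    \<comment> \<open>The integrand is a nonnegative real at every sample point, so passing to its
      real part changes nothing and reduces the claim to a nonnegative real integral.\<close>
    also have "\<dots> = (\<integral>\<omega>. complex_of_real (Re (\<tau> (star (P \<omega>) * P \<omega>))) \<partial>M)"
      by (rule Bochner_Integration.integral_cong[OF refl])
         (use state_positive in \<open>auto simp: nonneg_Reals_def complex_eq_iff elim!: nonneg_Reals_cases\<close>)
    also have "\<dots> = complex_of_real (\<integral>\<omega>. Re (\<tau> (star (P \<omega>) * P \<omega>)) \<partial>M)"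
      by (rule integral_complex_of_real)
    also have "\<dots> \<in> \<real>\<^sub>\<ge>\<^sub>0"
      using state_positive by (auto intro!: integral_nonneg_AE AE_I2 simp: complex_nonneg_Reals_iff)
    finally show ?thesis .
  qed
  have one: "mo 0 = 1"
    using time_changed_moment_eq(2)[where L = L and t = t and l = 0, OF B L nonneg]
    by (simp add: mo_def M.prob_space)
  show "nc_prob_space Polynomial.smult (map_poly cnj) ?S"
  proof
    show "map_poly cnj (map_poly cnj p) = p" for p
      by (rule poly_eqI) (simp add: coeff_map_poly)
    show "map_poly cnj (p + q) = map_poly cnj p + map_poly cnj q" for p q
      by (rule poly_eqI) (simp add: coeff_map_poly)
    show "map_poly cnj (Polynomial.smult c p) = Polynomial.smult (cnj c) (map_poly cnj p)" for c p
      by (rule poly_eqI) (simp add: coeff_map_poly)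
    show "map_poly cnj (p * q) = map_poly cnj q * map_poly cnj p" for p q
      by (subst mult.commute) (rule poly_eqI, simp add: coeff_map_poly coeff_mult)
    show "?S (p + q) = ?S p + ?S q" for p q by (rule add)
    show "?S (Polynomial.smult c p) = c * ?S p" for c p
      using S[of "Polynomial.smult c p" "degree p"] S[of p "degree p"]
      by (simp add: degree_smult_le sum_distrib_left mult.assoc)
    show "?S 1 = 1"
      using monom[of 1 0] one by (simp add: monom_eq_1)
    show "?S (map_poly cnj p * p) \<in> \<real>\<^sub>\<ge>\<^sub>0" for p by (rule pos)
  qed (simp_all add: smult_add_right smult_add_left)
qed

end

section \<open>Gaussian mixtures\<close>

lemma integral_std_normal_power: "(\<integral>z. z ^ l \<partial>std_normal_distribution) = real (gauss_moment l)"
proof -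
  have odd: "gauss_moment (2 * k + 1) = 0" for k
    by (induction k) auto
  have even: "real (gauss_moment (2 * k)) = fact (2 * k) / (2 ^ k * fact k)" for k
  proof (induction k)
    case (Suc k)
    have "real (gauss_moment (2 * Suc k)) = real (2 * k + 1) * (fact (2 * k) / (2 ^ k * fact k))"
      using Suc by (simp add: distrib_right add_divide_distrib)
    also have "\<dots> = (2 * real (Suc k)) * (real (2 * k + 1) * fact (2 * k)) / ((2 * real (Suc k)) * (2 ^ k * fact k))"
      by (simp del: of_nat_Suc)
    also have "\<dots> = fact (2 * Suc k) / (2 ^ Suc k * fact (Suc k))"
      by (simp add: algebra_simps)
    finally show ?case .
  qed simp
  show ?thesis
  proof (cases "even l")
    case True
    then obtain k where "l = 2 * k" by blast
    then show ?thesis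
      using std_normal_distribution_even_moments(1)[of k] even[of k] by simp
  next
    case False
    then obtain k where "l = 2 * k + 1" by (rule oddE)
    then show ?thesis
      using integral_std_normal_distribution_moment_odd[of l] odd[of k] False by simp
  qed
qed

text \<open>The law of a Brownian motion at an independent random time \<open>T\<close>, obtained as
  the square root of \<open>T\<close> times an independent standard normal variable; no Brownian
  motion on \<open>M\<close> is involved.\<close>

definition gauss_mixture :: "'a measure \<Rightarrow> ('a \<Rightarrow> real) \<Rightarrow> real measure" where
  "gauss_mixture M T = distr (M \<Otimes>\<^sub>M std_normal_distribution) borel (\<lambda>(\<omega>, z). sqrt (T \<omega>) * z)"

context prob_space
begin

context
  fixes T :: "'a \<Rightarrow> real"
  assumes T [measurable]: "T \<in> borel_measurable M"
    and nonneg: "\<And>\<omega>. \<omega> \<in> space M \<Longrightarrow> 0 \<le> T \<omega>"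
begin

lemma gauss_mixture_map_measurable:
  "(\<lambda>(\<omega>, z). sqrt (T \<omega>) * z) \<in> borel_measurable (M \<Otimes>\<^sub>M std_normal_distribution)"
  by measurable

lemma real_distribution_gauss_mixture: "real_distribution (gauss_mixture M T)"
proof -
  interpret N: real_distribution std_normal_distribution
    by (rule real_dist_normal_dist)
  interpret P: pair_prob_space M std_normal_distribution ..
  show ?thesis
    unfolding gauss_mixture_def
    by (rule P.real_distribution_distr) (rule gauss_mixture_map_measurable)
qed

lemma char_gauss_mixture:
  "char (gauss_mixture M T) u = expectation (\<lambda>\<omega>. complex_of_real (exp (- u\<^sup>2 * T \<omega> / 2)))"
proof -
  interpret N: real_distribution std_normal_distribution
    by (rule real_dist_normal_dist)
  interpret P: pair_prob_space M std_normal_distribution ..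
  have int: "integrable (M \<Otimes>\<^sub>M std_normal_distribution) (\<lambda>(\<omega>, z). iexp (u * (sqrt (T \<omega>) * z)))"
    by (rule P.integrable_const_bound[of _ 1]) (auto simp: case_prod_beta)
  have "char (gauss_mixture M T) u = (\<integral>x. iexp (u * (case x of (\<omega>, z) \<Rightarrow> sqrt (T \<omega>) * z)) \<partial>(M \<Otimes>\<^sub>M std_normal_distribution))"
    unfolding char_def gauss_mixture_def
    by (rule integral_distr[OF gauss_mixture_map_measurable]) simp
  also have "\<dots> = (\<integral>x. (case x of (\<omega>, z) \<Rightarrow> iexp (u * (sqrt (T \<omega>) * z))) \<partial>(M \<Otimes>\<^sub>M std_normal_distribution))"
    by (simp add: case_prod_beta)
  also have "\<dots> = expectation (\<lambda>\<omega>. \<integral>z. iexp (u * (sqrt (T \<omega>) * z)) \<partial>std_normal_distribution)"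
    using P.integral_fst'[OF int] by simp
  also have "\<dots> = expectation (\<lambda>\<omega>. complex_of_real (exp (- u\<^sup>2 * T \<omega> / 2)))"
  proof (rule Bochner_Integration.integral_cong[OF refl])
    fix \<omega> assume "\<omega> \<in> space M"
    have "(\<integral>z. iexp (u * (sqrt (T \<omega>) * z)) \<partial>std_normal_distribution) = char std_normal_distribution (u * sqrt (T \<omega>))"
      by (simp add: char_def mult.assoc)
    also have "\<dots> = complex_of_real (exp (- u\<^sup>2 * T \<omega> / 2))"
      using nonneg[OF \<open>\<omega> \<in> space M\<close>] by (simp add: char_std_normal_distribution power_mult_distrib)
    finally show "(\<integral>z. iexp (u * (sqrt (T \<omega>) * z)) \<partial>std_normal_distribution) = complex_of_real (exp (- u\<^sup>2 * T \<omega> / 2))" .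
  qed
  finally show ?thesis .
qed

lemma gauss_mixture_moment:
  assumes int: "\<And>m. integrable M (\<lambda>\<omega>. T \<omega> ^ m)"
  shows "integrable (gauss_mixture M T) (\<lambda>x. x ^ l)"
    and "(\<integral>x. x ^ l \<partial>gauss_mixture M T) = expectation (\<lambda>\<omega>. T \<omega> ^ (l div 2)) * real (gauss_moment l)"
proof -
  interpret N: real_distribution std_normal_distribution
    by (rule real_dist_normal_dist)
  interpret P: pair_prob_space M std_normal_distribution ..
  let ?f = "\<lambda>\<omega> z. (sqrt (T \<omega>) * z) ^ l"
  have sq: "integrable M (\<lambda>\<omega>. sqrt (T \<omega>) ^ l)"
  proof (rule Bochner_Integration.integrable_bound)
    show "integrable M (\<lambda>\<omega>. 1 + T \<omega> ^ l)"
      using int by simp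
    show "AE \<omega> in M. norm (sqrt (T \<omega>) ^ l) \<le> norm (1 + T \<omega> ^ l)"
    proof (rule AE_I2)
      fix \<omega> assume "\<omega> \<in> space M"
      then have T0: "0 \<le> T \<omega>" by (rule nonneg)
      \<comment> \<open>For odd \<open>l\<close> the integrand is a half-integer power of
        \<open>T\<close>; this bound reduces it to the integer powers that are known to be
        integrable.\<close>
      have "sqrt (T \<omega>) \<le> max 1 (T \<omega>)"
      proof (cases "T \<omega> \<le> 1")
        case False
        then show ?thesis
          using real_sqrt_le_mono[of "T \<omega>" "(T \<omega>)\<^sup>2"] by (simp add: power2_eq_square)
      qed (simp add: T0)
      then have "sqrt (T \<omega>) ^ l \<le> max 1 (T \<omega>) ^ l"
        using T0 by (intro power_mono) auto
      also have "\<dots> \<le> 1 + T \<omega> ^ l"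
        using T0 by (auto simp: max_def)
      finally show "norm (sqrt (T \<omega>) ^ l) \<le> norm (1 + T \<omega> ^ l)"
        using T0 by simp
    qed
  qed measurable
  have int2: "integrable (M \<Otimes>\<^sub>M std_normal_distribution) (\<lambda>(\<omega>, z). ?f \<omega> z)"
  proof (rule P.Fubini_integrable)
    show "(\<lambda>(\<omega>, z). ?f \<omega> z) \<in> borel_measurable (M \<Otimes>\<^sub>M std_normal_distribution)"
      by measurable
    have "(\<lambda>\<omega>. \<integral>z. norm (?f \<omega> z) \<partial>std_normal_distribution)
        = (\<lambda>\<omega>. \<bar>sqrt (T \<omega>) ^ l\<bar> * (\<integral>z. \<bar>z ^ l\<bar> \<partial>std_normal_distribution))"
      by (simp add: power_mult_distrib abs_mult)
    then show "integrable M (\<lambda>\<omega>. \<integral>z. norm (case (\<omega>, z) of (\<omega>, z) \<Rightarrow> ?f \<omega> z) \<partial>std_normal_distribution)"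
      using integrable_abs[OF sq] by simp
    show "AE \<omega> in M. integrable std_normal_distribution (\<lambda>z. case (\<omega>, z) of (\<omega>, z) \<Rightarrow> ?f \<omega> z)"
      using integrable_std_normal_distribution_moment by (simp add: power_mult_distrib)
  qed
  show "integrable (gauss_mixture M T) (\<lambda>x. x ^ l)"
    unfolding gauss_mixture_def using int2
    by (subst integrable_distr_eq[OF gauss_mixture_map_measurable]) (simp_all add: case_prod_unfold)
  have "(\<integral>x. x ^ l \<partial>gauss_mixture M T) = (\<integral>x. (case x of (\<omega>, z) \<Rightarrow> sqrt (T \<omega>) * z) ^ l \<partial>(M \<Otimes>\<^sub>M std_normal_distribution))"
    unfolding gauss_mixture_def by (rule integral_distr[OF gauss_mixture_map_measurable]) simp
  also have "\<dots> = (\<integral>x. (case x of (\<omega>, z) \<Rightarrow> ?f \<omega> z) \<partial>(M \<Otimes>\<^sub>M std_normal_distribution))"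
    by (simp add: case_prod_beta)
  also have "\<dots> = expectation (\<lambda>\<omega>. \<integral>z. ?f \<omega> z \<partial>std_normal_distribution)"
    using P.integral_fst'[OF int2] by simp
  also have "\<dots> = expectation (\<lambda>\<omega>. T \<omega> ^ (l div 2) * real (gauss_moment l))"
  proof (rule Bochner_Integration.integral_cong[OF refl])
    fix \<omega> assume "\<omega> \<in> space M"
    then have T0: "0 \<le> T \<omega>" by (rule nonneg)
    have "(\<integral>z. ?f \<omega> z \<partial>std_normal_distribution) = sqrt (T \<omega>) ^ l * real (gauss_moment l)"
      by (simp add: power_mult_distrib integral_std_normal_power)
    \<comment> \<open>For odd \<open>l\<close> the two powers of \<open>T\<close> differ, but then
      the Gaussian moment is 0.\<close>
    also have "\<dots> = T \<omega> ^ (l div 2) * real (gauss_moment l)"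
    proof (cases "even l")
      case True
      then obtain k where "l = 2 * k" by blast
      then show ?thesis using T0 by (simp add: power_mult)
    next
      case False
      then show ?thesis
        using integral_std_normal_power[of l] integral_std_normal_distribution_moment_odd[of l] by simp
    qed
    finally show "(\<integral>z. ?f \<omega> z \<partial>std_normal_distribution) = T \<omega> ^ (l div 2) * real (gauss_moment l)" .
  qed
  finally show "(\<integral>x. x ^ l \<partial>gauss_mixture M T) = expectation (\<lambda>\<omega>. T \<omega> ^ (l div 2)) * real (gauss_moment l)"
    by simp
qed

text \<open>The moment of order \<open>2 * m\<close> is the \<open>m\<close>-th moment of
  \<open>T\<close> times \<open>fact (2 * m) / (2 ^ m * fact m)\<close>, so the factorial in the
  criterion cancels. A bound on the moments of \<open>T\<close> of size
  \<open>fact m / c ^ m\<close> for every \<open>c\<close> is then enough.\<close>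

lemma moment_determinate_gauss_mixture:
  assumes int: "\<And>m. integrable M (\<lambda>\<omega>. T \<omega> ^ m)"
    and bound: "\<And>m c. 0 < c \<Longrightarrow> expectation (\<lambda>\<omega>. T \<omega> ^ m) \<le> fact m / c ^ m * E c"
  shows "moment_determinate (gauss_mixture M T)"
  unfolding moment_determinate_def
proof (intro conjI allI impI)
  let ?\<mu> = "gauss_mixture M T"
  interpret mu: real_distribution ?\<mu> by (rule real_distribution_gauss_mixture)
  show "prob_space ?\<mu>" by unfold_locales
  show "sets ?\<mu> = sets borel" by simp
  note mom = gauss_mixture_moment[OF int]
  show "integrable ?\<mu> (\<lambda>x. x ^ l)" for l by (rule mom)
  fix \<nu> :: "real measure"
  assume \<nu>: "prob_space \<nu>" "sets \<nu> = sets borel"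
    "\<forall>l :: nat. integrable \<nu> (\<lambda>x. x ^ l) \<and> (\<integral>x. x ^ l \<partial>\<nu>) = (\<integral>x. x ^ l \<partial>?\<mu>)"
  show "\<nu> = ?\<mu>"
  proof (rule real_distribution_eq_of_moments)
    show "real_distribution ?\<mu>" by (rule real_distribution_gauss_mixture)
    show "real_distribution \<nu>"
      using \<nu> by (simp add: real_distribution_def real_distribution_axioms_def)
    fix u :: real
    \<comment> \<open>A rate \<open>c\<close> at least \<open>u\<^sup>2\<close> leaves a geometric
      factor \<open>(1 / 2) ^ m\<close>; adding 1 keeps \<open>c\<close> positive at
      \<open>u = 0\<close>.\<close>
    define c where "c = u\<^sup>2 + 1"
    have c: "0 < c" by (simp add: c_def add_nonneg_pos)
    have le: "norm (u ^ (2 * m) / fact (2 * m) * (\<integral>x. x ^ (2 * m) \<partial>?\<mu>)) \<le> E c * (1 / 2) ^ m" for m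
    proof -
      have E0: "0 \<le> expectation (\<lambda>\<omega>. T \<omega> ^ m)"
        by (intro integral_nonneg_AE AE_I2) (simp add: nonneg)
      have g: "real (gauss_moment (2 * m)) = fact (2 * m) / (2 ^ m * fact m)"
        using integral_std_normal_power[of "2 * m"] std_normal_distribution_even_moments(1)[of m] by simp
      have "u ^ (2 * m) / fact (2 * m) * (\<integral>x. x ^ (2 * m) \<partial>?\<mu>)
          = (u\<^sup>2 / 2) ^ m * (expectation (\<lambda>\<omega>. T \<omega> ^ m) / fact m)"
        unfolding mom g by (simp add: power_mult power_divide)
      moreover have "\<dots> \<le> (u\<^sup>2 / 2) ^ m * (E c / c ^ m)"
        using bound[OF c, of m] by (intro mult_left_mono) (auto simp: field_simps)
      moreover have "(u\<^sup>2 / 2) ^ m * (E c / c ^ m) = (u\<^sup>2 / c) ^ m * (E c * (1 / 2) ^ m)"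
        by (simp add: power_divide)
      moreover have "\<dots> \<le> 1 * (E c * (1 / 2) ^ m)"
      proof (rule mult_right_mono)
        show "(u\<^sup>2 / c) ^ m \<le> 1"
          using c by (intro power_le_one) (auto simp: c_def)
        have "0 \<le> fact 0 / c ^ 0 * E c"
          by (rule order_trans[OF _ bound[OF c]]) (simp add: prob_space)
        then show "0 \<le> E c * (1 / 2) ^ m" by simp
      qed
      moreover have "0 \<le> (u\<^sup>2 / 2) ^ m * (expectation (\<lambda>\<omega>. T \<omega> ^ m) / fact m)"
        using E0 by simp
      ultimately show ?thesis by simp
    qed
    have lim: "(\<lambda>m. E c * (1 / 2) ^ m) \<longlonglongrightarrow> 0"
      by (intro tendsto_mult_right_zero LIMSEQ_power_zero) simp
    show "(\<lambda>m. u ^ (2 * m) / fact (2 * m) * (\<integral>x. x ^ (2 * m) \<partial>?\<mu>)) \<longlonglongrightarrow> 0"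
      by (rule Lim_null_comparison[OF always_eventually lim]) (rule allI, rule le)
  qed (use \<nu> mom in auto)
qed

end

section \<open>Brownian motion at an independent inverse subordinator\<close>

lemma brownian_motion_char:
  assumes W: "brownian_motion W" and s: "0 \<le> s"
  shows "expectation (\<lambda>\<omega>. iexp (u * W s \<omega>)) = complex_of_real (exp (- u\<^sup>2 * s / 2))"
proof -
  have W0: "AE \<omega> in M. W 0 \<omega> = 0" and [measurable]: "W s \<in> borel_measurable M" "W 0 \<in> borel_measurable M"
    using W s by (auto simp: brownian_motion_def)
  show ?thesis
  proof (cases "s = 0")
    case True
    have "expectation (\<lambda>\<omega>. iexp (u * W s \<omega>)) = expectation (\<lambda>\<omega>. 1)"
      by (rule integral_cong_AE) (use W0 True in auto)
    then show ?thesis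
      using True by (simp add: prob_space)
  next
    case False
    then have pos: "0 < s" "0 < sqrt s" using s by auto
    have "distributed M lborel (\<lambda>\<omega>. W (0 + s) \<omega> - W 0 \<omega>) (normal_density 0 (sqrt s))"
      using W pos unfolding brownian_motion_def by blast
    then have "distributed M lborel (\<lambda>\<omega>. (W s \<omega> - W 0 \<omega>) / sqrt s) std_normal_density"
      using normal_standard_normal_convert[OF pos(2), of "\<lambda>\<omega>. W (0 + s) \<omega> - W 0 \<omega>" 0] by simp
    then have d: "distr M lborel (\<lambda>\<omega>. (W s \<omega> - W 0 \<omega>) / sqrt s) = std_normal_distribution"
      by (rule distributed_distr_eq_density)
    have "expectation (\<lambda>\<omega>. iexp (u * W s \<omega>)) = expectation (\<lambda>\<omega>. iexp (u * sqrt s * ((W s \<omega> - W 0 \<omega>) / sqrt s)))"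
      by (rule integral_cong_AE) (use W0 pos in auto)
    also have "\<dots> = char (distr M lborel (\<lambda>\<omega>. (W s \<omega> - W 0 \<omega>) / sqrt s)) (u * sqrt s)"
      unfolding char_def by (subst integral_distr) auto
    also have "\<dots> = complex_of_real (exp (- u\<^sup>2 * s / 2))"
      unfolding d using s by (simp add: char_std_normal_distribution power_mult_distrib)
    finally show ?thesis .
  qed
qed

text \<open>Averaging the Gaussian characteristic function at time \<open>s\<close> over
  \<open>s = L t\<close> gives that of the mixture. The exponentials \<open>iexp (u * x)\<close> are
  bounded and continuous, as the random time lemma demands.\<close>

lemma time_changed_brownian_motion_law:
  assumes W: "brownian_motion W" and "0 < \<alpha>" and L: "inverse_stable_subordinator \<alpha> L"
    and ind: "indep_families {0..} borel W {0..} borel L" and t: "0 \<le> t"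
  shows "L t \<in> borel_measurable M"
    and "distr M borel (time_change W L t) = gauss_mixture M (L t)"
proof -
  have WL: "indep_var borel (W s) borel (L t)" if "0 \<le> s" for s
    using indep_families_imp_indep_var[OF ind, of "\<lambda>x. x s" borel "\<lambda>x. x t" borel] that t by simp
  show Lm [measurable]: "L t \<in> borel_measurable M"
    using indep_var_rv2[OF WL[OF order_refl]] .
  note nonneg = inverse_stable_subordinator_nonneg[OF \<open>0 < \<alpha>\<close> L t]
  have rc: "continuous (at_right s) (\<lambda>s. W s \<omega>)" if "\<omega> \<in> space M" "0 \<le> s" for \<omega> s
  proof -
    have "continuous_on {0..} (\<lambda>s. W s \<omega>)"
      using W that by (simp add: brownian_motion_def)
    then have "continuous (at s within {0..}) (\<lambda>s. W s \<omega>)"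
      using that by (simp add: continuous_on_eq_continuous_within)
    then show ?thesis
      by (rule continuous_within_subset) (use that in auto)
  qed
  have bounded: "norm (iexp (u * x)) \<le> 1" for u x :: real
    by simp
  have cont: "continuous_on UNIV (\<lambda>x. iexp (u * x))" for u :: real
    by (intro continuous_intros)
  note res = expectation_independent_time[OF WL rc nonneg cont bounded]
  have meas [measurable]: "time_change W L t \<in> borel_measurable M"
    using res(1) by (simp add: time_change_def[abs_def])
  show "distr M borel (time_change W L t) = gauss_mixture M (L t)"
  proof (rule Levy_uniqueness)
    show "real_distribution (distr M borel (time_change W L t))"
      by (simp add: real_distribution_distr)
    show "real_distribution (gauss_mixture M (L t))"
      by (rule real_distribution_gauss_mixture[OF Lm nonneg])
    show "char (distr M borel (time_change W L t)) = char (gauss_mixture M (L t))"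
    proof
      fix u
      have "char (distr M borel (time_change W L t)) u = expectation (\<lambda>\<omega>. iexp (u * W (L t \<omega>) \<omega>))"
        unfolding char_def by (subst integral_distr) (auto simp: time_change_def)
      also have "\<dots> = expectation (\<lambda>\<omega>. expectation (\<lambda>\<omega>'. iexp (u * W (L t \<omega>) \<omega>')))"
        by (rule res(2))
      also have "\<dots> = expectation (\<lambda>\<omega>. complex_of_real (exp (- u\<^sup>2 * L t \<omega> / 2)))"
        by (rule Bochner_Integration.integral_cong[OF refl]) (rule brownian_motion_char[OF W nonneg])
      also have "\<dots> = char (gauss_mixture M (L t)) u"
        by (rule char_gauss_mixture[OF Lm nonneg, symmetric])
      finally show "char (distr M borel (time_change W L t)) u = char (gauss_mixture M (L t)) u" .
    qed
  qed
qed

end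

lemma gauss_mixture_cong_law:
  assumes M: "prob_space M" and M': "prob_space M'"
    and [measurable]: "T \<in> borel_measurable M" "T' \<in> borel_measurable M'"
    and nonneg: "\<And>\<omega>. \<omega> \<in> space M \<Longrightarrow> 0 \<le> T \<omega>" "\<And>\<omega>. \<omega> \<in> space M' \<Longrightarrow> 0 \<le> T' \<omega>"
    and law: "distr M' borel T' = distr M borel T"
  shows "gauss_mixture M' T' = gauss_mixture M T"
proof (rule Levy_uniqueness)
  show "real_distribution (gauss_mixture M T)" "real_distribution (gauss_mixture M' T')"
    using prob_space.real_distribution_gauss_mixture[OF M _ nonneg(1)]
      prob_space.real_distribution_gauss_mixture[OF M' _ nonneg(2)] by simp_all
  show "char (gauss_mixture M' T') = char (gauss_mixture M T)"
  proof
    fix u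
    let ?h = "\<lambda>x. complex_of_real (exp (- u\<^sup>2 * x / 2))"
    have "char (gauss_mixture M' T') u = (\<integral>x. ?h x \<partial>distr M' borel T')"
      by (subst prob_space.char_gauss_mixture[OF M' _ nonneg(2)]) (simp_all add: integral_distr)
    also have "\<dots> = (\<integral>x. ?h x \<partial>distr M borel T)"
      by (simp only: law)
    also have "\<dots> = char (gauss_mixture M T) u"
      by (subst prob_space.char_gauss_mixture[OF M _ nonneg(1)]) (simp_all add: integral_distr)
    finally show "char (gauss_mixture M' T') u = char (gauss_mixture M T) u" .
  qed
qed

theorem corollary4p1:
  fixes M :: "'a measure"
    and \<alpha> t :: real
    and X2 :: "nat \<times> nat \<Rightarrow> nat \<Rightarrow> 'a \<Rightarrow> real"
    and X1 :: "nat \<Rightarrow> nat \<Rightarrow> 'a \<Rightarrow> real"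
    and N N\<alpha> :: "real \<Rightarrow> 'a \<Rightarrow> nat"
    and L :: "real \<Rightarrow> 'a \<Rightarrow> real"
    and A2 A1 :: "nat \<Rightarrow> 'a \<Rightarrow> complex mat"
  defines "N\<alpha> \<equiv> time_change N L"
    and "A2 \<equiv> \<lambda>n. normalized_link_matrix \<alpha> link2 X2 N\<alpha> n t"
    and "A1 \<equiv> \<lambda>n. normalized_link_matrix \<alpha> link1 X1 N\<alpha> n t"
  assumes "prob_space M" and "0 < \<alpha>" and "\<alpha> \<le> 1" and "0 \<le> t"
    and "prob_space.inverse_stable_subordinator M \<alpha> L"
    and "prob_space.poisson_process M N"
    and "prob_space.indep_families M {0..} (count_space UNIV) N {0..} borel L"
    and "prob_space.assumption_I M X2 X1"
    and "prob_space.indep_families M input_index borel (input_family X2 X1)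
           {0..} (count_space UNIV) N\<alpha>"
  shows
    "((\<forall>n. A2 n \<in> random_matrix_algebra M n) \<and>
      (\<forall>(scaleC :: complex \<Rightarrow> 'b :: ring_1 \<Rightarrow> 'b) star \<tau> B.
         nc_prob_space scaleC star \<tau> \<longrightarrow>
         nc_prob_space.free_brownian_motion scaleC star \<tau> B \<longrightarrow>
         nc_prob_space Polynomial.smult (map_poly cnj) (time_changed_state M L \<tau> B t) \<and>
         (\<forall>l\<ge>1. (\<lambda>n. tau_n M n (\<lambda>\<omega>. A2 n \<omega> ^\<^sub>m l))
                   \<longlonglongrightarrow> time_changed_state M L \<tau> B t (monom 1 l)))) \<and>
     ((\<forall>n. A1 n \<in> random_matrix_algebra M n) \<and>
      (\<exists>\<mu>. moment_determinate \<mu> \<and>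
         (\<forall>l\<ge>1. (\<lambda>n. tau_n M n (\<lambda>\<omega>. A1 n \<omega> ^\<^sub>m l))
                   \<longlonglongrightarrow> complex_of_real (\<integral>x. x ^ l \<partial>\<mu>)) \<and>
         (\<forall>(M' :: 'c measure) W L'.
            prob_space M' \<longrightarrow>
            prob_space.brownian_motion M' W \<longrightarrow>
            prob_space.inverse_stable_subordinator M' \<alpha> L' \<longrightarrow>
            prob_space.indep_families M' {0..} borel W {0..} borel L' \<longrightarrow>
            distr M' borel (time_change W L' t) = \<mu>)))"
proof -
  interpret prob_space M by fact
  note \<alpha> = \<open>0 < \<alpha>\<close> and t = \<open>0 \<le> t\<close>
  note L = \<open>inverse_stable_subordinator \<alpha> L\<close> and N = \<open>poisson_process N\<close>
  note NL = \<open>indep_families {0..} (count_space UNIV) N {0..} borel L\<close>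
  note input = \<open>assumption_I X2 X1\<close>
  note ind = \<open>indep_families input_index borel (input_family X2 X1) {0..} (count_space UNIV) N\<alpha>\<close>
  \<comment> \<open>Measurability of \<open>L t\<close> is read off from the independence of
    \<open>N\<close> and \<open>L\<close>.\<close>
  have Lm [measurable]: "L t \<in> borel_measurable M"
    using indep_var_rv2[OF indep_families_imp_indep_var[OF NL _ _, of "\<lambda>_. 0" borel "\<lambda>x. x t" borel]] t by simp
  note nonneg = inverse_stable_subordinator_nonneg[OF \<alpha> L t]
  note Lint = inverse_stable_subordinator_power(1)[OF \<alpha> L t Lm]
  have r: "0 \<le> real n * t" for n using t by simp
  define K where "K n = N\<alpha> (real n * t)" for n
  note frac = fractional_poisson_moments[OF \<alpha> L N NL t, folded N\<alpha>_def]
  have Klim: "(\<lambda>n. expectation (\<lambda>\<omega>. real (K n \<omega>) ^ m) / (real n powr \<alpha>) ^ m) \<longlonglongrightarrow> expectation (\<lambda>\<omega>. L t \<omega> ^ m)" for m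
    unfolding K_def by (rule frac(3))
  have f2: "(Inl (c, r) :: (nat \<times> nat) \<times> nat + nat \<times> nat) \<in> input_index" if "1 \<le> r" for c r
    unfolding input_index_def using that by (intro InlI) auto
  have f1: "(Inr (c, r) :: (nat \<times> nat) \<times> nat + nat \<times> nat) \<in> input_index" if "1 \<le> r" for c r
    unfolding input_index_def using that by (intro InrI) auto
  interpret W2: walk_family M X2
  proof (rule walk_family_input[OF input, where f = Inl])
    show "\<exists>i j. \<forall>r \<omega> q. \<bar>X2 c r \<omega>\<bar> ^ q \<le> \<bar>X2 (i, j) r \<omega>\<bar> ^ q + \<bar>X1 i r \<omega>\<bar> ^ q" for c
      by (rule exI[of _ "fst c"], rule exI[of _ "snd c"]) simp
  qed (simp_all add: f2 input_family_def)
  interpret W1: walk_family M X1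
  proof (rule walk_family_input[OF input, where f = Inr])
    show "\<exists>i j. \<forall>r \<omega> q. \<bar>X1 c r \<omega>\<bar> ^ q \<le> \<bar>X2 (i, j) r \<omega>\<bar> ^ q + \<bar>X1 i r \<omega>\<bar> ^ q" for c
      by (rule exI[of _ c]) simp
  qed (simp_all add: f1 input_family_def)
  have sw2: "stopped_walks M X2 (K n)" for n
    unfolding K_def
    by (rule stopped_walks_input[OF W2.walk_family_axioms ind r, where f = Inl])
       (simp_all add: f2 input_family_def frac)
  have sw1: "stopped_walks M X1 (K n)" for n
    unfolding K_def
    by (rule stopped_walks_input[OF W1.walk_family_axioms ind r, where f = Inr])
       (simp_all add: f1 input_family_def frac)
  have alg2: "A2 n \<in> random_matrix_algebra M n" for n
    unfolding A2_def by (rule stopped_walks.normalized_link_matrix_in_algebra[OF sw2[of n]]) (rule K_def)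
  have alg1: "A1 n \<in> random_matrix_algebra M n" for n
    unfolding A1_def by (rule stopped_walks.normalized_link_matrix_in_algebra[OF sw1[of n]]) (rule K_def)
  have lim2: "(\<lambda>n. tau_n M n (\<lambda>\<omega>. A2 n \<omega> ^\<^sub>m l))
      \<longlonglongrightarrow> complex_of_real (expectation (\<lambda>\<omega>. L t \<omega> ^ (l div 2)) * real (dyck_count 0 l))" for l
  proof -
    let ?w = "\<lambda>n (j, xs). trail j xs"
    let ?v = "expectation (\<lambda>\<omega>. L t \<omega> ^ (l div 2))"
    have split: "{s \<in> closed_walks l n. P (case s of (j, xs) \<Rightarrow> trail j xs)}
        = {(j, xs) \<in> closed_walks l n. P (trail j xs)}" for n P
      by auto
    have "(\<lambda>n. (\<Sum>s\<in>closed_walks l n. expectation (\<lambda>\<omega>. W2.word (?w n s) (K n \<omega>) \<omega>))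
        * real n powr (- \<alpha> * l / 2) / real n powr (1 + l / 2)) \<longlonglongrightarrow> real (dyck_count 0 l) * ?v"
    proof (rule W2.words_limit[OF sw2 \<alpha> Klim finite_closed_walks])
      show "length (?w n s) = l" if "s \<in> closed_walks l n" for n s
        using that by (auto simp: closed_walks_def)
      show "(\<lambda>n. card {s \<in> closed_walks l n. \<forall>c\<in>set (?w n s). count_list (?w n s) c = 2} / real n powr (1 + l / 2))
          \<longlonglongrightarrow> real (dyck_count 0 l)"
        using closed_walks_limits(1)[of l] unfolding split[of _ "\<lambda>w. \<forall>c\<in>set w. count_list w c = 2"] .
      show "(\<lambda>n. card {s \<in> closed_walks l n. (\<forall>c. count_list (?w n s) c \<noteq> 1) \<and> \<not> (\<forall>c\<in>set (?w n s). count_list (?w n s) c = 2)}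
          / real n powr (1 + l / 2)) \<longlonglongrightarrow> 0"
        using closed_walks_limits(2)[of l]
        unfolding split[of _ "\<lambda>w. (\<forall>c. count_list w c \<noteq> 1) \<and> \<not> (\<forall>c\<in>set w. count_list w c = 2)"] .
    qed
    then have "(\<lambda>n. complex_of_real ((\<Sum>s\<in>closed_walks l n. expectation (\<lambda>\<omega>. W2.word (?w n s) (K n \<omega>) \<omega>))
        * real n powr (- \<alpha> * l / 2) / real n powr (1 + l / 2))) \<longlonglongrightarrow> complex_of_real (?v * real (dyck_count 0 l))"
      unfolding mult.commute[of ?v] by (rule tendsto_of_real)
    then show ?thesis
    proof (rule Lim_transform_eventually, intro eventually_sequentiallyI[of 1])
      fix n :: nat assume n: "1 \<le> n"
      show "complex_of_real ((\<Sum>s\<in>closed_walks l n. expectation (\<lambda>\<omega>. W2.word (?w n s) (K n \<omega>) \<omega>))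
          * real n powr (- \<alpha> * l / 2) / real n powr (1 + l / 2)) = tau_n M n (\<lambda>\<omega>. A2 n \<omega> ^\<^sub>m l)"
        unfolding A2_def
        by (rule stopped_walks.tau_n_power[where N = N\<alpha> and n = n and t = t, OF sw2[of n] K_def[of n], symmetric])
           (use n in \<open>auto simp: closed_walks_def mat_trace_pow_link2 case_prod_beta\<close>)
    qed
  qed
  have lim1: "(\<lambda>n. tau_n M n (\<lambda>\<omega>. A1 n \<omega> ^\<^sub>m l))
      \<longlonglongrightarrow> complex_of_real (expectation (\<lambda>\<omega>. L t \<omega> ^ (l div 2)) * real (gauss_moment l))" for l
  proof -
    let ?w = "\<lambda>n (j, ds). map (cycle_dist n) ds"
    let ?v = "expectation (\<lambda>\<omega>. L t \<omega> ^ (l div 2))"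
    have split: "{s \<in> closed_steps l n. P (case s of (j, ds) \<Rightarrow> map (cycle_dist n) ds)}
        = {(j, ds) \<in> closed_steps l n. P (map (cycle_dist n) ds)}" for n P
      by auto
    have "(\<lambda>n. (\<Sum>s\<in>closed_steps l n. expectation (\<lambda>\<omega>. W1.word (?w n s) (K n \<omega>) \<omega>))
        * real n powr (- \<alpha> * l / 2) / real n powr (1 + l / 2)) \<longlonglongrightarrow> real (gauss_moment l) * ?v"
    proof (rule W1.words_limit[OF sw1 \<alpha> Klim finite_closed_steps])
      show "length (?w n s) = l" if "s \<in> closed_steps l n" for n s
        using that by (auto simp: closed_steps_def)
      show "(\<lambda>n. card {s \<in> closed_steps l n. \<forall>c\<in>set (?w n s). count_list (?w n s) c = 2} / real n powr (1 + l / 2))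
          \<longlonglongrightarrow> real (gauss_moment l)"
        using closed_steps_limits(1)[of l] unfolding split[of _ "\<lambda>w. \<forall>c\<in>set w. count_list w c = 2"] .
      show "(\<lambda>n. card {s \<in> closed_steps l n. (\<forall>c. count_list (?w n s) c \<noteq> 1) \<and> \<not> (\<forall>c\<in>set (?w n s). count_list (?w n s) c = 2)}
          / real n powr (1 + l / 2)) \<longlonglongrightarrow> 0"
        using closed_steps_limits(2)[of l]
        unfolding split[of _ "\<lambda>w. (\<forall>c. count_list w c \<noteq> 1) \<and> \<not> (\<forall>c\<in>set w. count_list w c = 2)"] .
    qed
    then have "(\<lambda>n. complex_of_real ((\<Sum>s\<in>closed_steps l n. expectation (\<lambda>\<omega>. W1.word (?w n s) (K n \<omega>) \<omega>))
        * real n powr (- \<alpha> * l / 2) / real n powr (1 + l / 2))) \<longlonglongrightarrow> complex_of_real (?v * real (gauss_moment l))"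
      unfolding mult.commute[of ?v] by (rule tendsto_of_real)
    then show ?thesis
    proof (rule Lim_transform_eventually, intro eventually_sequentiallyI[of 1])
      fix n :: nat assume n: "1 \<le> n"
      show "complex_of_real ((\<Sum>s\<in>closed_steps l n. expectation (\<lambda>\<omega>. W1.word (?w n s) (K n \<omega>) \<omega>))
          * real n powr (- \<alpha> * l / 2) / real n powr (1 + l / 2)) = tau_n M n (\<lambda>\<omega>. A1 n \<omega> ^\<^sub>m l)"
        unfolding A1_def
        by (rule stopped_walks.tau_n_power[where N = N\<alpha> and n = n and t = t, OF sw1[of n] K_def[of n], symmetric])
           (use n in \<open>auto simp: closed_steps_def mat_trace_pow_link1 case_prod_beta\<close>)
    qed
  qed
  have part_i: "nc_prob_space Polynomial.smult (map_poly cnj) (time_changed_state M L \<tau> B t) \<and>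
      (\<forall>l\<ge>1. (\<lambda>n. tau_n M n (\<lambda>\<omega>. A2 n \<omega> ^\<^sub>m l)) \<longlonglongrightarrow> time_changed_state M L \<tau> B t (monom 1 l))"
    if "nc_prob_space scaleC star \<tau>" and B: "nc_prob_space.free_brownian_motion scaleC star \<tau> B"
    for scaleC :: "complex \<Rightarrow> 'b \<Rightarrow> 'b" and star \<tau> B
  proof -
    interpret nc: nc_prob_space scaleC star \<tau> by fact
    show ?thesis
      using nc.nc_prob_space_time_changed_state[where L = L and t = t, OF B prob_space_axioms Lm nonneg Lint] lim2
        nc.time_changed_moment_eq(2)[where L = L and t = t, OF B Lm nonneg]
      by simp
  qed
  \<comment> \<open>The limit law is built on \<open>M\<close> alone, so the same measure serves
    every space \<open>M'\<close>.\<close>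
  let ?\<mu> = "gauss_mixture M (L t)"
  have det: "moment_determinate ?\<mu>"
    by (rule moment_determinate_gauss_mixture[OF Lm nonneg Lint
          inverse_stable_subordinator_power(2)[OF \<alpha> L t Lm]])
  have lim_\<mu>: "(\<lambda>n. tau_n M n (\<lambda>\<omega>. A1 n \<omega> ^\<^sub>m l)) \<longlonglongrightarrow> complex_of_real (\<integral>x. x ^ l \<partial>?\<mu>)" for l
  proof -
    have eq: "(\<integral>x. x ^ l \<partial>?\<mu>) = expectation (\<lambda>\<omega>. L t \<omega> ^ (l div 2)) * real (gauss_moment l)"
      by (rule gauss_mixture_moment(2)[OF Lm nonneg Lint])
    show ?thesis
      unfolding eq by (rule lim1)
  qed
  have law: "distr M' borel (time_change W L' t) = ?\<mu>"
    if M': "prob_space M'" and W: "prob_space.brownian_motion M' W"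
      and L': "prob_space.inverse_stable_subordinator M' \<alpha> L'"
      and WL': "prob_space.indep_families M' {0..} borel W {0..} borel L'"
    for M' :: "'c measure" and W L'
  proof -
    interpret M': prob_space M' by (rule M')
    note res = M'.time_changed_brownian_motion_law[OF W \<alpha> L' WL' t]
    \<comment> \<open>Scaling by 1 between two spaces: the law of the inverse subordinator at time
      \<open>t\<close> is the same on both.\<close>
    have "distr M' borel (L' (1 * t)) = distr M borel (\<lambda>\<omega>. 1 powr \<alpha> * L t \<omega>)"
      by (rule inverse_stable_subordinator_scaling[OF prob_space_axioms M' \<alpha> L L' _ t]) (use res(1) in simp_all)
    then have "distr M' borel (L' t) = distr M borel (L t)"
      by simp
    then have "gauss_mixture M' (L' t) = ?\<mu>"
      by (intro gauss_mixture_cong_law[OF prob_space_axioms M' Lm res(1) nonneg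
            M'.inverse_stable_subordinator_nonneg[OF \<alpha> L' t]])
    then show ?thesis
      using res(2) by simp
  qed
  show ?thesis
    using alg2 alg1 part_i det lim_\<mu> law by blast
qed

end
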